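(* There does not exist a $G$-equivariant holomorphic embedding of $L\mathbb{P}_1$ into a projectivized Banach/Fréchet space.
   Context: Fix a smoothness class $C^k$ ($k=1,2,\dots,\infty$) or Sobolev class $W^{k,p}$ ($k=1,2,\dots$, $1\le p<\infty$). $L\mathbb{P}_1$ is the complex Banach/Fréchet manifold of all maps $S^1\to\mathbb{P}_1$ of this class. $G\simeq PGL(2,\mathbb{C})$ is the group of holomorphic automorphisms of $\mathbb{P}_1$; it acts on $L\mathbb{P}_1$ by $(gx)(t)=g(x(t))$. A projectivized Banach/Fréchet space is the projective space $\mathbb{P}(V)$ of lines in a complex Banach or Fréchet space $V$. A holomorphic embedding $\epsilon:L\mathbb{P}_1\to\mathbb{P}(V)$ is $G$-equivariant if $\epsilon(gx)=g\,\epsilon(x)$ for some action of $G$ on $\mathbb{P}(V)$ by projectivizations of continuous linear automorphisms of $V$. *)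

theory Defs
  imports
    "HOL-Analysis.Analysis"
    "HOL-Algebra.Group_Action"
    "HOL-Library.Function_Algebras"
    "HOL-Library.Extended_Nat"
begin

section \<open>Complex locally convex spaces\<close>

text \<open>
  A complex topological vector space is a pair of a scalar multiplication and a topology whose
  underlying set \<^term>\<open>topspace T\<close> is a complex subspace of the ambient type.  Carriers are explicit
  because the model space of the loop space depends on the smoothness class.
\<close>

definition complex_seminorm_on :: "(complex \<Rightarrow> 'a \<Rightarrow> 'a) \<Rightarrow> 'a set \<Rightarrow> ('a::ab_group_add \<Rightarrow> real) \<Rightarrow> bool"
  where "complex_seminorm_on sc E p \<longleftrightarrow>
    (\<forall>x\<in>E. 0 \<le> p x) \<and>
    (\<forall>x\<in>E. \<forall>y\<in>E. p (x + y) \<le> p x + p y) \<and>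
    (\<forall>c. \<forall>x\<in>E. p (sc c x) = cmod c * p x)"

definition seminorm_topology :: "'a set \<Rightarrow> ('a::ab_group_add \<Rightarrow> real) set \<Rightarrow> 'a topology"
  where "seminorm_topology E P =
    topology_generated_by {{y\<in>E. p (y - x) < e} | p x e. p \<in> P \<and> x \<in> E \<and> 0 < e}"

text \<open>A complex Banach space is the special case in which all seminorms \<open>P n\<close> are one and the
  same complete norm.\<close>

definition complex_frechet_space :: "(complex \<Rightarrow> 'a \<Rightarrow> 'a) \<Rightarrow> 'a::ab_group_add topology \<Rightarrow> bool"
  where "complex_frechet_space sc T \<longleftrightarrow>
    vector_space sc \<and> Modules.module.subspace sc (topspace T) \<and>
    (\<exists>P :: nat \<Rightarrow> 'a \<Rightarrow> real.
      (\<forall>n. complex_seminorm_on sc (topspace T) (P n)) \<and>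
      (\<forall>x\<in>topspace T. (\<forall>n. P n x = 0) \<longrightarrow> x = 0) \<and>
      T = seminorm_topology (topspace T) (range P) \<and>
      (\<forall>u :: nat \<Rightarrow> 'a. range u \<subseteq> topspace T \<and>
          (\<forall>n. \<forall>e>0. \<exists>N. \<forall>i\<ge>N. \<forall>j\<ge>N. P n (u i - u j) < e) \<longrightarrow>
        (\<exists>l\<in>topspace T. \<forall>n. (\<lambda>i. P n (u i - l)) \<longlonglongrightarrow> 0)))"

definition clinear_on ::
    "(complex \<Rightarrow> 'a \<Rightarrow> 'a) \<Rightarrow> (complex \<Rightarrow> 'b \<Rightarrow> 'b) \<Rightarrow> 'a::ab_group_add set \<Rightarrow> ('a \<Rightarrow> 'b::ab_group_add) \<Rightarrow> bool"
  where "clinear_on sc sc' E f \<longleftrightarrow>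
    (\<forall>x\<in>E. \<forall>y\<in>E. f (x + y) = f x + f y) \<and> (\<forall>c. \<forall>x\<in>E. f (sc c x) = sc' c (f x))"

definition continuous_functional :: "(complex \<Rightarrow> 'a \<Rightarrow> 'a) \<Rightarrow> 'a::ab_group_add topology \<Rightarrow> ('a \<Rightarrow> complex) \<Rightarrow> bool"
  where "continuous_functional sc T l \<longleftrightarrow>
    clinear_on sc (*) (topspace T) l \<and> continuous_map T euclidean l"

definition linear_automorphism :: "(complex \<Rightarrow> 'a \<Rightarrow> 'a) \<Rightarrow> 'a::ab_group_add topology \<Rightarrow> ('a \<Rightarrow> 'a) \<Rightarrow> bool"
  where "linear_automorphism sc T A \<longleftrightarrow>
    clinear_on sc sc (topspace T) A \<and> homeomorphic_map T T A"


section \<open>Holomorphic maps between open sets of complex locally convex spaces\<close>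

definition has_directional_derivative ::
    "(complex \<Rightarrow> 'a \<Rightarrow> 'a) \<Rightarrow> (complex \<Rightarrow> 'b \<Rightarrow> 'b) \<Rightarrow> 'b topology
      \<Rightarrow> ('a::ab_group_add \<Rightarrow> 'b::ab_group_add) \<Rightarrow> 'a \<Rightarrow> 'a \<Rightarrow> 'b \<Rightarrow> bool"
  where "has_directional_derivative sc sc' S f x \<xi> \<eta> \<longleftrightarrow>
    limitin S (\<lambda>h::real. sc' (of_real (1 / h)) (f (x + sc (of_real h) \<xi>) - f x)) \<eta> (at 0)"

text \<open>Holomorphic means \<open>C\<^sup>1\<close> (the directional derivatives exist and depend continuously on the
  point and the direction jointly) with complex linear differential.\<close>

definition holomorphic_between ::
    "(complex \<Rightarrow> 'a \<Rightarrow> 'a) \<Rightarrow> 'a topology \<Rightarrow> (complex \<Rightarrow> 'b \<Rightarrow> 'b) \<Rightarrow> 'b topology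
      \<Rightarrow> 'a set \<Rightarrow> ('a::ab_group_add \<Rightarrow> 'b::ab_group_add) \<Rightarrow> bool"
  where "holomorphic_between sc T sc' S D f \<longleftrightarrow>
    openin T D \<and> continuous_map (subtopology T D) S f \<and>
    (\<exists>df :: 'a \<Rightarrow> 'a \<Rightarrow> 'b.
      (\<forall>x\<in>D. \<forall>\<xi>\<in>topspace T. has_directional_derivative sc sc' S f x \<xi> (df x \<xi>)) \<and>
      (\<forall>x\<in>D. clinear_on sc sc' (topspace T) (df x)) \<and>
      continuous_map (prod_topology (subtopology T D) T) S (\<lambda>(x, \<xi>). df x \<xi>))"


section \<open>Complex manifolds given by parametrizations\<close>

text \<open>
  A manifold is a set \<open>M\<close> of points with a collection \<open>A\<close> of pairs \<open>(T, \<phi>)\<close>, where \<open>\<phi>\<close> is an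
  inverse chart, defined on the whole model space \<^term>\<open>topspace T\<close>.  All inverse charts used below
  are defined on a whole vector space.
\<close>

definition manifold_topology :: "'m set \<Rightarrow> ('e topology \<times> ('e \<Rightarrow> 'm)) set \<Rightarrow> 'm topology"
  where "manifold_topology M A =
    topology (\<lambda>U. U \<subseteq> M \<and> (\<forall>(T, \<phi>)\<in>A. openin T {e\<in>topspace T. \<phi> e \<in> U}))"

lemma openin_manifold_topology:
  "openin (manifold_topology M A) U \<longleftrightarrow>
    U \<subseteq> M \<and> (\<forall>(T, \<phi>)\<in>A. openin T {e\<in>topspace T. \<phi> e \<in> U})"
proof -
  have "istopology (\<lambda>U. U \<subseteq> M \<and> (\<forall>(T, \<phi>)\<in>A. openin T {e\<in>topspace T. \<phi> e \<in> U}))"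
    unfolding istopology_def
  proof (intro conjI allI impI)
    fix U V assume U: "U \<subseteq> M \<and> (\<forall>(T, \<phi>)\<in>A. openin T {e\<in>topspace T. \<phi> e \<in> U})"
      and V: "V \<subseteq> M \<and> (\<forall>(T, \<phi>)\<in>A. openin T {e\<in>topspace T. \<phi> e \<in> V})"
    show "U \<inter> V \<subseteq> M" using U by blast
    have "{e\<in>topspace T. \<phi> e \<in> U \<inter> V} =
        {e\<in>topspace T. \<phi> e \<in> U} \<inter> {e\<in>topspace T. \<phi> e \<in> V}" for T and \<phi> :: "'b \<Rightarrow> 'a"
      by blast
    then show "\<forall>(T, \<phi>)\<in>A. openin T {e\<in>topspace T. \<phi> e \<in> U \<inter> V}"
      using U V by fastforce
  next
    fix K assume K: "\<forall>U\<in>K. U \<subseteq> M \<and> (\<forall>(T, \<phi>)\<in>A. openin T {e\<in>topspace T. \<phi> e \<in> U})"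
    show "\<Union>K \<subseteq> M" using K by blast
    have "{e\<in>topspace T. \<phi> e \<in> \<Union>K} = (\<Union>U\<in>K. {e\<in>topspace T. \<phi> e \<in> U})"
      for T and \<phi> :: "'b \<Rightarrow> 'a"
      by blast
    then show "\<forall>(T, \<phi>)\<in>A. openin T {e\<in>topspace T. \<phi> e \<in> \<Union>K}"
      using K by (fastforce intro: openin_Union)
  qed
  then show ?thesis
    by (simp add: manifold_topology_def topology_inverse')
qed

lemma topspace_manifold_topology:
  assumes "\<And>T \<phi> e. (T, \<phi>) \<in> A \<Longrightarrow> e \<in> topspace T \<Longrightarrow> \<phi> e \<in> M"
  shows "topspace (manifold_topology M A) = M"
proof -
  have "{e\<in>topspace T. \<phi> e \<in> M} = topspace T" if "(T, \<phi>) \<in> A" for T \<phi>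
    using assms that by blast
  then have "openin (manifold_topology M A) M"
    by (fastforce simp: openin_manifold_topology)
  then show ?thesis
    by (metis openin_manifold_topology openin_subset openin_topspace subset_antisym)
qed

definition chart_domain :: "('e topology \<times> ('e \<Rightarrow> 'm)) \<Rightarrow> ('f topology \<times> ('f \<Rightarrow> 'n)) \<Rightarrow> ('m \<Rightarrow> 'n) \<Rightarrow> 'e set"
  where "chart_domain a b F =
    {e\<in>topspace (fst a). F (snd a e) \<in> snd b ` topspace (fst b)}"

definition in_charts :: "('e topology \<times> ('e \<Rightarrow> 'm)) \<Rightarrow> ('f topology \<times> ('f \<Rightarrow> 'n)) \<Rightarrow> ('m \<Rightarrow> 'n) \<Rightarrow> 'e \<Rightarrow> 'f"
  where "in_charts a b F e = inv_into (topspace (fst b)) (snd b) (F (snd a e))"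

definition holomorphic_map ::
    "(complex \<Rightarrow> 'e::ab_group_add \<Rightarrow> 'e) \<Rightarrow> 'm set \<Rightarrow> ('e topology \<times> ('e \<Rightarrow> 'm)) set
      \<Rightarrow> (complex \<Rightarrow> 'f::ab_group_add \<Rightarrow> 'f) \<Rightarrow> 'n set \<Rightarrow> ('f topology \<times> ('f \<Rightarrow> 'n)) set
      \<Rightarrow> ('m \<Rightarrow> 'n) \<Rightarrow> bool"
  where "holomorphic_map sc M A sc' N B F \<longleftrightarrow>
    continuous_map (manifold_topology M A) (manifold_topology N B) F \<and>
    (\<forall>a\<in>A. \<forall>b\<in>B.
      holomorphic_between sc (fst a) sc' (fst b) (chart_domain a b F) (in_charts a b F))"

definition injective_differential ::
    "(complex \<Rightarrow> 'e::ab_group_add \<Rightarrow> 'e) \<Rightarrow> ('e topology \<times> ('e \<Rightarrow> 'm)) set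
      \<Rightarrow> (complex \<Rightarrow> 'f::ab_group_add \<Rightarrow> 'f) \<Rightarrow> ('f topology \<times> ('f \<Rightarrow> 'n)) set
      \<Rightarrow> ('m \<Rightarrow> 'n) \<Rightarrow> bool"
  where "injective_differential sc A sc' B F \<longleftrightarrow>
    (\<forall>a\<in>A. \<forall>b\<in>B. \<forall>e\<in>chart_domain a b F. \<forall>\<xi>\<in>topspace (fst a).
      has_directional_derivative sc sc' (fst b) (in_charts a b F) e \<xi> 0 \<longrightarrow> \<xi> = 0)"

text \<open>A holomorphic embedding is a holomorphic immersion that is a homeomorphism onto its image.
  No closedness or complementedness of the range of the differential is imposed.\<close>

definition holomorphic_embedding ::
    "(complex \<Rightarrow> 'e::ab_group_add \<Rightarrow> 'e) \<Rightarrow> 'm set \<Rightarrow> ('e topology \<times> ('e \<Rightarrow> 'm)) set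
      \<Rightarrow> (complex \<Rightarrow> 'f::ab_group_add \<Rightarrow> 'f) \<Rightarrow> 'n set \<Rightarrow> ('f topology \<times> ('f \<Rightarrow> 'n)) set
      \<Rightarrow> ('m \<Rightarrow> 'n) \<Rightarrow> bool"
  where "holomorphic_embedding sc M A sc' N B F \<longleftrightarrow>
    holomorphic_map sc M A sc' N B F \<and>
    injective_differential sc A sc' B F \<and>
    embedding_map (manifold_topology M A) (manifold_topology N B) F"


section \<open>Projective spaces\<close>

definition line :: "(complex \<Rightarrow> 'a \<Rightarrow> 'a) \<Rightarrow> 'a \<Rightarrow> 'a set"
  where "line sc v = range (\<lambda>c. sc c v)"

definition proj :: "(complex \<Rightarrow> 'a \<Rightarrow> 'a) \<Rightarrow> 'a::zero set \<Rightarrow> 'a set set"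
  where "proj sc E = {line sc v | v. v \<in> E \<and> v \<noteq> 0}"

text \<open>
  For a continuous functional \<open>l\<close> and \<open>v\<^sub>0\<close> with \<open>l v\<^sub>0 = 1\<close>, the affine chart on the set of lines not
  contained in \<open>ker l\<close> is inverse to \<open>w \<mapsto> line (v\<^sub>0 + w)\<close>, \<open>w \<in> ker l\<close>.  By the Hahn-Banach theorem
  these charts cover the projectivization of a Frechet space, and their topology is the quotient
  topology.
\<close>

definition proj_charts :: "(complex \<Rightarrow> 'a \<Rightarrow> 'a) \<Rightarrow> 'a::ab_group_add topology \<Rightarrow> ('a topology \<times> ('a \<Rightarrow> 'a set)) set"
  where "proj_charts sc T =
    {(subtopology T {w. l w = 0}, \<lambda>w. line sc (v0 + w)) | l v0.
      continuous_functional sc T l \<and> v0 \<in> topspace T \<and> l v0 = 1}"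

definition projectivization :: "(complex \<Rightarrow> 'a \<Rightarrow> 'a) \<Rightarrow> 'a::zero set \<Rightarrow> ('a \<Rightarrow> 'a) \<Rightarrow> ('a set \<Rightarrow> 'a set)"
  where "projectivization sc E A = restrict (image A) (proj sc E)"


section \<open>The Riemann sphere and its automorphism group\<close>

definition P1 :: "(complex^2) set set"
  where "P1 = proj (*s) UNIV"

definition affine_point :: "complex \<Rightarrow> (complex^2) set"
  where "affine_point z = line (*s) (vector [z, 1])"

text \<open>The holomorphic automorphisms of the sphere are the maps induced by invertible matrices.\<close>

definition PGL2 :: "((complex^2) set \<Rightarrow> (complex^2) set) monoid"
  where "PGL2 = (BijGroup P1)
    \<lparr>carrier := {projectivization (*s) UNIV (\<lambda>v. A *v v) | A :: complex^2^2. invertible A}\<rparr>"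


lemma image_line:
  fixes A :: "complex^2^2"
  shows "(\<lambda>v. A *v v) ` line (*s) v = line (*s) (A *v v)"
  by (auto simp: line_def image_image vector_scalar_commute[symmetric])

lemma projectivization_in_P1:
  fixes A :: "complex^2^2"
  assumes "invertible A" "L \<in> P1"
  shows "(\<lambda>v. A *v v) ` L \<in> P1"
proof -
  obtain v where v: "L = line (*s) v" "v \<noteq> 0" using assms by (auto simp: P1_def proj_def)
  obtain B where B: "B ** A = mat 1" using assms by (auto simp: invertible_def)
  have "A *v v \<noteq> 0"
    using v(2) B by (metis matrix_vector_mul_assoc matrix_vector_mul_lid matrix_vector_mult_0_right)
  then show ?thesis using v image_line[of A v] by (auto simp: P1_def proj_def)
qed

lemma projectivization_mult:
  fixes A B :: "complex^2^2"
  assumes "invertible B"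
  shows "compose P1 (projectivization (*s) UNIV (\<lambda>v. A *v v)) (projectivization (*s) UNIV (\<lambda>v. B *v v))
    = projectivization (*s) UNIV (\<lambda>v. (A ** B) *v v)"
  using projectivization_in_P1[OF assms]
  by (auto simp: compose_def projectivization_def P1_def[symmetric] fun_eq_iff image_image
      matrix_vector_mul_assoc restrict_def)

lemma projectivization_one:
  "projectivization (*s) UNIV (\<lambda>v. (mat 1 :: complex^2^2) *v v) = (\<lambda>L\<in>P1. L)"
  by (auto simp: projectivization_def P1_def[symmetric] fun_eq_iff)

lemma projectivization_Bij:
  fixes A :: "complex^2^2"
  assumes "invertible A"
  shows "projectivization (*s) UNIV (\<lambda>v. A *v v) \<in> Bij P1"
proof -
  obtain B where B: "A ** B = mat 1" "B ** A = mat 1" using assms by (auto simp: invertible_def)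
  then have iB: "invertible B" by (auto simp: invertible_def)
  have "bij_betw (image (\<lambda>v. A *v v)) P1 P1"
    by (rule bij_betw_byWitness[where f' = "image (\<lambda>v. B *v v)"])
       (auto simp: image_image matrix_vector_mul_assoc B projectivization_in_P1 assms iB)
  then show ?thesis
    by (simp add: Bij_def projectivization_def P1_def[symmetric] cong: bij_betw_cong)
qed

lemma group_PGL2: "group PGL2"
  unfolding PGL2_def
proof (rule group.subgroup_imp_group[OF group_BijGroup])
  let ?p = "\<lambda>A :: complex^2^2. projectivization (*s) UNIV (\<lambda>v. A *v v)"
  let ?H = "{?p A | A. invertible A}"
  show "subgroup ?H (BijGroup P1)"
  proof (rule group.subgroupI[OF group_BijGroup])
    show "?H \<subseteq> carrier (BijGroup P1)"
      using projectivization_Bij by (auto simp: BijGroup_def)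
    show "?H \<noteq> {}" using invertible_def[of "mat 1 :: complex^2^2"] matrix_mul_lid[of "mat 1 :: complex^2^2"] by blast
  next
    fix g h assume "g \<in> ?H" "h \<in> ?H"
    then obtain A B where AB: "g = ?p A" "h = ?p B" "invertible A" "invertible B" by blast
    then have "g \<otimes>\<^bsub>BijGroup P1\<^esub> h = ?p (A ** B)"
      using projectivization_Bij projectivization_mult by (simp add: BijGroup_def)
    then show "g \<otimes>\<^bsub>BijGroup P1\<^esub> h \<in> ?H" using AB invertible_mult by blast
  next
    fix g assume "g \<in> ?H"
    then obtain A where A: "g = ?p A" "invertible A" by blast
    then obtain B where B: "A ** B = mat 1" "B ** A = mat 1" by (auto simp: invertible_def)
    then have iB: "invertible B" by (auto simp: invertible_def)
    have "?p B \<otimes>\<^bsub>BijGroup P1\<^esub> g = \<one>\<^bsub>BijGroup P1\<^esub>"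
      using A B iB projectivization_Bij projectivization_mult[of A B] projectivization_one
      by (simp add: BijGroup_def)
    then have "inv\<^bsub>BijGroup P1\<^esub> g = ?p B"
      using A iB projectivization_Bij
      by (intro group.inv_equality[OF group_BijGroup]) (auto simp: BijGroup_def)
    then show "inv\<^bsub>BijGroup P1\<^esub> g \<in> ?H" using iB by blast
  qed
qed


section \<open>Smoothness classes\<close>

datatype smoothness = Ck enat | Wkp nat real

fun admissible :: "smoothness \<Rightarrow> bool"
  where
    "admissible (Ck k) \<longleftrightarrow> 1 \<le> k"
  | "admissible (Wkp k p) \<longleftrightarrow> 1 \<le> k \<and> 1 \<le> p"

definition nth_derivative :: "nat \<Rightarrow> (real \<Rightarrow> 'a::real_normed_vector) \<Rightarrow> real \<Rightarrow> 'a"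
  where "nth_derivative n f = ((\<lambda>g t. vector_derivative g (at t)) ^^ n) f"

definition Ck_on :: "enat \<Rightarrow> real set \<Rightarrow> (real \<Rightarrow> 'a::real_normed_vector) \<Rightarrow> bool"
  where "Ck_on k J f \<longleftrightarrow>
    (\<forall>j. enat j < k \<longrightarrow> (\<forall>t\<in>J. nth_derivative j f differentiable (at t))) \<and>
    (\<forall>j. enat j \<le> k \<longrightarrow> continuous_on J (nth_derivative j f))"

definition Lp_loc :: "real \<Rightarrow> real set \<Rightarrow> (real \<Rightarrow> complex) \<Rightarrow> bool"
  where "Lp_loc p J g \<longleftrightarrow>
    set_borel_measurable lborel J g \<and>
    (\<forall>K. compact K \<and> K \<subseteq> J \<longrightarrow> set_integrable lborel K (\<lambda>t. cmod (g t) powr p))"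

definition weak_derivative :: "real set \<Rightarrow> nat \<Rightarrow> (real \<Rightarrow> complex) \<Rightarrow> (real \<Rightarrow> complex) \<Rightarrow> bool"
  where "weak_derivative J j f g \<longleftrightarrow>
    Lp_loc 1 J g \<and>
    (\<forall>\<phi> :: real \<Rightarrow> real.
      Ck_on \<infinity> UNIV \<phi> \<and> compact (closure {t. \<phi> t \<noteq> 0}) \<and> closure {t. \<phi> t \<noteq> 0} \<subseteq> J \<longrightarrow>
      (LINT t:J|lborel. nth_derivative j \<phi> t *\<^sub>R f t) =
        (-1) ^ j * (LINT t:J|lborel. \<phi> t *\<^sub>R g t))"

text \<open>Being of a given class on an open set \<open>J\<close> is a local condition.  As \<open>k \<ge> 1\<close>, Sobolev functions
  of one variable have a continuous representative, which is the one considered here.\<close>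

fun of_class :: "smoothness \<Rightarrow> real set \<Rightarrow> (real \<Rightarrow> complex) \<Rightarrow> bool"
  where
    "of_class (Ck k) J f \<longleftrightarrow> Ck_on k J f"
  | "of_class (Wkp k p) J f \<longleftrightarrow>
      continuous_on J f \<and> (\<forall>j\<le>k. \<exists>g. Lp_loc p J g \<and> weak_derivative J j f g)"


section \<open>Loop spaces\<close>

text \<open>Maps on the circle \<open>\<real>/\<int>\<close> are represented by 1-periodic maps on the real line.\<close>

definition periodic :: "(real \<Rightarrow> 'a) \<Rightarrow> bool"
  where "periodic x \<longleftrightarrow> (\<forall>t. x (t + 1) = x t)"

definition LC :: "smoothness \<Rightarrow> (real \<Rightarrow> complex) set"
  where "LC r = {y. periodic y \<and> of_class r UNIV y}"

text \<open>The weak derivatives in the Sobolev norm are unique almost everywhere, so the choice does not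
  matter.\<close>

fun class_seminorms :: "smoothness \<Rightarrow> ((real \<Rightarrow> complex) \<Rightarrow> real) set"
  where
    "class_seminorms (Ck k) = {\<lambda>y. SUP t. cmod (nth_derivative j y t) | j. enat j \<le> k}"
  | "class_seminorms (Wkp k p) =
      {\<lambda>y. \<Sum>j\<le>k. (LINT t:{0..1}|lborel.
              cmod ((SOME g. weak_derivative UNIV j y g) t) powr p) powr (1 / p)}"

definition LC_topology :: "smoothness \<Rightarrow> (real \<Rightarrow> complex) topology"
  where "LC_topology r = seminorm_topology (LC r) (class_seminorms r)"

definition LC_scale :: "complex \<Rightarrow> (real \<Rightarrow> complex) \<Rightarrow> (real \<Rightarrow> complex)"
  where "LC_scale c y = (\<lambda>t. c * y t)"

definition LP1 :: "smoothness \<Rightarrow> (real \<Rightarrow> (complex^2) set) set"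
  where "LP1 r = {x. periodic x \<and> (\<forall>t. x t \<in> P1) \<and>
    (\<forall>t0. \<exists>g\<in>carrier PGL2. \<exists>J f. open J \<and> t0 \<in> J \<and> of_class r J f \<and>
      (\<forall>t\<in>J. x t = g (affine_point (f t))))}"

text \<open>
  The charts of the loop space.  The image of the parametrization belonging to \<open>g\<close> is the open set of
  loops avoiding the point \<open>g \<infinity>\<close>.  A loop of an admissible class has finite length, hence its image
  is a null set and misses some point of the sphere, so these charts cover the whole loop space.
\<close>

definition LP1_charts :: "smoothness \<Rightarrow> ((real \<Rightarrow> complex) topology \<times> ((real \<Rightarrow> complex) \<Rightarrow> (real \<Rightarrow> (complex^2) set))) set"
  where "LP1_charts r = {(LC_topology r, \<lambda>y t. g (affine_point (y t))) | g. g \<in> carrier PGL2}"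


section \<open>Equivariance\<close>

definition projective_action ::
    "(complex \<Rightarrow> 'v \<Rightarrow> 'v) \<Rightarrow> 'v::ab_group_add topology
      \<Rightarrow> (((complex^2) set \<Rightarrow> (complex^2) set) \<Rightarrow> 'v set \<Rightarrow> 'v set) \<Rightarrow> bool"
  where "projective_action sc V \<rho> \<longleftrightarrow>
    group_action PGL2 (proj sc (topspace V)) \<rho> \<and>
    (\<forall>g\<in>carrier PGL2. \<exists>A. linear_automorphism sc V A \<and>
      \<rho> g = projectivization sc (topspace V) A)"

definition equivariant ::
    "smoothness \<Rightarrow> (complex \<Rightarrow> 'v \<Rightarrow> 'v) \<Rightarrow> 'v::ab_group_add topology
      \<Rightarrow> ((real \<Rightarrow> (complex^2) set) \<Rightarrow> 'v set) \<Rightarrow> bool"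
  where "equivariant r sc V \<epsilon> \<longleftrightarrow>
    (\<exists>\<rho>. projective_action sc V \<rho> \<and>
      (\<forall>g\<in>carrier PGL2. \<forall>x\<in>LP1 r. \<epsilon> (\<lambda>t. g (x t)) = \<rho> g (\<epsilon> x)))"

end

theory Submission
  imports Defs "HOL-Complex_Analysis.Complex_Analysis" "HOL-Real_Asymp.Real_Asymp"
begin

text \<open>Only loops near a constant one are needed.  Suppose \<open>\<epsilon>\<close> is an equivariant embedding, and let \<open>A\<close> and
  \<open>B\<close> be linear lifts to \<open>V\<close> of the actions of \<open>z \<mapsto> z/2\<close> and \<open>z \<mapsto> 1/z\<close>.  On the loops in the affine
  part of the projective line, \<open>\<epsilon>\<close> lifts to a map \<open>F\<close> into \<open>V\<close>: choose it near the constant loop \<open>0\<close>,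
  normalise it by an infinite product so that \<open>A F(y) = \<alpha> F(y/2)\<close>, and extend it by this relation; it is
  entire along complex lines and planes.  For a loop \<open>y\<close> without zeros, \<open>F(w y)\<close> and \<open>B F(1/(w y))\<close>
  span the same line, so they differ by a scalar \<open>\<theta>(w)\<close>, and \<open>\<theta>(2 w) = K \<theta>(w)\<close> with \<open>K\<close> depending only on the
  action.  Hence \<open>F(w y)\<close> grows polynomially in \<open>w\<close>, of a degree independent of \<open>y\<close>.

  Now put \<open>h(t) = exp (2 \<pi> i t)\<close>.  By the growth estimate \<open>F(u (1 + s h))\<close> is a polynomial in \<open>s\<close> of degree
  at most some fixed \<open>n\<close>, so suitable weights at \<open>n + 2\<close> points \<open>s\<^sub>i\<close> on the circle of radius 1/2 annihilate
  it.  Passing to inverses, some nonzero weights \<open>W\<^sub>i\<close> satisfy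
  \<open>\<Sum> W\<^sub>i F(u/(1 + s\<^sub>i h)) = 0\<close> for all \<open>u = 2\<^sup>-\<^sup>j\<close>.  Its first-order part in \<open>u\<close> says
  that the differential of \<open>\<epsilon>\<close> at the loop \<open>0\<close> kills \<open>\<Sum> W\<^sub>i/(1 + s\<^sub>i h)\<close>, which is not zero because the
  poles are distinct; but an embedding is an immersion.\<close>

section \<open>The Hahn--Banach theorem for seminorms\<close>

text \<open>Nothing bounds a dimension at the outset: \<open>V\<close> may be infinite-dimensional
  and the embedding is only holomorphic. The bound comes from a relation in the group. Conjugation
  aside, halving after inversion after halving is again inversion, so \<open>A B A\<close> and
  \<open>B\<close> induce the same projective map and differ by a scalar \<open>\<kappa>\<close>.
  With the eigenvalue \<open>\<alpha>\<close> of \<open>A\<close> on the line over the loop 0 this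
  yields the constant \<open>K\<close>, the product of \<open>\<kappa>\<close> and the square of
  \<open>\<alpha>\<close>, which does not see the loop. One degree n therefore serves all zero-free
  loops, while the inverses 1/(1 + s h) are independent for distinct s: already n + 2 of them become
  dependent under a differential that is injective. Roots of unity make the weights explicit and all
  nonzero. Only the powers of a single dilation are used, because no continuity of the action in the
  group element is assumed; hence u runs through powers of 2. Vector-valued function theory is
  avoided by testing against continuous functionals, which separate points by Hahn-Banach. The test
  loops extend holomorphically across the circle, so the same loops serve every smoothness
  class.\<close>

definition sublinear_on :: "(complex \<Rightarrow> 'a \<Rightarrow> 'a) \<Rightarrow> 'a set \<Rightarrow> ('a::ab_group_add \<Rightarrow> real) \<Rightarrow> bool"
  where "sublinear_on sc E g \<longleftrightarrow>
    (\<forall>x\<in>E. \<forall>y\<in>E. g (x + y) \<le> g x + g y) \<and>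
    (\<forall>t\<ge>0. \<forall>x\<in>E. g (sc (of_real t) x) = t * g x)"

locale complex_subspace =
  fixes sc :: "complex \<Rightarrow> 'a \<Rightarrow> 'a::ab_group_add" and E :: "'a set"
  assumes vs: "vector_space sc" and sub: "Modules.module.subspace sc E"
begin

sublocale vector_space sc by (fact vs)

lemma E_add: "x \<in> E \<Longrightarrow> y \<in> E \<Longrightarrow> x + y \<in> E"
  using sub by (rule subspace_add)
lemma E_scale: "x \<in> E \<Longrightarrow> sc c x \<in> E"
  using sub by (rule subspace_scale)
lemma E_0: "0 \<in> E"
  using sub by (rule subspace_0)
lemma E_neg: "x \<in> E \<Longrightarrow> - x \<in> E"
  using sub by (rule subspace_neg)
lemma E_diff: "x \<in> E \<Longrightarrow> y \<in> E \<Longrightarrow> x - y \<in> E"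
  using sub by (rule subspace_diff)

lemma sublinear_on_0:
  assumes "sublinear_on sc E g" shows "g 0 = 0"
  using assms E_0 unfolding sublinear_on_def
  by (metis mult_zero_left of_real_0 order_refl scale_zero_left)

lemma sublinear_on_ge_neg:
  assumes "sublinear_on sc E g" "x \<in> E"
  shows "- g (- x) \<le> g x"
proof -
  have "g (x + - x) \<le> g x + g (- x)"
    using assms E_neg unfolding sublinear_on_def by blast
  then show ?thesis using sublinear_on_0[OF assms(1)] by simp
qed

text \<open>The infimum over \<open>t \<ge> 0\<close> of \<open>g (x + t y) - t g y\<close> is again sublinear; a minimal sublinear
  functional must equal it, which forces additivity.\<close>

lemma sublinear_on_shift:
  assumes g: "sublinear_on sc E g" and y: "y \<in> E"
  defines "h \<equiv> \<lambda>x. if x \<in> E then INF t\<in>{0..}. g (x + sc (of_real t) y) - t * g y else 0"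
  shows "sublinear_on sc E h" "\<And>x. x \<in> E \<Longrightarrow> h x \<le> g x"
    "\<And>x. x \<in> E \<Longrightarrow> h x \<le> g (x + y) - g y"
proof -
  define k where "k x t = g (x + sc (of_real t) y) - t * g y" for x t
  have h: "h x = (INF t\<in>{0..}. k x t)" if "x \<in> E" for x
    using that by (simp add: h_def k_def)
  have add: "g (a + b) \<le> g a + g b" if "a \<in> E" "b \<in> E" for a b
    using g that by (auto simp: sublinear_on_def)
  have hom: "g (sc (of_real t) a) = t * g a" if "a \<in> E" "t \<ge> 0" for a t
    using g that by (auto simp: sublinear_on_def)
  \<comment> \<open>A lower bound independent of \<open>t\<close>; it makes the infimum over
    \<open>t \<ge> 0\<close> finite.\<close>
  have "- g (- x) \<le> k x t" if "x \<in> E" "t \<ge> 0" for x t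
  proof -
    have "g ((x + sc (of_real t) y) + - x) \<le> g (x + sc (of_real t) y) + g (- x)"
      using that y by (intro add E_add E_scale E_neg)
    then show ?thesis using hom[OF y that(2)] by (simp add: k_def)
  qed
  then have bdd: "bdd_below (k x ` {0..})" if "x \<in> E" for x
    using that by (intro bdd_belowI[of _ "- g (- x)"]) auto
  have le: "h x \<le> k x t" if "x \<in> E" "t \<ge> 0" for x t
    unfolding h[OF that(1)] using bdd[OF that(1)] that(2) by (intro cINF_lower) auto
  have approx: "\<exists>t\<ge>0. k x t < h x + e" if "x \<in> E" "e > 0" for x e
  proof -
    have "(INF t\<in>{0..}. k x t) < h x + e" using that h by simp
    then show ?thesis using cInf_lessD[of "k x ` {0..}" "h x + e"] by auto
  qed
  show "h x \<le> g x" if "x \<in> E" for x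
    using le[OF that, of 0] by (simp add: k_def)
  show "h x \<le> g (x + y) - g y" if "x \<in> E" for x
    using le[OF that, of 1] by (simp add: k_def)
  have hadd: "h (x + x') \<le> h x + h x'" if xx: "x \<in> E" "x' \<in> E" for x x'
  proof (rule field_le_epsilon)
    fix e :: real assume e: "e > 0"
    obtain t where t: "t \<ge> 0" "k x t < h x + e/2" using approx[of x "e/2"] xx e by auto
    obtain t' where t': "t' \<ge> 0" "k x' t' < h x' + e/2" using approx[of x' "e/2"] xx e by auto
    have "h (x + x') \<le> k (x + x') (t + t')" using that t t' by (intro le E_add) auto
    also have "\<dots> \<le> k x t + k x' t'"
      using add[of "x + sc (of_real t) y" "x' + sc (of_real t') y"] that y
      by (simp add: k_def E_add E_scale scale_left_distrib algebra_simps)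
    finally show "h (x + x') \<le> h x + h x' + e" using t t' by linarith
  qed
  have hmul: "h (sc (of_real s) x) \<le> s * h x" if xs: "x \<in> E" "s > 0" for x s
  proof (rule field_le_epsilon)
    fix e :: real assume e: "e > 0"
    obtain t where t: "t \<ge> 0" "k x t < h x + e/s" using approx[of x "e/s"] xs e by auto
    have "h (sc (of_real s) x) \<le> k (sc (of_real s) x) (s * t)" using that t by (intro le E_scale) auto
    also have "\<dots> = s * k x t"
      using hom[of "x + sc (of_real t) y" s] that y
      by (simp add: k_def E_add E_scale scale_right_distrib algebra_simps)
    also have "\<dots> \<le> s * h x + e" using t that by (simp add: field_simps)
    finally show "h (sc (of_real s) x) \<le> s * h x + e" .
  qed
  have h0: "h 0 = 0"
  proof (rule antisym)
    show "h 0 \<le> 0" using le[OF E_0, of 0] by (simp add: k_def sublinear_on_0[OF g])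
    show "0 \<le> h 0" unfolding h[OF E_0]
      by (rule cINF_greatest) (auto simp: k_def hom y)
  qed
  have "h (sc (of_real s) x) = s * h x" if "x \<in> E" "s \<ge> 0" for x s
  proof (cases "s = 0")
    case False
    then have s: "s > 0" using that by simp
    have "h (sc (of_real (1/s)) (sc (of_real s) x)) \<le> (1/s) * h (sc (of_real s) x)"
      using that s by (intro hmul E_scale) auto
    then have "s * h x \<le> h (sc (of_real s) x)"
      using s by (simp add: field_simps flip: of_real_mult)
    then show ?thesis using hmul[OF that(1) s] by linarith
  qed (simp add: h0)
  with hadd show "sublinear_on sc E h" unfolding sublinear_on_def by blast
qed

text \<open>Zorn's lemma with the pointwise order read downwards. Candidates are made to vanish off
  \<open>E\<close>, so that agreement on \<open>E\<close> is equality of functions and the order is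
  antisymmetric; a chain is bounded by its pointwise infimum.\<close>

lemma minimal_sublinear_on:
  assumes p: "sublinear_on sc E p"
  shows "\<exists>g. sublinear_on sc E g \<and> (\<forall>x\<in>E. g x \<le> p x) \<and>
    (\<forall>h. sublinear_on sc E h \<longrightarrow> (\<forall>x\<in>E. h x \<le> g x) \<longrightarrow> (\<forall>x\<in>E. h x = g x))"
proof -
  define S where "S = {g. sublinear_on sc E g \<and> (\<forall>x\<in>E. g x \<le> p x) \<and> (\<forall>x. x \<notin> E \<longrightarrow> g x = 0)}"
  define P where "P g h \<longleftrightarrow> (\<forall>x. h x \<le> g x)" for g h :: "'a \<Rightarrow> real"
  have po: "partial_order_on S (relation_of P S)"
    by (rule partial_order_on_relation_ofI)
       (auto simp: P_def fun_eq_iff intro: order.trans antisym)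
  have res: "(\<lambda>x. if x \<in> E then g x else 0) \<in> S"
    if "sublinear_on sc E g" "\<forall>x\<in>E. g x \<le> p x" for g
    using that by (simp add: S_def sublinear_on_def E_add E_scale)
  have "\<exists>m\<in>S. \<forall>a\<in>S. P m a \<longrightarrow> a = m"
  proof (rule predicate_Zorn[OF po])
    fix C assume C: "C \<in> Chains (relation_of P S)"
    show "\<exists>u\<in>S. \<forall>a\<in>C. P a u"
    proof (cases "C = {}")
      case True then show ?thesis using res[OF p] by auto
    next
      case False
      have CS: "C \<subseteq> S" and tot: "a \<in> C \<Longrightarrow> b \<in> C \<Longrightarrow> P a b \<or> P b a" for a b
        using C by (auto simp: Chains_def relation_of_def)
      define u where "u x = (INF g\<in>C. g x)" for x
      have lb: "- p (- x) \<le> g x" if "g \<in> C" "x \<in> E" for g x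
        using sublinear_on_ge_neg[of g x] that CS E_neg[of x] by (fastforce simp: S_def)
      have le: "u x \<le> g x" if "g \<in> C" for g x
      proof (cases "x \<in> E")
        case True
        have "bdd_below ((\<lambda>g. g x) ` C)" using lb True by (intro bdd_belowI[of _ "- p (- x)"]) auto
        then show ?thesis unfolding u_def using that by (rule cINF_lower)
      next
        case False
        then have "\<And>g. g \<in> C \<Longrightarrow> g x = 0" using CS by (auto simp: S_def)
        then have "(\<lambda>g. g x) ` C = {0}" using \<open>C \<noteq> {}\<close> by (auto simp: image_iff)
        then show ?thesis using \<open>\<And>g. g \<in> C \<Longrightarrow> g x = 0\<close>[OF that] by (simp add: u_def)
      qed
      have ge: "c \<le> u x" if "\<And>g. g \<in> C \<Longrightarrow> c \<le> g x" for c x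
        unfolding u_def using False that by (intro cINF_greatest)
      have "u (x + y) \<le> u x + u y" if xy: "x \<in> E" "y \<in> E" for x y
      proof -
        have uab: "u (x + y) \<le> a x + b y" if ab: "a \<in> C" "b \<in> C" for a b
        proof -
          \<comment> \<open>The smaller of two members of a chain serves both arguments at once;
            this makes the infimum subadditive.\<close>
          obtain c where c: "c \<in> C" "c x \<le> a x" "c y \<le> b y"
            using tot[OF ab] ab by (auto simp: P_def)
          have "u (x + y) \<le> c (x + y)" by (rule le[OF c(1)])
          also have "\<dots> \<le> c x + c y" using c(1) CS xy by (auto simp: S_def sublinear_on_def)
          finally show ?thesis using c by linarith
        qed
        have "u (x + y) - a x \<le> u y" if a: "a \<in> C" for a
          using uab[OF a] by (intro ge) (simp add: algebra_simps)
        then have "u (x + y) - u y \<le> u x"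
          by (intro ge) (simp add: algebra_simps)
        then show ?thesis by simp
      qed
      moreover have "u (sc (of_real t) x) = t * u x" if x: "x \<in> E" and t: "t \<ge> 0" for x t
      proof (cases "t = 0")
        case True
        have "(\<lambda>g. g 0) ` C = {0}" using False CS sublinear_on_0 by (force simp: S_def)
        then show ?thesis using True by (simp add: u_def)
      next
        case False
        then have t: "t > 0" using t by simp
        have eq: "g (sc (of_real t) x) = t * g x" if "g \<in> C" for g
          using that CS x t by (auto simp: S_def sublinear_on_def)
        have "u (sc (of_real t) x) / t \<le> u x"
          using le[of _ "sc (of_real t) x"] eq t by (intro ge) (simp add: field_simps)
        moreover have "t * u x \<le> u (sc (of_real t) x)"
        proof (rule ge)
          show "t * u x \<le> g (sc (of_real t) x)" if "g \<in> C" for g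
            unfolding eq[OF that] using le[OF that, of x] t by simp
        qed
        ultimately show ?thesis using t by (simp add: field_simps)
      qed
      ultimately have "sublinear_on sc E u" by (auto simp: sublinear_on_def)
      moreover have "u x \<le> p x" if "x \<in> E" for x
        using False le[of _ x] CS that by (fastforce simp: S_def)
      moreover have "u x = 0" if "x \<notin> E" for x
      proof (rule antisym)
        obtain g where "g \<in> C" using False by blast
        then show "u x \<le> 0" using le[of g x] CS that by (auto simp: S_def)
        show "0 \<le> u x" using CS that by (intro ge) (auto simp: S_def)
      qed
      ultimately have "u \<in> S" by (auto simp: S_def)
      then show ?thesis using le by (auto simp: P_def)
    qed
  qed
  then obtain m where m: "m \<in> S" "\<And>a. a \<in> S \<Longrightarrow> P m a \<Longrightarrow> a = m" by blast
  show ?thesis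
  proof (intro exI[of _ m] conjI allI impI)
    show "sublinear_on sc E m" "\<forall>x\<in>E. m x \<le> p x" using m(1) by (auto simp: S_def)
    fix h assume h: "sublinear_on sc E h" "\<forall>x\<in>E. h x \<le> m x"
    have "(\<lambda>x. if x \<in> E then h x else 0) = m"
    proof (rule m(2)[OF res[OF h(1)]])
      show "\<forall>x\<in>E. h x \<le> p x" using h m(1) by (force simp: S_def)
      show "P m (\<lambda>x. if x \<in> E then h x else 0)" using h m(1) by (auto simp: P_def S_def)
    qed
    then show "\<forall>x\<in>E. h x = m x" by (auto simp: fun_eq_iff split: if_splits)
  qed
qed

text \<open>A minimal sublinear functional cannot be lowered by a shift, hence is real linear; its
  complexification is the functional sought.\<close>

lemma hahn_banach_seminorm:
  assumes p: "complex_seminorm_on sc E p" and x0: "x0 \<in> E" "p x0 \<noteq> 0"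
  obtains l where "clinear_on sc (*) E l" "\<forall>x\<in>E. cmod (l x) \<le> p x" "l x0 \<noteq> 0"
proof -
  have p1: "sublinear_on sc E p"
    using p by (auto simp: complex_seminorm_on_def sublinear_on_def)
  \<comment> \<open>The descent starts from the shift of \<open>p\<close> in the direction
    \<open>x0\<close> and not from \<open>p\<close> itself: every \<open>g\<close> below
    \<open>p'\<close> satisfies \<open>g (- x0) \<le> - p x0\<close>, which keeps the functional
    nonzero at \<open>x0\<close>.\<close>
  define p' where "p' x = (if x \<in> E then INF t\<in>{0..}. p (x + sc (of_real t) x0) - t * p x0 else 0)" for x
  note p' = sublinear_on_shift[OF p1 x0(1), folded p'_def]
  obtain g where g: "sublinear_on sc E g" "\<forall>x\<in>E. g x \<le> p' x"
    and min: "\<And>h. sublinear_on sc E h \<Longrightarrow> \<forall>x\<in>E. h x \<le> g x \<Longrightarrow> \<forall>x\<in>E. h x = g x"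
    using minimal_sublinear_on[OF p'(1)] by blast
  have add: "g (x + y) = g x + g y" if "x \<in> E" "y \<in> E" for x y
  proof -
    define h where "h x = (if x \<in> E then INF t\<in>{0..}. g (x + sc (of_real t) y) - t * g y else 0)" for x
    note h = sublinear_on_shift[OF g(1) that(2), folded h_def]
    have "\<forall>x\<in>E. h x = g x" using h(2) by (intro min[OF h(1)]) blast
    then have "g x \<le> g (x + y) - g y" using h(3)[OF that(1)] that by simp
    moreover have "g (x + y) \<le> g x + g y" using g(1) that by (auto simp: sublinear_on_def)
    ultimately show ?thesis by simp
  qed
  have neg: "g (- x) = - g x" if "x \<in> E" for x
    using add[OF that E_neg[OF that]] sublinear_on_0[OF g(1)] by simp
  have rscale: "g (sc (of_real t) x) = t * g x" if "x \<in> E" for x t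
  proof (cases "t \<ge> 0")
    case True then show ?thesis using g(1) that by (auto simp: sublinear_on_def)
  next
    case False
    then have "g (sc (of_real (-t)) (-x)) = - t * g (- x)"
      using g(1) E_neg[OF that] by (simp add: sublinear_on_def del: of_real_minus scale_minus_right)
    then show ?thesis using neg[OF that] by simp
  qed
  have gp: "g x \<le> p x" if "x \<in> E" for x
    using bspec[OF g(2) that] p'(2)[OF that] by simp
  have gx0: "g x0 \<noteq> 0"
  proof -
    have "g (- x0) \<le> p' (- x0)" using g(2) E_neg x0 by blast
    also have "\<dots> \<le> p (- x0 + x0) - p x0" using p'(3) E_neg x0 by blast
    also have "\<dots> = - p x0" using sublinear_on_0[OF p1] by simp
    finally have "p x0 \<le> g x0" using neg x0 by simp
    moreover have "p x0 \<ge> 0" using p x0 by (auto simp: complex_seminorm_on_def)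
    ultimately show ?thesis using x0 by simp
  qed
  \<comment> \<open>The only complex linear map with real part \<open>g\<close>.\<close>
  define l where "l x = Complex (g x) (- g (sc \<i> x))" for x
  have lin: "clinear_on sc (*) E l"
    unfolding clinear_on_def
  proof (intro conjI ballI allI)
    show "l (x + y) = l x + l y" if "x \<in> E" "y \<in> E" for x y
      using that by (simp add: l_def add E_scale scale_right_distrib complex_eq_iff)
    show "l (sc c x) = c * l x" if x: "x \<in> E" for c x
    proof -
      have c: "sc c x = sc (of_real (Re c)) x + sc (of_real (Im c)) (sc \<i> x)"
        by (subst complex_eq[of c]) (simp only: scale_left_distrib scale_scale mult.commute[of \<i>])
      have ic: "sc \<i> (sc c x) = sc (of_real (Re c)) (sc \<i> x) + sc (of_real (- Im c)) x"
      proof -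
        have "\<i> * (of_real (Im c) * \<i>) = of_real (- Im c)" by (simp add: complex_eq_iff)
        then show ?thesis
          unfolding c by (simp only: scale_right_distrib scale_scale mult.commute[of \<i> "of_real (Re c)"])
      qed
      have "g (sc c x) = Re c * g x + Im c * g (sc \<i> x)"
        unfolding c using x by (simp only: add rscale E_scale)
      moreover have "g (sc \<i> (sc c x)) = Re c * g (sc \<i> x) - Im c * g x"
        unfolding ic using x by (simp only: add rscale E_scale)
      ultimately show ?thesis
        by (intro complex_eqI) (simp_all add: l_def)
    qed
  qed
  show ?thesis
  proof (rule that[OF lin])
    show "\<forall>x\<in>E. cmod (l x) \<le> p x"
    proof
      fix x assume x: "x \<in> E"
      \<comment> \<open>A rotation makes \<open>l x\<close> real; its modulus is then a value of
        \<open>g\<close>, and \<open>g \<le> p\<close> applies.\<close>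
      obtain c where c: "cmod c = 1" "c * l x = of_real (cmod (l x))"
      proof (cases "l x = 0")
        case False
        show ?thesis
        proof (rule that)
          show "cmod (of_real (cmod (l x)) / l x) = 1" using False by (simp add: norm_divide)
          show "of_real (cmod (l x)) / l x * l x = of_real (cmod (l x))" using False by simp
        qed
      next
        case True
        then show ?thesis by (intro that[of 1]) auto
      qed
      have "of_real (cmod (l x)) = l (sc c x)" using lin x c by (simp add: clinear_on_def)
      then have "Re (of_real (cmod (l x))) = Re (l (sc c x))" by (rule arg_cong)
      then have "cmod (l x) = g (sc c x)" by (simp add: l_def)
      also have "\<dots> \<le> p (sc c x)" using gp E_scale x by blast
      also have "\<dots> = p x" using p x c by (auto simp: complex_seminorm_on_def)
      finally show "cmod (l x) \<le> p x" .
    qed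
    show "l x0 \<noteq> 0" using gx0 by (simp add: l_def complex_eq_iff)
  qed
qed

end

section \<open>Smooth loops\<close>

lemma nth_derivative_0 [simp]: "nth_derivative 0 f = f"
  by (simp add: nth_derivative_def)

lemma nth_derivative_Suc: "nth_derivative (Suc j) f = (\<lambda>t. vector_derivative (nth_derivative j f) (at t))"
  by (simp add: nth_derivative_def)

lemma nth_derivative_Suc': "nth_derivative (Suc j) f = nth_derivative j (\<lambda>t. vector_derivative f (at t))"
  by (simp add: nth_derivative_def funpow_Suc_right del: funpow.simps)

lemma nth_derivative_closed_class:
  assumes S: "\<And>f. f \<in> S \<Longrightarrow> \<exists>f'\<in>S. \<forall>t. (f has_vector_derivative f' t) (at t)" and f: "f \<in> S"
  shows "nth_derivative j f \<in> S"
proof (induction j)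
  case (Suc j)
  then obtain f' where f': "f' \<in> S" "\<forall>t. (nth_derivative j f has_vector_derivative f' t) (at t)"
    using S by blast
  then have "nth_derivative (Suc j) f = f'"
    by (auto simp: nth_derivative_Suc fun_eq_iff vector_derivative_at)
  then show ?case using f' by simp
qed (use f in simp)

text \<open>Smoothness without computing derivatives: a class in which every function has a
  derivative in the class consists of smooth functions. It is applied to \<open>smooth_loops\<close>
  and to \<open>flat_exp_algebra\<close>.\<close>

lemma Ck_on_closed_class:
  assumes S: "\<And>f. f \<in> S \<Longrightarrow> \<exists>f'\<in>S. \<forall>t. (f has_vector_derivative f' t) (at t)" and f: "f \<in> S"
  shows "Ck_on k UNIV f"
proof -
  have "nth_derivative j f differentiable (at t)" for j t
    using S[OF nth_derivative_closed_class[OF S f, of j]] by (auto intro: differentiableI_vector)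
  then show ?thesis
    by (auto simp: Ck_on_def differentiable_imp_continuous_on differentiable_on_def)
qed

text \<open>Loops that extend holomorphically to a neighbourhood of the circle. They are stable
  under linear combinations, derivatives and inversion of zero-free loops and belong to every
  admissible loop class, so one space of test loops serves all of them.\<close>

definition smooth_loops :: "(real \<Rightarrow> complex) set"
  where "smooth_loops = {\<lambda>t. R (cis (2 * pi * t)) | R U. open U \<and> sphere 0 1 \<subseteq> U \<and> R holomorphic_on U}"

lemma smooth_loopsI:
  assumes "open U" "sphere 0 1 \<subseteq> U" "R holomorphic_on U" "\<And>t. y t = R (cis (2 * pi * t))"
  shows "y \<in> smooth_loops"
  using assms unfolding smooth_loops_def by (auto simp: fun_eq_iff intro!: exI[of _ R] exI[of _ U])

lemma smooth_loops_lincomb: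
  assumes "y \<in> smooth_loops" "z \<in> smooth_loops"
  shows "(\<lambda>t. a * y t + b * z t) \<in> smooth_loops"
proof -
  obtain R U where R: "open U" "sphere 0 1 \<subseteq> U" "R holomorphic_on U" "y = (\<lambda>t. R (cis (2 * pi * t)))"
    using assms by (auto simp: smooth_loops_def)
  obtain Q W where Q: "open W" "sphere 0 1 \<subseteq> W" "Q holomorphic_on W" "z = (\<lambda>t. Q (cis (2 * pi * t)))"
    using assms by (auto simp: smooth_loops_def)
  show ?thesis
  proof (rule smooth_loopsI[of "U \<inter> W" "\<lambda>w. a * R w + b * Q w"])
    have "R holomorphic_on U \<inter> W" "Q holomorphic_on U \<inter> W"
      using R Q by (auto intro: holomorphic_on_subset)
    then show "(\<lambda>w. a * R w + b * Q w) holomorphic_on U \<inter> W"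
      by (intro holomorphic_intros)
  qed (use R Q in auto)
qed

lemma smooth_loops_inverse:
  assumes "y \<in> smooth_loops" "\<And>t. y t \<noteq> 0"
  shows "(\<lambda>t. inverse (y t)) \<in> smooth_loops"
proof -
  obtain R U where R: "open U" "sphere 0 1 \<subseteq> U" "R holomorphic_on U" "y = (\<lambda>t. R (cis (2 * pi * t)))"
    using assms by (auto simp: smooth_loops_def)
  \<comment> \<open>Zeros of \<open>R\<close> off the circle are cut out of the domain.\<close>
  let ?W = "{w \<in> U. R w \<in> - {0}}"
  have nz: "R w \<noteq> 0" if "w \<in> sphere 0 1" for w
  proof -
    have *: "cis (2 * pi * (Arg w / (2 * pi))) = w"
      using that rcis_cmod_Arg[of w] by (simp add: rcis_def)
    show ?thesis using assms(2)[of "Arg w / (2 * pi)"] unfolding R(4) * .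
  qed
  show ?thesis
  proof (rule smooth_loopsI[of ?W "\<lambda>w. inverse (R w)"])
    have "?W = U \<inter> R -` (- {0})" by auto
    then show "open ?W"
      using continuous_open_preimage[OF holomorphic_on_imp_continuous_on[OF R(3)] R(1), of "- {0}"] by (simp add: open_Compl)
    show "(\<lambda>w. inverse (R w)) holomorphic_on ?W"
      by (intro holomorphic_intros holomorphic_on_subset[OF R(3)]) auto
    show "sphere 0 1 \<subseteq> ?W" using nz R(2) by auto
  qed (use R in auto)
qed

lemma smooth_loops_affine: "(\<lambda>t. a + b * cis (2 * pi * t)) \<in> smooth_loops"
  by (rule smooth_loopsI[of UNIV "\<lambda>w. a + b * w"]) (auto intro!: holomorphic_intros)

lemma smooth_loops_derivative:
  assumes "y \<in> smooth_loops"
  shows "\<exists>y'\<in>smooth_loops. \<forall>t. (y has_vector_derivative y' t) (at t)"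
proof -
  obtain R U where R: "open U" "sphere 0 1 \<subseteq> U" "R holomorphic_on U" "y = (\<lambda>t. R (cis (2 * pi * t)))"
    using assms by (auto simp: smooth_loops_def)
  let ?y = "\<lambda>t. 2 * of_real pi * \<i> * cis (2 * pi * t) * deriv R (cis (2 * pi * t))"
  have "(y has_vector_derivative ?y t) (at t)" for t
  proof -
    have "cis (2 * pi * t) \<in> U" using R(2) by auto
    then have d: "(R has_field_derivative deriv R (cis (2 * pi * t))) (at (cis (2 * pi * t)))"
      using R holomorphic_derivI by blast
    have v: "((\<lambda>t. cis (2 * pi * t)) has_vector_derivative (2 * of_real pi * \<i> * cis (2 * pi * t))) (at t)"
      unfolding cis_conv_exp by (auto intro!: derivative_eq_intros has_vector_derivative_real_field)
    show ?thesis
      unfolding R(4) using field_vector_diff_chain_at[OF v d] by (simp only: o_def)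
  qed
  moreover have "?y \<in> smooth_loops"
    by (rule smooth_loopsI[OF R(1,2), of "\<lambda>w. 2 * of_real pi * \<i> * w * deriv R w"])
       (use R in \<open>auto intro!: holomorphic_intros\<close>)
  ultimately show ?thesis by (intro bexI[of _ ?y]) auto
qed

lemma smooth_loops_nth_derivative: "y \<in> smooth_loops \<Longrightarrow> nth_derivative j y \<in> smooth_loops"
  using nth_derivative_closed_class[of smooth_loops] smooth_loops_derivative by blast

lemma smooth_loops_Ck: "y \<in> smooth_loops \<Longrightarrow> Ck_on k UNIV y"
  using Ck_on_closed_class[of smooth_loops] smooth_loops_derivative by blast

lemma smooth_loops_has_derivative:
  assumes "y \<in> smooth_loops"
  shows "(nth_derivative j y has_vector_derivative nth_derivative (Suc j) y t) (at t)"
proof -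
  obtain y' where y': "\<forall>t. (nth_derivative j y has_vector_derivative y' t) (at t)"
    using smooth_loops_derivative[OF smooth_loops_nth_derivative[OF assms, of j]] by blast
  show ?thesis unfolding nth_derivative_Suc vector_derivative_at[OF y'[rule_format]] by (rule y'[rule_format])
qed

lemma smooth_loops_continuous:
  assumes "y \<in> smooth_loops" shows "continuous_on S y"
proof -
  have "isCont y t" for t
    using smooth_loops_has_derivative[OF assms, of 0 t] has_vector_derivative_continuous by auto
  then show ?thesis by (simp add: continuous_at_imp_continuous_on)
qed

lemma periodic_int:
  assumes "periodic y" shows "y (t + of_int n) = y t"
proof -
  have *: "y (t + of_nat n) = y t" for n t
  proof (induction n)
    case (Suc n)
    then show ?case using assms[unfolded periodic_def, rule_format, of "t + of_nat n"] by (simp add: algebra_simps)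
  qed simp
  show ?thesis
  proof (cases n)
    case (neg m)
    then have "t + of_int n + of_nat (Suc m) = t" by simp
    then show ?thesis using *[of "t + of_int n" "Suc m"] by metis
  qed (use * in auto)
qed

lemma periodic_bounded:
  fixes y :: "real \<Rightarrow> complex"
  assumes "periodic y" "continuous_on UNIV y"
  obtains K where "K \<ge> 0" "\<And>t. cmod (y t) \<le> K"
proof -
  have "compact (y ` {0..1})"
    using assms by (intro compact_continuous_image continuous_on_subset[OF assms(2)]) auto
  then obtain K where "\<forall>x\<in>y ` {0..1}. cmod x \<le> K"
    using compact_imp_bounded bounded_iff by blast
  then have K: "\<And>t. t \<in> {0..1} \<Longrightarrow> cmod (y t) \<le> K" by blast
  have "cmod (y t) \<le> K" for t
  proof -
    have "y t = y (frac t)" using periodic_int[OF assms(1), of t "- \<lfloor>t\<rfloor>"] by (simp add: frac_def)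
    then show ?thesis using K[of "frac t"] by (simp add: frac_lt_1 less_imp_le)
  qed
  moreover have "0 \<le> K" using K[of 0] by (meson atLeastAtMost_iff norm_ge_zero order.trans order_refl zero_le_one)
  ultimately show ?thesis using that by blast
qed

lemma smooth_loops_periodic: "y \<in> smooth_loops \<Longrightarrow> periodic y"
proof -
  have *: "cis (2 * pi * (t + 1)) = cis (2 * pi * t)" for t
  proof -
    have "2 * pi * (t + 1) = 2 * pi * t + 2 * pi" by (simp add: algebra_simps)
    then show ?thesis using cis_mult[of "2 * pi * t" "2 * pi"] by simp
  qed
  assume "y \<in> smooth_loops"
  then obtain R where "y = (\<lambda>t. R (cis (2 * pi * t)))" unfolding smooth_loops_def by blast
  then show "periodic y" unfolding periodic_def by (simp only: * simp_thms)
qed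

lemma smooth_loops_bounded:
  assumes "y \<in> smooth_loops" obtains K where "K \<ge> 0" "\<And>t. cmod (y t) \<le> K"
  using periodic_bounded[OF smooth_loops_periodic[OF assms] smooth_loops_continuous[OF assms]] that by blast

lemma nth_derivative_lincomb:
  assumes "y \<in> smooth_loops" "z \<in> smooth_loops"
  shows "nth_derivative j (\<lambda>t. a * y t + b * z t) = (\<lambda>t. a * nth_derivative j y t + b * nth_derivative j z t)"
proof (induction j)
  case (Suc j)
  have "((\<lambda>t. a * nth_derivative j y t + b * nth_derivative j z t) has_vector_derivative
      a * nth_derivative (Suc j) y t + b * nth_derivative (Suc j) z t) (at t)" for t
    by (intro has_vector_derivative_add has_vector_derivative_mult_right smooth_loops_has_derivative assms)
  then show ?case
    unfolding nth_derivative_Suc[of j "\<lambda>t. a * y t + b * z t"] Suc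
    by (intro ext vector_derivative_at)
qed simp

section \<open>Test functions and weak derivatives\<close>

text \<open>For \<open>m = 0\<close> this is the classical flat function exp(-1/u) on the positive
  reals; the powers of 1/u close the family under differentiation, up to linear
  combinations.\<close>

definition flat_exp :: "nat \<Rightarrow> real \<Rightarrow> real"
  where "flat_exp m u = (if 0 < u then (1 / u) ^ m * exp (- (1 / u)) else 0)"

lemma flat_exp_derivative:
  "(flat_exp m has_real_derivative (flat_exp (m + 2) u - real m * flat_exp (m + 1) u)) (at u)"
proof -
  consider "u > 0" | "u < 0" | "u = 0" by linarith
  then show ?thesis
  proof cases
    case 1
    have inv: "((\<lambda>u. 1 / u) has_real_derivative (- ((1 / u) ^ 2))) (at u)"
      using 1 by (auto intro!: derivative_eq_intros simp: power2_eq_square)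
    have "((\<lambda>u. (1 / u) ^ m * exp (- (1 / u))) has_real_derivative
        (real m * ((- ((1 / u) ^ 2)) * (1 / u) ^ (m - Suc 0)) * exp (- (1 / u))
          + exp (- (1 / u)) * (- (- ((1 / u) ^ 2))) * (1 / u) ^ m)) (at u)"
      by (intro DERIV_mult DERIV_power DERIV_fun_exp DERIV_minus inv)
    moreover have "real m * ((- ((1 / u) ^ 2)) * (1 / u) ^ (m - Suc 0)) * exp (- (1 / u))
          + exp (- (1 / u)) * (- (- ((1 / u) ^ 2))) * (1 / u) ^ m
        = flat_exp (m + 2) u - real m * flat_exp (m + 1) u"
      using 1 by (cases m) (simp_all add: flat_exp_def power_add power2_eq_square algebra_simps)
    ultimately have "((\<lambda>u. (1 / u) ^ m * exp (- (1 / u))) has_real_derivative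
        (flat_exp (m + 2) u - real m * flat_exp (m + 1) u)) (at u)"
      by metis
    then show ?thesis
      by (rule has_field_derivative_transform_within_open[of _ _ _ "{0<..}"])
         (use 1 in \<open>auto simp: flat_exp_def\<close>)
  next
    case 2
    have "((\<lambda>u. 0) has_real_derivative (flat_exp (m + 2) u - real m * flat_exp (m + 1) u)) (at u)"
      using 2 by (simp add: flat_exp_def)
    then show ?thesis
      by (rule has_field_derivative_transform_within_open[of _ _ _ "{..<0}"])
         (use 2 in \<open>auto simp: flat_exp_def\<close>)
  next
    case 3
    \<comment> \<open>At 0 the exponential beats every power of 1/h from the right, and from the
      left the function is zero.\<close>
    have "((\<lambda>h. (flat_exp m (0 + h) - flat_exp m 0) / h) \<longlongrightarrow> 0) (at_right 0)"
    proof (rule tendsto_cong[THEN iffD1, rotated])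
      show "((\<lambda>h::real. (1 / h) ^ m * exp (- (1 / h)) / h) \<longlongrightarrow> 0) (at_right 0)" by real_asymp
      show "\<forall>\<^sub>F h in at_right 0. (1 / h) ^ m * exp (- (1 / h)) / h = (flat_exp m (0 + h) - flat_exp m 0) / h"
        by (auto simp: eventually_at_right_field flat_exp_def intro: exI[of _ 1])
    qed
    moreover have "((\<lambda>h. (flat_exp m (0 + h) - flat_exp m 0) / h) \<longlongrightarrow> 0) (at_left 0)"
    proof (rule tendsto_eventually)
      show "\<forall>\<^sub>F h in at_left 0. (flat_exp m (0 + h) - flat_exp m 0) / h = 0"
        by (auto simp: eventually_at_left_field flat_exp_def intro: exI[of _ "-1"])
    qed
    ultimately have "((\<lambda>h. (flat_exp m (0 + h) - flat_exp m 0) / h) \<longlongrightarrow> 0) (at 0)"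
      by (simp add: filterlim_at_split)
    then show ?thesis unfolding 3 DERIV_def by (simp add: flat_exp_def)
  qed
qed

text \<open>Stable under differentiation and rich enough to contain the cut-off functions built
  below, whose smoothness is then automatic.\<close>

inductive_set flat_exp_algebra :: "(real \<Rightarrow> real) set" where
  const: "(\<lambda>t. c) \<in> flat_exp_algebra"
| left: "(\<lambda>t. flat_exp m (t - a)) \<in> flat_exp_algebra"
| right: "(\<lambda>t. flat_exp m (b - t)) \<in> flat_exp_algebra"
| add: "f \<in> flat_exp_algebra \<Longrightarrow> g \<in> flat_exp_algebra \<Longrightarrow> (\<lambda>t. f t + g t) \<in> flat_exp_algebra"
| mult: "f \<in> flat_exp_algebra \<Longrightarrow> g \<in> flat_exp_algebra \<Longrightarrow> (\<lambda>t. f t * g t) \<in> flat_exp_algebra"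

lemma flat_exp_algebra_scale: "f \<in> flat_exp_algebra \<Longrightarrow> (\<lambda>t. c * f t) \<in> flat_exp_algebra"
  using flat_exp_algebra.mult[OF flat_exp_algebra.const] .

lemma flat_exp_algebra_power: "f \<in> flat_exp_algebra \<Longrightarrow> (\<lambda>t. f t ^ k) \<in> flat_exp_algebra"
  by (induction k) (auto intro: flat_exp_algebra.intros)

lemma flat_exp_algebra_real_derivative:
  assumes "f \<in> flat_exp_algebra"
  shows "\<exists>f'\<in>flat_exp_algebra. \<forall>t. (f has_real_derivative f' t) (at t)"
  using assms
proof induction
  case (const c)
  have "\<forall>t. ((\<lambda>t. c) has_real_derivative 0) (at t)" by simp
  then show ?case by (intro bexI[OF _ flat_exp_algebra.const[of 0]])
next
  case (left m a)
  have "(\<lambda>t. flat_exp (m + 2) (t - a) + (- real m) * flat_exp (m + 1) (t - a)) \<in> flat_exp_algebra"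
    by (intro flat_exp_algebra.add flat_exp_algebra_scale flat_exp_algebra.left)
  moreover have "((\<lambda>t. flat_exp m (t - a)) has_real_derivative
      flat_exp (m + 2) (t - a) + (- real m) * flat_exp (m + 1) (t - a)) (at t)" for t
    by (rule DERIV_cong[OF DERIV_chain'[where g = "flat_exp m" and f = "\<lambda>t. t - a" and D = 1, OF _ flat_exp_derivative]])
       (auto intro!: derivative_eq_intros)
  ultimately show ?case by (intro bexI) auto
next
  case (right m b)
  have "(\<lambda>t. (- 1) * flat_exp (m + 2) (b - t) + real m * flat_exp (m + 1) (b - t)) \<in> flat_exp_algebra"
    by (intro flat_exp_algebra.add flat_exp_algebra_scale flat_exp_algebra.right)
  moreover have "((\<lambda>t. flat_exp m (b - t)) has_real_derivative
      (- 1) * flat_exp (m + 2) (b - t) + real m * flat_exp (m + 1) (b - t)) (at t)" for t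
    by (rule DERIV_cong[OF DERIV_chain'[where g = "flat_exp m" and f = "\<lambda>t. b - t" and D = "-1", OF _ flat_exp_derivative]])
       (auto intro!: derivative_eq_intros)
  ultimately show ?case by (intro bexI) auto
next
  case (add f g)
  then obtain f' g' where "f' \<in> flat_exp_algebra" "g' \<in> flat_exp_algebra"
    "\<forall>t. (f has_real_derivative f' t) (at t)" "\<forall>t. (g has_real_derivative g' t) (at t)" by blast
  then show ?case
    by (intro bexI[of _ "\<lambda>t. f' t + g' t"] flat_exp_algebra.add) (auto intro: DERIV_add)
next
  case (mult f g)
  then obtain f' g' where "f' \<in> flat_exp_algebra" "g' \<in> flat_exp_algebra"
    "\<forall>t. (f has_real_derivative f' t) (at t)" "\<forall>t. (g has_real_derivative g' t) (at t)" by blast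
  then show ?case using mult.hyps
    by (intro bexI[of _ "\<lambda>t. f' t * g t + g' t * f t"] flat_exp_algebra.add flat_exp_algebra.mult)
       (auto intro: DERIV_mult)
qed

lemma flat_exp_algebra_Ck: "f \<in> flat_exp_algebra \<Longrightarrow> Ck_on k UNIV f"
  using Ck_on_closed_class[of flat_exp_algebra f k] flat_exp_algebra_real_derivative
  unfolding has_real_derivative_iff_has_vector_derivative by blast

definition test_function :: "(real \<Rightarrow> real) \<Rightarrow> bool"
  where "test_function \<phi> \<longleftrightarrow> Ck_on \<infinity> UNIV \<phi> \<and> compact (closure {t. \<phi> t \<noteq> 0})"

text \<open>With \<open>0 \<le> \<psi> < 1\<close> smooth and positive exactly on \<open>(a, b)\<close>, the functions \<open>1 - (1 - \<psi>) ^ k\<close>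
  approximate the indicator function of the interval.\<close>

lemma test_function_indicator:
  obtains \<phi> :: "nat \<Rightarrow> real \<Rightarrow> real" where "\<And>k. test_function (\<phi> k)"
    "\<And>k t. 0 \<le> \<phi> k t \<and> \<phi> k t \<le> indicator {a..b} t" "\<And>t. (\<lambda>k. \<phi> k t) \<longlonglongrightarrow> indicator {a<..<b} t"
proof -
  define \<psi> where "\<psi> t = flat_exp 0 (t - a) * flat_exp 0 (b - t)" for t
  define \<phi> where "\<phi> k t = 1 + (-1) * (1 + (-1) * \<psi> t) ^ k" for k t
  have "\<phi> k \<in> flat_exp_algebra" for k
    unfolding \<phi>_def \<psi>_def
    by (intro flat_exp_algebra.intros flat_exp_algebra_scale flat_exp_algebra_power)
  then have Ck: "Ck_on \<infinity> UNIV (\<phi> k)" for k by (rule flat_exp_algebra_Ck)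
  have \<psi>: "0 \<le> \<psi> t" "\<psi> t < 1" "t \<notin> {a<..<b} \<Longrightarrow> \<psi> t = 0" "t \<in> {a<..<b} \<Longrightarrow> \<psi> t > 0" for t
  proof -
    have e: "0 \<le> flat_exp 0 u" "flat_exp 0 u < 1" for u by (auto simp: flat_exp_def)
    show "0 \<le> \<psi> t" using e by (simp add: \<psi>_def)
    have "\<psi> t \<le> flat_exp 0 (t - a) * 1" unfolding \<psi>_def using e[of "t - a"] e[of "b - t"] by (intro mult_left_mono) auto
    then show "\<psi> t < 1" using e(2)[of "t - a"] by simp
    show "t \<notin> {a<..<b} \<Longrightarrow> \<psi> t = 0" by (auto simp: \<psi>_def flat_exp_def)
    show "t \<in> {a<..<b} \<Longrightarrow> \<psi> t > 0" by (auto simp: \<psi>_def flat_exp_def)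
  qed
  have supp: "\<phi> k t = 0" if "t \<notin> {a<..<b}" for k t
    using \<psi>(3)[OF that] by (simp add: \<phi>_def)
  have pw: "0 \<le> (1 + (-1) * \<psi> t) ^ k" "(1 + (-1) * \<psi> t) ^ k \<le> 1" for k t
    using \<psi>(1,2)[of t] by (auto intro!: zero_le_power power_le_one)
  show ?thesis
  proof (rule that[of \<phi>])
    show "test_function (\<phi> k)" for k
    proof -
      have "{t. \<phi> k t \<noteq> 0} \<subseteq> {a<..<b}" using supp by blast
      also have "\<dots> \<subseteq> {a..b}" by auto
      finally have "{t. \<phi> k t \<noteq> 0} \<subseteq> {a..b}" .
      then have "bounded {t. \<phi> k t \<noteq> 0}" using bounded_closed_interval bounded_subset by blast
      then show ?thesis using Ck by (simp add: test_function_def compact_closure)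
    qed
    show "0 \<le> \<phi> k t \<and> \<phi> k t \<le> indicator {a..b} t" for k t
      using pw[of t k] supp[of t k] by (cases "t \<in> {a<..<b}") (auto simp: \<phi>_def indicator_def)
    show "(\<lambda>k. \<phi> k t) \<longlonglongrightarrow> indicator {a<..<b} t" for t
    proof (cases "t \<in> {a<..<b}")
      case True
      have "(\<lambda>k. (1 + (-1) * \<psi> t) ^ k) \<longlonglongrightarrow> 0"
        using \<psi>(2)[of t] \<psi>(4)[OF True] by (intro LIMSEQ_realpow_zero) auto
      from tendsto_add[OF tendsto_const[of 1] tendsto_mult[OF tendsto_const[of "-1"] this]]
      show ?thesis using True by (simp add: \<phi>_def)
    qed (simp add: supp)
  qed
qed

lemma Lp_loc_1_iff:
  "Lp_loc 1 UNIV g \<longleftrightarrow> g \<in> borel_measurable lborel \<and> (\<forall>K. compact K \<longrightarrow> set_integrable lborel K g)"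
proof -
  have "set_integrable lborel K (\<lambda>t. cmod (g t)) \<longleftrightarrow> set_integrable lborel K g"
    if g: "g \<in> borel_measurable lborel" and K: "compact K" for K
  proof -
    have "K \<in> sets lborel" using K by (simp add: borel_compact)
    then have "(\<lambda>t. indicat_real K t *\<^sub>R g t) \<in> borel_measurable lborel" using g by simp
    from integrable_norm_iff[OF this] show ?thesis by (simp add: set_integrable_def)
  qed
  then show ?thesis by (auto simp: Lp_loc_def set_borel_measurable_def)
qed

lemma integrable_test_mult:
  fixes g :: "real \<Rightarrow> complex"
  assumes g: "Lp_loc 1 UNIV g" and \<phi>: "continuous_on UNIV \<phi>" and K: "compact K" "\<And>t. t \<notin> K \<Longrightarrow> \<phi> t = 0"
  shows "integrable lborel (\<lambda>t. \<phi> t *\<^sub>R g t)"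
proof -
  have "compact (\<phi> ` K)" using \<phi> K by (intro compact_continuous_image) (auto intro: continuous_on_subset)
  then obtain B where B: "\<forall>x\<in>\<phi> ` K. norm x \<le> B" using compact_imp_bounded bounded_iff by blast
  have gK: "set_integrable lborel K g" and gm: "g \<in> borel_measurable lborel" using g K by (auto simp: Lp_loc_1_iff)
  have pm: "\<phi> \<in> borel_measurable lborel" using borel_measurable_continuous_onI[OF \<phi>] by simp
  show ?thesis
  proof (rule Bochner_Integration.integrable_bound)
    show "integrable lborel (\<lambda>t. B *\<^sub>R (indicat_real K t *\<^sub>R g t))"
      using gK unfolding set_integrable_def by (intro integrable_scaleR_right) auto
    show "(\<lambda>t. \<phi> t *\<^sub>R g t) \<in> borel_measurable lborel" using gm pm by simp
    have "norm (\<phi> t *\<^sub>R g t) \<le> norm (B *\<^sub>R (indicat_real K t *\<^sub>R g t))" for t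
    proof (cases "t \<in> K")
      case True
      then have "\<bar>\<phi> t\<bar> \<le> \<bar>B\<bar>" using B by force
      then show ?thesis using True by (simp add: mult_right_mono)
    qed (simp add: K)
    then show "AE t in lborel. norm (\<phi> t *\<^sub>R g t) \<le> norm (B *\<^sub>R (indicat_real K t *\<^sub>R g t))" by simp
  qed
qed

lemma Lp_loc_1_continuous:
  assumes "continuous_on UNIV f" shows "Lp_loc 1 UNIV f"
  unfolding Lp_loc_1_iff set_integrable_def
  using assms by (auto simp: borel_measurable_continuous_onI intro!: borel_integrable_compact intro: continuous_on_subset)

lemma Lp_loc_1_lincomb:
  assumes "Lp_loc 1 UNIV f" "Lp_loc 1 UNIV g"
  shows "Lp_loc 1 UNIV (\<lambda>t. a * f t + b * g t)"
  using assms unfolding Lp_loc_1_iff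
  by (auto intro!: set_integral_add set_integrable_mult_right)

lemma test_function_derivatives:
  assumes "test_function \<phi>"
  shows "continuous_on UNIV (nth_derivative j \<phi>)"
    "(nth_derivative j \<phi> has_real_derivative nth_derivative (Suc j) \<phi> t) (at t)"
    "t \<notin> closure {t. \<phi> t \<noteq> 0} \<Longrightarrow> nth_derivative j \<phi> t = 0"
    "compact (closure {t. \<phi> t \<noteq> 0})"
    "test_function (nth_derivative j \<phi>)"
proof -
  have C: "Ck_on \<infinity> UNIV \<phi>" and K: "compact (closure {t. \<phi> t \<noteq> 0})" using assms by (auto simp: test_function_def)
  show "compact (closure {t. \<phi> t \<noteq> 0})" by (rule K)
  show c: "continuous_on UNIV (nth_derivative j \<phi>)" for j using C by (auto simp: Ck_on_def)
  have dif: "nth_derivative j \<phi> differentiable (at t)" for j t using C by (auto simp: Ck_on_def)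
  then show d: "(nth_derivative j \<phi> has_real_derivative nth_derivative (Suc j) \<phi> t) (at t)" for j t
    unfolding nth_derivative_Suc has_real_derivative_iff_has_vector_derivative
    by (simp add: vector_derivative_works)
  have z: "nth_derivative j \<phi> t = 0" if "t \<notin> closure {t. \<phi> t \<noteq> 0}" for j t
    using that
  proof (induction j arbitrary: t)
    case 0
    then show ?case using closure_subset[of "{t. \<phi> t \<noteq> 0}"] by auto
  next
    case (Suc j)
    have "((\<lambda>t. 0) has_real_derivative 0) (at t)" by simp
    then have "(nth_derivative j \<phi> has_real_derivative 0) (at t)"
      by (rule has_field_derivative_transform_within_open[of _ _ _ "- closure {t. \<phi> t \<noteq> 0}"])
         (use Suc.prems in \<open>auto simp: Suc.IH\<close>)
    with d[of j t] show ?case by (rule DERIV_unique)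
  qed
  show "t \<notin> closure {t. \<phi> t \<noteq> 0} \<Longrightarrow> nth_derivative j \<phi> t = 0" by (rule z)
  have "nth_derivative i (nth_derivative j \<phi>) = nth_derivative (i + j) \<phi>" for i
    by (simp add: nth_derivative_def funpow_add)
  then have "Ck_on \<infinity> UNIV (nth_derivative j \<phi>)" using dif c by (simp add: Ck_on_def)
  moreover have "closure {t. nth_derivative j \<phi> t \<noteq> 0} \<subseteq> closure {t. \<phi> t \<noteq> 0}"
    using z by (intro closure_minimal) auto
  then have "compact (closure {t. nth_derivative j \<phi> t \<noteq> 0})"
    using K by (metis closed_closure closure_closure compact_Int_closed inf.absorb_iff2)
  ultimately show "test_function (nth_derivative j \<phi>)" by (simp add: test_function_def)
qed

lemma integrable_test_derivative_mult:
  fixes g :: "real \<Rightarrow> complex"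
  assumes "test_function \<phi>" "Lp_loc 1 UNIV g"
  shows "integrable lborel (\<lambda>t. nth_derivative j \<phi> t *\<^sub>R g t)"
  by (rule integrable_test_mult[OF assms(2) test_function_derivatives(1,4)[OF assms(1)]])
     (rule test_function_derivatives(3)[OF assms(1)])

lemma weak_derivative_UNIV:
  "weak_derivative UNIV j f g \<longleftrightarrow> Lp_loc 1 UNIV g \<and>
    (\<forall>\<phi>. test_function \<phi> \<longrightarrow>
      (LINT t|lborel. nth_derivative j \<phi> t *\<^sub>R f t) = (-1) ^ j * (LINT t|lborel. \<phi> t *\<^sub>R g t))"
  by (simp add: weak_derivative_def test_function_def set_lebesgue_integral_def)

lemma weak_derivative_Lp_loc: "weak_derivative J j f g \<Longrightarrow> Lp_loc 1 J g"
  by (simp only: weak_derivative_def)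

lemma weak_derivative_eq:
  "weak_derivative UNIV j f g \<Longrightarrow> test_function \<phi> \<Longrightarrow>
    (LINT t|lborel. nth_derivative j \<phi> t *\<^sub>R f t) = (-1) ^ j * (LINT t|lborel. \<phi> t *\<^sub>R g t)"
  unfolding weak_derivative_UNIV by blast

text \<open>Test functions approximate indicators of open intervals, so the integral of
  \<open>g\<close> over every such interval vanishes. Intervals generate the Borel sets and are
  stable under intersection, so the integral over every Borel set vanishes.\<close>

lemma du_Bois_Reymond:
  fixes g :: "real \<Rightarrow> complex"
  assumes g: "Lp_loc 1 UNIV g" and z: "\<And>\<phi>. test_function \<phi> \<Longrightarrow> (LINT t|lborel. \<phi> t *\<^sub>R g t) = 0"
  shows "AE t in lborel. g t = 0"
proof -
  have gm: "g \<in> borel_measurable lborel" and gK: "\<And>K. compact K \<Longrightarrow> set_integrable lborel K g"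
    using g by (auto simp: Lp_loc_1_iff)
  have I: "(LINT t:{a<..<b}|lborel. g t) = 0" for a b
  proof -
    obtain \<phi> where \<phi>: "\<And>k. test_function (\<phi> k)"
      "\<And>k t. 0 \<le> \<phi> k t \<and> \<phi> k t \<le> indicator {a..b} t" "\<And>t. (\<lambda>k. \<phi> k t) \<longlonglongrightarrow> indicat_real {a<..<b} t"
      using test_function_indicator[of a b] by blast
    have "(\<lambda>k. LINT t|lborel. \<phi> k t *\<^sub>R g t) \<longlonglongrightarrow> (LINT t|lborel. indicator {a<..<b} t *\<^sub>R g t)"
    proof (rule integral_dominated_convergence[where w = "\<lambda>t. norm (indicator {a..b} t *\<^sub>R g t)"])
      show "(\<lambda>t. \<phi> k t *\<^sub>R g t) \<in> borel_measurable lborel" for k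
        using integrable_test_derivative_mult[OF \<phi>(1) g, of 0 k] by simp
      show "integrable lborel (\<lambda>t. norm (indicat_real {a..b} t *\<^sub>R g t))"
        using gK[of "{a..b}"] by (intro integrable_norm) (simp add: set_integrable_def)
      show "AE t in lborel. (\<lambda>k. \<phi> k t *\<^sub>R g t) \<longlonglongrightarrow> indicat_real {a<..<b} t *\<^sub>R g t"
        using \<phi>(3) by (auto intro!: AE_I2 tendsto_scaleR)
      show "AE t in lborel. norm (\<phi> k t *\<^sub>R g t) \<le> norm (indicat_real {a..b} t *\<^sub>R g t)" for k
      proof (rule AE_I2)
        fix t
        have "\<bar>\<phi> k t\<bar> \<le> \<bar>indicat_real {a..b} t\<bar>" using \<phi>(2)[of k t] by simp
        then show "norm (\<phi> k t *\<^sub>R g t) \<le> norm (indicat_real {a..b} t *\<^sub>R g t)"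
          by (simp add: mult_right_mono)
      qed
    qed (use gm in simp)
    then show ?thesis using z[OF \<phi>(1)] by (simp add: set_lebesgue_integral_def LIMSEQ_const_iff)
  qed
  \<comment> \<open>\<open>g\<close> is only locally integrable; truncation to bounded intervals
    makes it integrable, and countably many of them cover the line.\<close>
  have "AE t in lborel. indicat_real {- real n<..<real n} t *\<^sub>R g t = 0" for n
  proof -
    let ?f = "\<lambda>t. indicat_real {- real n<..<real n} t *\<^sub>R g t"
    have fi: "integrable lborel ?f"
      using set_integrable_subset[OF gK[of "{- real n..real n}"], of "{- real n<..<real n}"]
      by (force simp: set_integrable_def)
    have si: "set_integrable lborel A ?f" if "A \<in> sets borel" for A
      unfolding set_integrable_def by (rule integrable_mult_indicator[OF _ fi]) (simp add: that)
    have ss: "sets borel = sigma_sets UNIV (range (\<lambda>(a, b). {a<..<b :: real}))"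
    proof -
      have "sets borel = sets (sigma UNIV (range (\<lambda>(a, b). {a<..<b :: real})))"
        using borel_eq_box[where 'a = real] by (simp only: box_real)
      then show ?thesis by simp
    qed
    have "(LINT t:A|lborel. ?f t) = 0" if "A \<in> sets borel" for A
    proof -
      have st: "Int_stable (range (\<lambda>(a, b). {a<..<b :: real}))"
      proof (rule Int_stableI)
        fix S T assume "S \<in> range (\<lambda>(a, b). {a<..<b :: real})" "T \<in> range (\<lambda>(a, b). {a<..<b :: real})"
        then obtain a b c d where "S = {a<..<b}" "T = {c<..<d}" by auto
        then have "S \<inter> T = (case (max a c, min b d) of (a, b) \<Rightarrow> {a<..<b})" by auto
        then show "S \<inter> T \<in> range (\<lambda>(a, b). {a<..<b :: real})" by (rule range_eqI)
      qed
      have "A \<in> sigma_sets UNIV (range (\<lambda>(a, b). {a<..<b :: real}))" using that ss by simp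
      with st subset_UNIV[of "range (\<lambda>(a, b). {a<..<b :: real})", folded Pow_UNIV] show ?thesis
      proof (induction rule: sigma_sets_induct_disjoint)
        case (basic A)
        then obtain a b where "A = {a<..<b}" by auto
        then have "indicat_real A t *\<^sub>R ?f t = indicat_real {max a (- real n)<..<min b (real n)} t *\<^sub>R g t" for t
          by (auto simp: indicator_def)
        then show ?case using I[of "max a (- real n)" "min b (real n)"] by (simp only: set_lebesgue_integral_def)
      next
        case empty then show ?case by (simp add: set_lebesgue_integral_def)
      next
        case (compl A)
        then have A: "A \<in> sets borel" using ss by simp
        have "(LINT t:(UNIV - A) \<union> A|lborel. ?f t) = (LINT t:(UNIV - A)|lborel. ?f t) + (LINT t:A|lborel. ?f t)"
          using A si by (intro set_integral_Un) auto
        moreover have "(LINT t:UNIV|lborel. ?f t) = 0"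
          using I[of "- real n" "real n"] by (simp add: set_lebesgue_integral_def)
        ultimately show ?case using compl by simp
      next
        case (union A)
        then have A: "A i \<in> sets borel" for i using ss by auto
        have "(LINT t:(\<Union>i. A i)|lborel. ?f t) = (\<Sum>i. (LINT t:(A i)|lborel. ?f t))"
          using A si union(1) by (intro lebesgue_integral_countable_add)
            (auto simp: disjoint_family_on_def)
        then show ?case using union by simp
      qed
    qed
    then show ?thesis by (intro sigma_finite_measure.density_zero[OF lborel.sigma_finite_measure_axioms fi]) simp
  qed
  then have "AE t in lborel. \<forall>n. indicat_real {- real n<..<real n} t *\<^sub>R g t = 0"
    unfolding AE_all_countable by blast
  then show ?thesis
  proof (rule AE_mp, intro AE_I2 impI)
    fix t assume *: "\<forall>n. indicat_real {- real n<..<real n} t *\<^sub>R g t = 0"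
    obtain n where "real n > \<bar>t\<bar>" using reals_Archimedean2 by blast
    then show "g t = 0" using *[rule_format, of n] by (auto simp: indicator_def split: if_splits)
  qed
qed

lemma weak_derivative_unique:
  assumes "weak_derivative UNIV j f g" "weak_derivative UNIV j f h"
  shows "AE t in lborel. g t = h t"
proof -
  have l: "Lp_loc 1 UNIV g" "Lp_loc 1 UNIV h" using assms weak_derivative_Lp_loc by blast+
  have "AE t in lborel. 1 * g t + (-1) * h t = 0"
  proof (rule du_Bois_Reymond[OF Lp_loc_1_lincomb[OF l]])
    fix \<phi> assume \<phi>: "test_function \<phi>"
    have "(LINT t|lborel. \<phi> t *\<^sub>R g t) = (LINT t|lborel. \<phi> t *\<^sub>R h t)"
    proof -
      have "(-1) ^ j * (LINT t|lborel. \<phi> t *\<^sub>R g t) = (-1) ^ j * (LINT t|lborel. \<phi> t *\<^sub>R h t)"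
        using weak_derivative_eq[OF assms(1) \<phi>] weak_derivative_eq[OF assms(2) \<phi>] by (rule trans[OF sym])
      then show ?thesis by simp
    qed
    then show "(LINT t|lborel. \<phi> t *\<^sub>R (1 * g t + (-1) * h t)) = 0"
      using integrable_test_derivative_mult[OF \<phi> l(1), of 0] integrable_test_derivative_mult[OF \<phi> l(2), of 0]
      by (simp add: scaleR_diff_right)
  qed
  then show ?thesis by simp
qed

lemma weak_derivative_lincomb:
  assumes "weak_derivative UNIV j x g" "weak_derivative UNIV j y h"
    and "continuous_on UNIV x" "continuous_on UNIV y"
  shows "weak_derivative UNIV j (\<lambda>t. a * x t + b * y t) (\<lambda>t. a * g t + b * h t)"
proof -
  have l: "Lp_loc 1 UNIV g" "Lp_loc 1 UNIV h" "Lp_loc 1 UNIV x" "Lp_loc 1 UNIV y"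
    using assms weak_derivative_Lp_loc Lp_loc_1_continuous by blast+
  have *: "(LINT t|lborel. nth_derivative i \<phi> t *\<^sub>R (a * u t + b * v t)) =
      a * (LINT t|lborel. nth_derivative i \<phi> t *\<^sub>R u t) + b * (LINT t|lborel. nth_derivative i \<phi> t *\<^sub>R v t)"
    if "test_function \<phi>" "Lp_loc 1 UNIV u" "Lp_loc 1 UNIV v" for \<phi> u v i
  proof -
    note i = integrable_test_derivative_mult[OF that(1,2), of i] integrable_test_derivative_mult[OF that(1,3), of i]
    have "nth_derivative i \<phi> t *\<^sub>R (a * u t + b * v t) =
        a * (nth_derivative i \<phi> t *\<^sub>R u t) + b * (nth_derivative i \<phi> t *\<^sub>R v t)" for t
      by (simp add: scaleR_conv_of_real algebra_simps)
    then show ?thesis using i by (simp del: mult_scaleR_right)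
  qed
  show ?thesis
    unfolding weak_derivative_UNIV
  proof (intro conjI allI impI Lp_loc_1_lincomb l)
    fix \<phi> assume \<phi>: "test_function \<phi>"
    show "(LINT t|lborel. nth_derivative j \<phi> t *\<^sub>R (a * x t + b * y t)) =
        (-1) ^ j * (LINT t|lborel. \<phi> t *\<^sub>R (a * g t + b * h t))"
      using *[OF \<phi> l(3,4), of j] *[OF \<phi> l(1,2), of 0]
      unfolding weak_derivative_eq[OF assms(1) \<phi>] weak_derivative_eq[OF assms(2) \<phi>] nth_derivative_0
      by (simp add: algebra_simps del: mult_scaleR_right)
  qed
qed

lemma has_vector_derivative_continuous_on:
  assumes "\<And>t. (u has_vector_derivative u' t) (at t)" shows "continuous_on S u"
  using has_vector_derivative_continuous[OF assms] by (simp add: continuous_at_imp_continuous_on)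

lemma integral_by_parts_test:
  fixes u :: "real \<Rightarrow> complex"
  assumes \<phi>: "test_function \<phi>"
    and u: "\<And>t. (u has_vector_derivative u' t) (at t)" "continuous_on UNIV u'"
  shows "(LINT t|lborel. nth_derivative 1 \<phi> t *\<^sub>R u t) = - (LINT t|lborel. \<phi> t *\<^sub>R u' t)"
proof -
  note d = test_function_derivatives[OF \<phi>]
  have uc: "continuous_on UNIV u"
    by (rule has_vector_derivative_continuous_on[OF u(1)])
  \<comment> \<open>The support lies in the open interval, so both boundary terms vanish.\<close>
  obtain B where B: "B > 0" "closure {t. \<phi> t \<noteq> 0} \<subseteq> {-B<..<B}"
  proof -
    obtain B where "B > 0" and B: "\<forall>x\<in>closure {t. \<phi> t \<noteq> 0}. norm x < B"
      using compact_imp_bounded[OF d(4)] bounded_pos_less by blast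
    have "closure {t. \<phi> t \<noteq> 0} \<subseteq> {-B<..<B}"
    proof
      fix x assume "x \<in> closure {t. \<phi> t \<noteq> 0}"
      then have "\<bar>x\<bar> < B" using bspec[OF B] unfolding real_norm_def by blast
      then show "x \<in> {-B<..<B}" unfolding greaterThanLessThan_iff by linarith
    qed
    then show ?thesis by (rule that[OF \<open>B > 0\<close>])
  qed
  let ?F = "\<lambda>t. \<phi> t *\<^sub>R u' t + nth_derivative 1 \<phi> t *\<^sub>R u t"
  have "(LINT t|lborel. indicat_real {-B..B} t *\<^sub>R ?F t) = \<phi> B *\<^sub>R u B - \<phi> (-B) *\<^sub>R u (-B)"
  proof (rule integral_FTC_Icc)
    show "((\<lambda>t. \<phi> t *\<^sub>R u t) has_vector_derivative ?F t) (at t within {-B..B})" for t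
    proof -
      have "(\<phi> has_field_derivative nth_derivative 1 \<phi> t) (at t)"
        using d(2)[of 0 t] by (simp only: nth_derivative_0 One_nat_def)
      then show ?thesis
        by (rule has_vector_derivative_at_within[OF has_vector_derivative_scaleR[OF _ u(1)]])
    qed
    show "continuous_on {-B..B} ?F"
      using d(1)[of 0] d(1)[of 1] uc u(2) unfolding nth_derivative_0
      by (intro continuous_on_add continuous_on_scaleR) (erule continuous_on_subset, simp)+
  qed (use B in simp)
  moreover have "indicat_real {-B..B} t *\<^sub>R ?F t = ?F t" for t
  proof (cases "t \<in> {-B..B}")
    case False
    then have "t \<notin> closure {t. \<phi> t \<noteq> 0}" using subsetD[OF B(2), of t] by auto
    from d(3)[OF this, of 0] d(3)[OF this, of 1] show ?thesis by simp
  qed simp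
  moreover have "B \<notin> closure {t. \<phi> t \<noteq> 0}" "- B \<notin> closure {t. \<phi> t \<noteq> 0}"
    using subsetD[OF B(2), of B] subsetD[OF B(2), of "-B"] by auto
  from d(3)[OF this(1), of 0] d(3)[OF this(2), of 0] have "\<phi> B = 0" "\<phi> (-B) = 0" by simp_all
  ultimately have "(LINT t|lborel. ?F t) = 0" by simp
  moreover have "integrable lborel (\<lambda>t. \<phi> t *\<^sub>R u' t)" "integrable lborel (\<lambda>t. nth_derivative 1 \<phi> t *\<^sub>R u t)"
    using integrable_test_derivative_mult[OF \<phi> Lp_loc_1_continuous[OF u(2)], of 0]
      integrable_test_derivative_mult[OF \<phi> Lp_loc_1_continuous[OF uc], of 1] by simp_all
  ultimately show ?thesis by (simp add: eq_neg_iff_add_eq_0 add.commute)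
qed

text \<open>Repeated integration by parts. The induction peels the first derivative off the test
  function, which therefore has to vary; the hypothesis lists all successive derivatives as a
  sequence \<open>D\<close>.\<close>

lemma weak_derivative_classical:
  assumes "\<And>j t. (D j has_vector_derivative D (Suc j) t) (at t)"
  shows "weak_derivative UNIV j (D 0) (D j)"
  unfolding weak_derivative_UNIV
proof (intro conjI allI impI)
  have c: "continuous_on UNIV (D j)" for j
    by (rule has_vector_derivative_continuous_on[OF assms])
  then show "Lp_loc 1 UNIV (D j)" by (rule Lp_loc_1_continuous)
  fix \<phi> assume "test_function \<phi>"
  then show "(LINT t|lborel. nth_derivative j \<phi> t *\<^sub>R D 0 t) = (-1) ^ j * (LINT t|lborel. \<phi> t *\<^sub>R D j t)"
  proof (induction j arbitrary: \<phi>)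
    case (Suc j)
    have t: "test_function (nth_derivative 1 \<phi>)" by (rule test_function_derivatives(5)[OF Suc.prems])
    have *: "nth_derivative (Suc j) \<phi> = nth_derivative j (nth_derivative 1 \<phi>)"
      by (simp only: nth_derivative_Suc'[of j \<phi>] nth_derivative_Suc[of 0 \<phi>] One_nat_def nth_derivative_0)
    have "(LINT t|lborel. nth_derivative (Suc j) \<phi> t *\<^sub>R D 0 t) =
        (-1) ^ j * (LINT t|lborel. nth_derivative 1 \<phi> t *\<^sub>R D j t)"
      unfolding * by (rule Suc.IH[OF t])
    also have "\<dots> = (-1) ^ j * - (LINT t|lborel. \<phi> t *\<^sub>R D (Suc j) t)"
      by (subst integral_by_parts_test[OF Suc.prems assms c]) (rule refl)
    finally show ?case by (simp only: power_Suc mult_minus_left mult_minus_right mult_1_left)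
  next
    case 0
    show ?case by (simp only: nth_derivative_0 power_0 mult_1_left)
  qed
qed

section \<open>Minkowski's inequality and the loop spaces\<close>

lemma powr_convex_combination:
  fixes u v s p :: real
  assumes "0 \<le> u" "0 \<le> v" "0 \<le> s" "s \<le> 1" "1 \<le> p"
  shows "(s * u + (1 - s) * v) powr p \<le> s * u powr p + (1 - s) * v powr p"
proof -
  \<comment> \<open>Covers the cases with a vanishing argument, through
    \<open>c powr p \<le> c\<close> for \<open>c\<close> in the unit interval.\<close>
  have le: "(c * w) powr p \<le> c * w powr p" if "0 \<le> c" "c \<le> 1" "0 \<le> w" for c w :: real
  proof -
    have "c powr p \<le> c powr 1"
    proof (cases "c = 0")
      case False
      then show ?thesis using that assms by (intro powr_mono') auto
    qed simp
    then show ?thesis using that by (simp add: powr_mult mult_right_mono)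
  qed
  consider "u = 0" | "v = 0" | "u > 0" "v > 0" using assms by linarith
  then show ?thesis
  proof cases
    case 1 then show ?thesis using le[of "1 - s" v] assms by simp
  next
    case 2 then show ?thesis using le[of s u] assms by simp
  next
    case 3
    then show ?thesis using convex_onD[OF powr_convex[OF assms(5)], of "1 - s" u v] assms
      by simp
  qed
qed

text \<open>\<open>x + y\<close> is \<open>\<alpha> + \<beta>\<close> times a convex combination of
  \<open>x / \<alpha>\<close> and \<open>y / \<beta>\<close>, and the power is convex. Taking the
  two norms as weights gives Minkowski's inequality with no detour through Hoelder's.\<close>

lemma powr_add_le_weighted:
  fixes x y \<alpha> \<beta> p :: real
  assumes "0 \<le> x" "0 \<le> y" "0 < \<alpha>" "0 < \<beta>" "1 \<le> p"
  shows "(x + y) powr p \<le> (\<alpha> + \<beta>) powr p * (\<alpha> / (\<alpha> + \<beta>) * (x powr p / \<alpha> powr p) + \<beta> / (\<alpha> + \<beta>) * (y powr p / \<beta> powr p))"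
proof -
  let ?s = "\<alpha> / (\<alpha> + \<beta>)"
  have s: "1 - ?s = \<beta> / (\<alpha> + \<beta>)" using assms by (simp add: field_simps)
  have "x + y = (\<alpha> + \<beta>) * (?s * (x / \<alpha>) + (1 - ?s) * (y / \<beta>))"
  proof -
    have "?s * (x / \<alpha>) = x / (\<alpha> + \<beta>)" "\<beta> / (\<alpha> + \<beta>) * (y / \<beta>) = y / (\<alpha> + \<beta>)" using assms by simp_all
    then show ?thesis unfolding s using assms by (simp add: add_divide_distrib[symmetric])
  qed
  then have "(x + y) powr p = (\<alpha> + \<beta>) powr p * (?s * (x / \<alpha>) + (1 - ?s) * (y / \<beta>)) powr p"
    unfolding s using assms by (simp add: powr_mult)
  also have "\<dots> \<le> (\<alpha> + \<beta>) powr p * (?s * (x / \<alpha>) powr p + (1 - ?s) * (y / \<beta>) powr p)"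
    using assms by (intro mult_left_mono powr_convex_combination) auto
  finally show ?thesis unfolding s using assms by (simp add: powr_divide)
qed

lemma Minkowski_integral:
  fixes f g :: "'a \<Rightarrow> 'b::{second_countable_topology, banach}"
  assumes p: "1 \<le> p" and m: "f \<in> borel_measurable M" "g \<in> borel_measurable M"
    and f: "integrable M (\<lambda>t. norm (f t) powr p)" and g: "integrable M (\<lambda>t. norm (g t) powr p)"
  shows "integrable M (\<lambda>t. norm (f t + g t) powr p)"
    "(LINT t|M. norm (f t + g t) powr p) powr (1 / p) \<le>
      (LINT t|M. norm (f t) powr p) powr (1 / p) + (LINT t|M. norm (g t) powr p) powr (1 / p)"
proof -
  let ?w = "\<lambda>\<alpha> \<beta> t. (\<alpha> + \<beta>) powr p * (\<alpha> / (\<alpha> + \<beta>) * (norm (f t) powr p / \<alpha> powr p) +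
      \<beta> / (\<alpha> + \<beta>) * (norm (g t) powr p / \<beta> powr p))"
  have w: "norm (f t + g t) powr p \<le> ?w \<alpha> \<beta> t" if "0 < \<alpha>" "0 < \<beta>" for \<alpha> \<beta> t
  proof -
    have "norm (f t + g t) powr p \<le> (norm (f t) + norm (g t)) powr p"
      using p by (intro powr_mono2 norm_triangle_ineq) auto
    also have "\<dots> \<le> ?w \<alpha> \<beta> t" using that p by (intro powr_add_le_weighted) auto
    finally show ?thesis .
  qed
  have wi: "integrable M (?w \<alpha> \<beta>)" for \<alpha> \<beta>
    using f g by (intro integrable_mult_right Bochner_Integration.integrable_add integrable_divide)
  show int: "integrable M (\<lambda>t. norm (f t + g t) powr p)"
  proof (rule Bochner_Integration.integrable_bound[OF wi[of 1 1]])
    show "(\<lambda>t. norm (f t + g t) powr p) \<in> borel_measurable M" using m by measurable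
    show "AE t in M. norm (norm (f t + g t) powr p) \<le> norm (?w 1 1 t)"
    proof (rule AE_I2)
      fix t
      have "norm (f t + g t) powr p \<le> ?w 1 1 t" by (rule w) auto
      then show "norm (norm (f t + g t) powr p) \<le> norm (?w 1 1 t)"
        unfolding real_norm_def by (intro order_trans[OF _ abs_ge_self]) (simp only: abs_of_nonneg powr_ge_zero)
    qed
  qed
  define A where "A = (LINT t|M. norm (f t) powr p) powr (1 / p)"
  define B where "B = (LINT t|M. norm (g t) powr p) powr (1 / p)"
  have AB: "A powr p = (LINT t|M. norm (f t) powr p)" "B powr p = (LINT t|M. norm (g t) powr p)" "0 \<le> A" "0 \<le> B"
    using p by (auto simp: A_def B_def powr_powr)
  have "(LINT t|M. norm (f t + g t) powr p) powr (1 / p) \<le> A + B + e" if "e > 0" for e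
  proof -
    \<comment> \<open>The extra \<open>e / 2\<close> keeps both weights positive even when a norm
      vanishes; \<open>e\<close> then tends to 0.\<close>
    let ?\<alpha> = "A + e / 2" and ?\<beta> = "B + e / 2"
    have pos: "0 < ?\<alpha>" "0 < ?\<beta>" using AB that by auto
    have "(LINT t|M. norm (f t + g t) powr p) \<le> (LINT t|M. ?w ?\<alpha> ?\<beta> t)"
      by (intro integral_mono int wi w pos)
    also have "\<dots> = (?\<alpha> + ?\<beta>) powr p * (?\<alpha> / (?\<alpha> + ?\<beta>) * (A powr p / ?\<alpha> powr p) + ?\<beta> / (?\<alpha> + ?\<beta>) * (B powr p / ?\<beta> powr p))"
      using f g by (simp add: AB)
    also have "\<dots> \<le> (?\<alpha> + ?\<beta>) powr p * (?\<alpha> / (?\<alpha> + ?\<beta>) * 1 + ?\<beta> / (?\<alpha> + ?\<beta>) * 1)"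
    proof (intro mult_left_mono add_mono)
      show "A powr p / ?\<alpha> powr p \<le> 1" using powr_mono2[of p A ?\<alpha>] pos AB(3) that p by simp
      show "B powr p / ?\<beta> powr p \<le> 1" using powr_mono2[of p B ?\<beta>] pos AB(4) that p by simp
    qed (use pos in auto)
    also have "\<dots> = (?\<alpha> + ?\<beta>) powr p" using pos by (simp add: add_divide_distrib[symmetric])
    finally have "(LINT t|M. norm (f t + g t) powr p) powr (1 / p) \<le> ((?\<alpha> + ?\<beta>) powr p) powr (1 / p)"
      using p by (intro powr_mono2) auto
    also have "\<dots> = A + B + e" using p pos by (simp add: powr_powr)
    finally show ?thesis .
  qed
  then show "(LINT t|M. norm (f t + g t) powr p) powr (1 / p) \<le>
      (LINT t|M. norm (f t) powr p) powr (1 / p) + (LINT t|M. norm (g t) powr p) powr (1 / p)"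
    unfolding A_def[symmetric] B_def[symmetric] by (rule field_le_epsilon)
qed

section \<open>The L^p norm over one period\<close>

lemma Lp_loc_UNIV:
  assumes "1 \<le> p"
  shows "Lp_loc p UNIV g \<longleftrightarrow> g \<in> borel_measurable lborel \<and>
    (\<forall>K. compact K \<longrightarrow> integrable lborel (\<lambda>t. norm (indicat_real K t *\<^sub>R g t) powr p))"
proof -
  have "indicat_real K t *\<^sub>R (cmod (g t) powr p) = norm (indicat_real K t *\<^sub>R g t) powr p" for K t
    using assms by (simp add: indicator_def)
  then show ?thesis by (simp add: Lp_loc_def set_integrable_def set_borel_measurable_def)
qed

definition Lp_norm_01 :: "real \<Rightarrow> (real \<Rightarrow> complex) \<Rightarrow> real"
  where "Lp_norm_01 p g = (LINT t:{0..1}|lborel. cmod (g t) powr p) powr (1 / p)"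

lemma Lp_norm_01_eq:
  assumes "1 \<le> p"
  shows "Lp_norm_01 p g = (LINT t|lborel. norm (indicat_real {0..1} t *\<^sub>R g t) powr p) powr (1 / p)"
proof -
  have "indicat_real {0..1} t *\<^sub>R (cmod (g t) powr p) = norm (indicat_real {0..1} t *\<^sub>R g t) powr p" for t
    using assms by (simp add: indicator_def)
  then show ?thesis by (simp only: Lp_norm_01_def set_lebesgue_integral_def)
qed

lemma Lp_loc_scale:
  assumes p: "1 \<le> p" and f: "Lp_loc p UNIV f"
  shows "Lp_loc p UNIV (\<lambda>t. a * f t)"
proof -
  have "norm (indicat_real K t *\<^sub>R (a * f t)) powr p = cmod a powr p * norm (indicat_real K t *\<^sub>R f t) powr p" for K t
    by (simp add: norm_mult powr_mult[symmetric] mult_ac)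
  then show ?thesis using f unfolding Lp_loc_UNIV[OF p] by (auto intro!: integrable_mult_right)
qed

lemma Lp_loc_add:
  assumes p: "1 \<le> p" and f: "Lp_loc p UNIV f" and g: "Lp_loc p UNIV g"
  shows "Lp_loc p UNIV (\<lambda>t. f t + g t)" "Lp_norm_01 p (\<lambda>t. f t + g t) \<le> Lp_norm_01 p f + Lp_norm_01 p g"
proof -
  have m: "f \<in> borel_measurable lborel" "g \<in> borel_measurable lborel"
    and i: "\<And>K. compact K \<Longrightarrow> integrable lborel (\<lambda>t. norm (indicat_real K t *\<^sub>R f t) powr p)"
      "\<And>K. compact K \<Longrightarrow> integrable lborel (\<lambda>t. norm (indicat_real K t *\<^sub>R g t) powr p)"
    using f g unfolding Lp_loc_UNIV[OF p] by blast+
  have mK: "(\<lambda>t. indicat_real K t *\<^sub>R f t) \<in> borel_measurable lborel"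
    "(\<lambda>t. indicat_real K t *\<^sub>R g t) \<in> borel_measurable lborel" if "compact K" for K
    using m borel_compact[OF that] by simp_all
  have K01: "compact {0..1::real}" by simp
  have M: "integrable lborel (\<lambda>t. norm (indicat_real K t *\<^sub>R (f t + g t)) powr p)"
    "(LINT t|lborel. norm (indicat_real K t *\<^sub>R (f t + g t)) powr p) powr (1 / p) \<le>
      (LINT t|lborel. norm (indicat_real K t *\<^sub>R f t) powr p) powr (1 / p) +
      (LINT t|lborel. norm (indicat_real K t *\<^sub>R g t) powr p) powr (1 / p)" if K: "compact K" for K
    using Minkowski_integral[OF p mK[OF K] i(1)[OF K] i(2)[OF K]] unfolding scaleR_add_right by blast+
  show "Lp_loc p UNIV (\<lambda>t. f t + g t)"
    unfolding Lp_loc_UNIV[OF p]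
  proof (intro conjI allI impI)
    show "(\<lambda>t. f t + g t) \<in> borel_measurable lborel" using m by measurable
    show "integrable lborel (\<lambda>t. norm (indicat_real K t *\<^sub>R (f t + g t)) powr p)" if "compact K" for K
      by (rule M(1)[OF that])
  qed
  show "Lp_norm_01 p (\<lambda>t. f t + g t) \<le> Lp_norm_01 p f + Lp_norm_01 p g"
    unfolding Lp_norm_01_eq[OF p] by (rule M(2)[OF K01])
qed

lemma Lp_norm_01_cong_AE:
  assumes "f \<in> borel_measurable lborel" "g \<in> borel_measurable lborel" "AE t in lborel. f t = g t"
  shows "Lp_norm_01 p f = Lp_norm_01 p g"
proof -
  have "(LINT t:{0..1}|lborel. cmod (f t) powr p) = (LINT t:{0..1}|lborel. cmod (g t) powr p)"
    unfolding set_lebesgue_integral_def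
  proof (rule integral_cong_AE)
    show "(\<lambda>t. indicat_real {0..1} t *\<^sub>R (cmod (f t) powr p)) \<in> borel_measurable lborel"
      "(\<lambda>t. indicat_real {0..1} t *\<^sub>R (cmod (g t) powr p)) \<in> borel_measurable lborel"
      using assms(1,2) by measurable
    show "AE t in lborel. indicat_real {0..1} t *\<^sub>R (cmod (f t) powr p) = indicat_real {0..1} t *\<^sub>R (cmod (g t) powr p)"
      using assms(3) by eventually_elim simp
  qed
  then show ?thesis by (simp only: Lp_norm_01_def)
qed

lemma Lp_norm_01_le:
  assumes p: "1 \<le> p" and c: "continuous_on UNIV f" and K: "\<And>t. cmod (f t) \<le> K"
  shows "Lp_norm_01 p f \<le> K"
proof -
  have K0: "0 \<le> K" using norm_ge_zero K by (rule order_trans)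
  have "(LINT t:{0..1}|lborel. cmod (f t) powr p) \<le> (LINT t:{0..1::real}|lborel. K powr p)"
  proof (rule set_integral_mono)
    have "continuous_on {0..1} (\<lambda>t. cmod (f t) powr p)"
      using p by (intro continuous_on_powr' continuous_intros continuous_on_subset[OF c]) auto
    then show "set_integrable lborel {0..1} (\<lambda>t. cmod (f t) powr p)"
      unfolding set_integrable_def by (intro borel_integrable_compact) auto
    show "set_integrable lborel {0..1::real} (\<lambda>t. K powr p)"
      unfolding set_integrable_def by (intro borel_integrable_compact) auto
    show "cmod (f t) powr p \<le> K powr p" for t using p K by (intro powr_mono2) auto
  qed
  also have "\<dots> = K powr p" by (simp add: set_lebesgue_integral_def)
  finally have "Lp_norm_01 p f \<le> (K powr p) powr (1 / p)"
    unfolding Lp_norm_01_def using p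
    by (intro powr_mono2) (auto simp: set_lebesgue_integral_def intro!: integral_nonneg_AE)
  also have "\<dots> = K" using p K0 by (simp add: powr_powr)
  finally show ?thesis .
qed

lemma Lp_loc_continuous:
  assumes p: "1 \<le> p" and c: "continuous_on UNIV f"
  shows "Lp_loc p UNIV f"
  unfolding Lp_loc_def
proof (intro conjI allI impI)
  show "set_borel_measurable lborel UNIV f"
    using borel_measurable_continuous_onI[OF c] by (simp add: set_borel_measurable_def)
  fix K :: "real set" assume K: "compact K \<and> K \<subseteq> UNIV"
  have "continuous_on K (\<lambda>t. cmod (f t) powr p)"
    using p by (intro continuous_on_powr' continuous_intros continuous_on_subset[OF c]) auto
  then show "set_integrable lborel K (\<lambda>t. cmod (f t) powr p)"
    using K unfolding set_integrable_def by (intro borel_integrable_compact) auto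
qed

lemma smooth_loops_weak_derivative:
  assumes "y \<in> smooth_loops"
  shows "weak_derivative UNIV j y (nth_derivative j y)"
  using weak_derivative_classical[of "\<lambda>j. nth_derivative j y" j, OF smooth_loops_has_derivative[OF assms]]
  by (simp only: nth_derivative_0)

text \<open>The Sobolev seminorm is defined through an arbitrary choice of weak derivatives.
  Uniqueness almost everywhere allows it to be computed from any known one; this is the purpose of
  the test functions.\<close>

lemma weak_derivative_some:
  assumes g: "weak_derivative UNIV j y g"
  shows "AE t in lborel. (SOME g. weak_derivative UNIV j y g) t = g t"
    "Lp_norm_01 p (SOME g. weak_derivative UNIV j y g) = Lp_norm_01 p g"
proof -
  have s: "weak_derivative UNIV j y (SOME g. weak_derivative UNIV j y g)" by (rule someI[of "\<lambda>g. weak_derivative UNIV j y g", OF g])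
  show ae: "AE t in lborel. (SOME g. weak_derivative UNIV j y g) t = g t"
    by (rule weak_derivative_unique[OF s g])
  show "Lp_norm_01 p (SOME g. weak_derivative UNIV j y g) = Lp_norm_01 p g"
    using weak_derivative_Lp_loc[OF s] weak_derivative_Lp_loc[OF g] ae
    by (intro Lp_norm_01_cong_AE) (auto simp: Lp_loc_1_iff)
qed

lemma class_seminorms_Wkp:
  "class_seminorms (Wkp k p) = {\<lambda>y. \<Sum>j\<le>k. Lp_norm_01 p (SOME g. weak_derivative UNIV j y g)}"
  by (simp add: Lp_norm_01_def)

section \<open>Loops of class C^k and W^{k,p} and their seminorms\<close>

lemma LC_periodic: "x \<in> LC r \<Longrightarrow> periodic x"
  by (simp only: LC_def mem_Collect_eq)

lemma LC_Wkp_continuous: "x \<in> LC (Wkp k p) \<Longrightarrow> continuous_on UNIV x"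
  by (simp only: LC_def mem_Collect_eq of_class.simps)

lemma LC_Wkp_derivative:
  assumes "x \<in> LC (Wkp k p)" "j \<le> k"
  obtains g where "Lp_loc p UNIV g" "weak_derivative UNIV j x g"
proof -
  have "\<exists>g. Lp_loc p UNIV g \<and> weak_derivative UNIV j x g"
    using assms by (simp only: LC_def mem_Collect_eq of_class.simps)
  then show ?thesis using that by (elim exE conjE)
qed

lemma LC_WkpI:
  assumes "periodic x" "continuous_on UNIV x"
    "\<And>j. j \<le> k \<Longrightarrow> \<exists>g. Lp_loc p UNIV g \<and> weak_derivative UNIV j x g"
  shows "x \<in> LC (Wkp k p)"
  unfolding LC_def mem_Collect_eq of_class.simps using assms by (intro conjI allI impI)

lemma LC_Wkp_lincomb:
  assumes p: "1 \<le> p" and x: "x \<in> LC (Wkp k p)" and y: "y \<in> LC (Wkp k p)"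
  shows "(\<lambda>t. a * x t + b * y t) \<in> LC (Wkp k p)"
proof -
  note c = LC_Wkp_continuous[OF x] LC_Wkp_continuous[OF y]
  note per = LC_periodic[OF x] LC_periodic[OF y]
  show ?thesis
  proof (rule LC_WkpI)
    show "periodic (\<lambda>t. a * x t + b * y t)" using per by (simp add: periodic_def)
    show "continuous_on UNIV (\<lambda>t. a * x t + b * y t)" using c by (intro continuous_intros)
    fix j assume j: "j \<le> k"
    obtain g where g: "Lp_loc p UNIV g" "weak_derivative UNIV j x g" by (rule LC_Wkp_derivative[OF x j])
    obtain h where h: "Lp_loc p UNIV h" "weak_derivative UNIV j y h" by (rule LC_Wkp_derivative[OF y j])
    show "\<exists>g. Lp_loc p UNIV g \<and> weak_derivative UNIV j (\<lambda>t. a * x t + b * y t) g"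
      by (rule exI, rule conjI[OF Lp_loc_add(1)[OF p Lp_loc_scale[OF p g(1)] Lp_loc_scale[OF p h(1)]]
            weak_derivative_lincomb[OF g(2) h(2) c]])
  qed
qed

lemma Ck_on_nth_derivative:
  assumes "Ck_on k UNIV x" "enat (Suc j) \<le> k"
  shows "(nth_derivative j x has_vector_derivative nth_derivative (Suc j) x t) (at t)"
proof -
  have "nth_derivative j x differentiable (at t)"
    using assms by (auto simp: Ck_on_def Suc_ile_eq)
  then show ?thesis unfolding nth_derivative_Suc by (simp add: vector_derivative_works)
qed

lemma Ck_on_nth_derivative_lincomb:
  fixes x y :: "real \<Rightarrow> complex"
  assumes x: "Ck_on k UNIV x" and y: "Ck_on k UNIV y"
  shows "enat j \<le> k \<Longrightarrow>
    nth_derivative j (\<lambda>t. a * x t + b * y t) = (\<lambda>t. a * nth_derivative j x t + b * nth_derivative j y t)"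
proof (induction j)
  case (Suc j)
  have j: "enat j \<le> k" using Suc.prems by (meson Suc_ile_eq order_less_imp_le)
  have "((\<lambda>t. a * nth_derivative j x t + b * nth_derivative j y t) has_vector_derivative
      a * nth_derivative (Suc j) x t + b * nth_derivative (Suc j) y t) (at t)" for t
    by (intro has_vector_derivative_add has_vector_derivative_mult_right
        Ck_on_nth_derivative[OF x] Ck_on_nth_derivative[OF y] Suc.prems)
  then show ?case
    unfolding nth_derivative_Suc[of j "\<lambda>t. a * x t + b * y t"] Suc.IH[OF j]
    by (intro ext vector_derivative_at)
qed simp

lemma Ck_on_lincomb:
  fixes x y :: "real \<Rightarrow> complex"
  assumes x: "Ck_on k UNIV x" and y: "Ck_on k UNIV y"
  shows "Ck_on k UNIV (\<lambda>t. a * x t + b * y t)"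
  unfolding Ck_on_def
proof (intro conjI allI impI ballI)
  fix j :: nat and t :: real assume j: "enat j < k"
  then have "nth_derivative j x differentiable (at t)" "nth_derivative j y differentiable (at t)"
    using x y by (auto simp: Ck_on_def)
  then show "nth_derivative j (\<lambda>t. a * x t + b * y t) differentiable (at t)"
    unfolding Ck_on_nth_derivative_lincomb[OF x y order_less_imp_le[OF j]]
    by (intro differentiable_add differentiable_mult differentiable_const)
next
  fix j assume j: "enat j \<le> k"
  then have "continuous_on UNIV (nth_derivative j x)" "continuous_on UNIV (nth_derivative j y)"
    using x y by (auto simp: Ck_on_def)
  then show "continuous_on UNIV (nth_derivative j (\<lambda>t. a * x t + b * y t))"
    unfolding Ck_on_nth_derivative_lincomb[OF x y j] by (intro continuous_intros)
qed

lemma periodic_nth_derivative: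
  fixes x :: "real \<Rightarrow> complex"
  assumes x: "Ck_on k UNIV x" and per: "periodic x"
  shows "enat j \<le> k \<Longrightarrow> periodic (nth_derivative j x)"
proof (induction j)
  case (Suc j)
  have j: "enat j \<le> k" using Suc.prems by (meson Suc_ile_eq order_less_imp_le)
  have "nth_derivative (Suc j) x (t + 1) = nth_derivative (Suc j) x t" for t
  proof -
    have "((\<lambda>t. t + 1) has_vector_derivative 1) (at t)"
      by (auto intro!: derivative_eq_intros)
    from vector_diff_chain_at[OF this Ck_on_nth_derivative[OF x Suc.prems]]
    have "((\<lambda>t. nth_derivative j x (t + 1)) has_vector_derivative nth_derivative (Suc j) x (t + 1)) (at t)"
      by (simp add: o_def)
    then have "(nth_derivative j x has_vector_derivative nth_derivative (Suc j) x (t + 1)) (at t)"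
      using Suc.IH[OF j] by (simp add: periodic_def)
    then show ?thesis using Ck_on_nth_derivative[OF x Suc.prems, of t] vector_derivative_unique_at by blast
  qed
  then show ?case by (simp add: periodic_def)
qed (use per in simp)

lemma smooth_loops_in_LC:
  assumes r: "admissible r" and y: "y \<in> smooth_loops"
  shows "y \<in> LC r"
proof (cases r)
  case (Ck k)
  then show ?thesis using smooth_loops_Ck[OF y] smooth_loops_periodic[OF y] by (simp add: LC_def)
next
  case (Wkp k p)
  have L: "Lp_loc p UNIV (nth_derivative j y)" for j
    using r Wkp smooth_loops_continuous[OF smooth_loops_nth_derivative[OF y]] by (intro Lp_loc_continuous) auto
  show ?thesis
    unfolding Wkp
    by (rule LC_WkpI[OF smooth_loops_periodic[OF y] smooth_loops_continuous[OF y]])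
       (rule exI, rule conjI[OF L smooth_loops_weak_derivative[OF y]])
qed

lemma LC_lincomb:
  assumes "admissible r" "x \<in> LC r" "y \<in> LC r"
  shows "(\<lambda>t. a * x t + b * y t) \<in> LC r"
proof (cases r)
  case (Ck k)
  have "periodic (\<lambda>t. a * x t + b * y t)" using assms by (simp add: LC_def periodic_def)
  then show ?thesis using Ck assms Ck_on_lincomb[of k x y] by (simp add: LC_def)
next
  case (Wkp k p)
  then show ?thesis using LC_Wkp_lincomb[where p = p and k = k and x = x and y = y] assms by simp
qed

text \<open>Needed on all of \<open>LC r\<close> and not just on smooth loops, because the basic
  open sets of the seminorm topology are centred at arbitrary loops.\<close>

lemma class_seminorms_triangle:
  assumes r: "admissible r" and q: "q \<in> class_seminorms r" and x: "x \<in> LC r" and y: "y \<in> LC r"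
  shows "q (\<lambda>t. x t + y t) \<le> q x + q y"
proof (cases r)
  case (Ck k)
  obtain j where j: "enat j \<le> k" "q = (\<lambda>y. SUP t. cmod (nth_derivative j y t))"
    using q Ck by auto
  have C: "Ck_on k UNIV x" "Ck_on k UNIV y" "periodic x" "periodic y" using x y Ck by (auto simp: LC_def)
  \<comment> \<open>The supremum is meaningful only for a bounded set; continuity and periodicity
    provide the bound.\<close>
  have bdd: "bdd_above (range (\<lambda>t. cmod (nth_derivative j z t)))" if z: "Ck_on k UNIV z" "periodic z" for z
  proof -
    have "continuous_on UNIV (nth_derivative j z)" using z j by (auto simp: Ck_on_def)
    then obtain K where "\<And>t. cmod (nth_derivative j z t) \<le> K"
      using periodic_bounded[OF periodic_nth_derivative[OF z j(1)]] by blast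
    then show ?thesis by (intro bdd_aboveI2)
  qed
  show ?thesis
    unfolding j(2)
  proof (rule cSUP_least)
    fix t
    have "cmod (nth_derivative j (\<lambda>t. x t + y t) t) = cmod (nth_derivative j x t + nth_derivative j y t)"
      using Ck_on_nth_derivative_lincomb[OF C(1,2) j(1), of 1 1] by simp
    also have "\<dots> \<le> cmod (nth_derivative j x t) + cmod (nth_derivative j y t)" by (rule norm_triangle_ineq)
    also have "\<dots> \<le> (SUP t. cmod (nth_derivative j x t)) + (SUP t. cmod (nth_derivative j y t))"
      by (intro add_mono cSUP_upper bdd C) auto
    finally show "cmod (nth_derivative j (\<lambda>t. x t + y t) t) \<le> \<dots>" .
  qed simp
next
  case (Wkp k p)
  have p: "1 \<le> p" using r Wkp by simp
  have qd: "q = (\<lambda>y. \<Sum>j\<le>k. Lp_norm_01 p (SOME g. weak_derivative UNIV j y g))"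
    using q unfolding Wkp class_seminorms_Wkp by simp
  note xy = x[unfolded Wkp] y[unfolded Wkp]
  note c = LC_Wkp_continuous[OF xy(1)] LC_Wkp_continuous[OF xy(2)]
  show ?thesis
    unfolding qd sum.distrib[symmetric]
  proof (rule sum_mono)
    fix j assume "j \<in> {..k}"
    then have j: "j \<le> k" by simp
    obtain g where g: "Lp_loc p UNIV g" "weak_derivative UNIV j x g" by (rule LC_Wkp_derivative[OF xy(1) j])
    obtain h where h: "Lp_loc p UNIV h" "weak_derivative UNIV j y h" by (rule LC_Wkp_derivative[OF xy(2) j])
    note gh = g h
    have "weak_derivative UNIV j (\<lambda>t. x t + y t) (\<lambda>t. g t + h t)"
      using weak_derivative_lincomb[OF gh(2,4) c, of 1 1] unfolding mult_1_left .
    from weak_derivative_some(2)[OF this] weak_derivative_some(2)[OF gh(2)] weak_derivative_some(2)[OF gh(4)]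
    show "Lp_norm_01 p (SOME g. weak_derivative UNIV j (\<lambda>t. x t + y t) g) \<le>
      Lp_norm_01 p (SOME g. weak_derivative UNIV j x g) + Lp_norm_01 p (SOME g. weak_derivative UNIV j y g)"
      using Lp_loc_add(2)[OF p gh(1,3)] by (simp only:)
  qed
qed

lemma class_seminorms_bound:
  assumes r: "admissible r" and q: "q \<in> class_seminorms r" and y: "y \<in> smooth_loops" and z: "z \<in> smooth_loops"
  shows "\<exists>K\<ge>0. \<forall>a b. q (\<lambda>t. a * y t + b * z t) \<le> K * (cmod a + cmod b)"
proof -
  have "\<exists>K\<ge>0. \<forall>a b t. cmod (nth_derivative j (\<lambda>t. a * y t + b * z t) t) \<le> K * (cmod a + cmod b)" for j
  proof -
    obtain K where K: "K \<ge> 0" "\<And>t. cmod (nth_derivative j y t) \<le> K"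
      using smooth_loops_bounded[OF smooth_loops_nth_derivative[OF y, of j]] by blast
    obtain L where L: "L \<ge> 0" "\<And>t. cmod (nth_derivative j z t) \<le> L"
      using smooth_loops_bounded[OF smooth_loops_nth_derivative[OF z, of j]] by blast
    have "cmod (nth_derivative j (\<lambda>t. a * y t + b * z t) t) \<le> (K + L) * (cmod a + cmod b)" for a b t
    proof -
      have "cmod (nth_derivative j (\<lambda>t. a * y t + b * z t) t) \<le>
          cmod a * cmod (nth_derivative j y t) + cmod b * cmod (nth_derivative j z t)"
        unfolding nth_derivative_lincomb[OF y z] by (metis norm_mult norm_triangle_ineq)
      also have "\<dots> \<le> cmod a * (K + L) + cmod b * (K + L)"
        using K(1) L(1) K(2)[of t] L(2)[of t] by (intro add_mono mult_left_mono) auto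
      finally show ?thesis by (simp add: algebra_simps)
    qed
    then show ?thesis using K(1) L(1) by (intro exI[of _ "K + L"]) auto
  qed
  then obtain K where K: "\<And>j. K j \<ge> 0"
    "\<And>j a b t. cmod (nth_derivative j (\<lambda>t. a * y t + b * z t) t) \<le> K j * (cmod a + cmod b)" by metis
  show ?thesis
  proof (cases r)
    case (Ck k)
    obtain j where j: "q = (\<lambda>y. SUP t. cmod (nth_derivative j y t))" using q Ck by auto
    show ?thesis
    proof (intro exI[of _ "K j"] conjI allI K(1))
      show "q (\<lambda>t. a * y t + b * z t) \<le> K j * (cmod a + cmod b)" for a b
        unfolding j using K(2) by (intro cSUP_least) auto
    qed
  next
    case (Wkp k p)
    have p: "1 \<le> p" using r Wkp by simp
    have qd: "q = (\<lambda>y. \<Sum>j\<le>k. Lp_norm_01 p (SOME g. weak_derivative UNIV j y g))"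
      using q unfolding Wkp class_seminorms_Wkp by simp
    show ?thesis
    proof (intro exI[of _ "\<Sum>j\<le>k. K j"] conjI allI)
      show "0 \<le> (\<Sum>j\<le>k. K j)" using K(1) by (simp add: sum_nonneg)
      show "q (\<lambda>t. a * y t + b * z t) \<le> (\<Sum>j\<le>k. K j) * (cmod a + cmod b)" for a b
        unfolding qd sum_distrib_right
      proof (rule sum_mono)
        fix j
        have s: "(\<lambda>t. a * y t + b * z t) \<in> smooth_loops" by (rule smooth_loops_lincomb[OF y z])
        show "Lp_norm_01 p (SOME g. weak_derivative UNIV j (\<lambda>t. a * y t + b * z t) g) \<le> K j * (cmod a + cmod b)"
          unfolding weak_derivative_some(2)[OF smooth_loops_weak_derivative[OF s]]
          by (rule Lp_norm_01_le[OF p smooth_loops_continuous[OF smooth_loops_nth_derivative[OF s]] K(2)])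
      qed
    qed
  qed
qed

text \<open>The underlying set of a generated topology is the union of its generators, so every loop
  has to lie in some ball around itself, that is, a seminorm of the zero loop has to be small. For
  the Sobolev seminorm, which involves a choice, this is read off the estimate with vanishing
  coefficients.\<close>

lemma topspace_LC_topology:
  assumes r: "admissible r" shows "topspace (LC_topology r) = LC r"
proof
  show "topspace (LC_topology r) \<subseteq> LC r"
    by (auto simp: LC_topology_def seminorm_topology_def topology_generated_by_topspace)
  show "LC r \<subseteq> topspace (LC_topology r)"
  proof
    fix x assume x: "x \<in> LC r"
    obtain q where q: "q \<in> class_seminorms r"
    proof (cases r)
      case (Ck k)
      have "(\<lambda>y. SUP t. cmod (nth_derivative 0 y t)) \<in> class_seminorms r"
        unfolding Ck class_seminorms.simps by (auto simp: enat_0 intro!: exI[of _ 0])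
      then show ?thesis by (rule that)
    next
      case (Wkp k p)
      show ?thesis by (rule that[unfolded Wkp class_seminorms.simps, OF singletonI])
    qed
    have s: "(\<lambda>t. 0) \<in> smooth_loops" using smooth_loops_affine[of 0 0] by simp
    obtain K where K: "\<forall>a b. q (\<lambda>t. a * 0 + b * 0) \<le> K * (cmod a + cmod b)"
      using class_seminorms_bound[OF r q s s] by (elim exE conjE)
    from K[rule_format, of 0 0] have "q (x - x) < 1" by (simp add: zero_fun_def)
    then have "x \<in> {y \<in> LC r. q (y - x) < 1}" using x by simp
    moreover have "{y \<in> LC r. q (y - x) < 1} \<in>
        {{y \<in> LC r. q (y - x) < e} |q x e. q \<in> class_seminorms r \<and> x \<in> LC r \<and> 0 < e}"
      by (rule CollectI, rule exI[of _ q], rule exI[of _ x], rule exI[of _ 1]) (simp add: q x)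
    ultimately show "x \<in> topspace (LC_topology r)"
      unfolding LC_topology_def seminorm_topology_def topology_generated_by_topspace by (rule UnionI[rotated])
  qed
qed

text \<open>Openness and continuity on the loop space are pulled back along this map to planes of
  smooth loops, where the complex analysis takes place.\<close>

lemma continuous_LC_plane:
  assumes r: "admissible r" and y: "y \<in> smooth_loops" and z: "z \<in> smooth_loops"
  shows "continuous_map euclidean (LC_topology r) (\<lambda>(a, b). (\<lambda>t. a * y t + b * z t))"
  unfolding LC_topology_def seminorm_topology_def
proof (rule continuous_on_generated_topo)
  let ?f = "\<lambda>(a, b). (\<lambda>t. a * y t + b * z t)"
  have fLC: "?f c \<in> LC r" for c
    using smooth_loops_in_LC[OF r smooth_loops_lincomb[OF y z]] by (cases c) simp
  show "?f ` topspace euclidean \<subseteq> \<Union> {{y \<in> LC r. q (y - x) < e} |q x e. q \<in> class_seminorms r \<and> x \<in> LC r \<and> 0 < e}"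
  proof (rule image_subsetI)
    fix c
    have "?f c \<in> topspace (LC_topology r)" unfolding topspace_LC_topology[OF r] by (rule fLC)
    then show "?f c \<in> \<Union> {{y \<in> LC r. q (y - x) < e} |q x e. q \<in> class_seminorms r \<and> x \<in> LC r \<and> 0 < e}"
      unfolding LC_topology_def seminorm_topology_def topology_generated_by_topspace .
  qed
  fix U assume "U \<in> {{y \<in> LC r. q (y - x) < e} |q x e. q \<in> class_seminorms r \<and> x \<in> LC r \<and> 0 < e}"
  then obtain q x e where U: "U = {y \<in> LC r. q (y - x) < e}" "q \<in> class_seminorms r" "x \<in> LC r" "0 < e"
    by (elim CollectE exE conjE)
  have "open {c. q (?f c - x) < e}"
    unfolding open_contains_ball
  proof
    fix c0 assume c0: "c0 \<in> {c. q (?f c - x) < e}"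
    obtain K where K: "K \<ge> 0" "\<forall>a b. q (\<lambda>t. a * y t + b * z t) \<le> K * (cmod a + cmod b)"
      using class_seminorms_bound[OF r U(2) y z] by (elim exE conjE)
    \<comment> \<open>The slack at \<open>c0\<close> divided by \<open>2 * K + 1\<close>: each of
      the two coefficients moves by less than \<open>d\<close>, which costs at most
      \<open>2 * K * d\<close>, and the 1 keeps the denominator positive.\<close>
    define d where "d = (e - q (?f c0 - x)) / (2 * K + 1)"
    have d: "d > 0" using c0 K by (simp add: d_def)
    have "q (?f c - x) < e" if c: "dist c0 c < d" for c
    proof -
      have l: "(\<lambda>t. 1 * ?f c0 t + (-1) * x t) \<in> LC r" by (rule LC_lincomb[OF r fLC U(3)])
      have n: "cmod (fst c - fst c0) \<le> dist c0 c" "cmod (snd c - snd c0) \<le> dist c0 c"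
        using dist_fst_le[of c c0] dist_snd_le[of c c0] by (simp_all add: dist_norm dist_commute norm_minus_commute)
      have eq: "?f c - x = (\<lambda>t. ((fst c - fst c0) * y t + (snd c - snd c0) * z t) + (1 * ?f c0 t + (-1) * x t))"
        by (auto simp: fun_eq_iff case_prod_unfold algebra_simps)
      have eq0: "?f c0 - x = (\<lambda>t. 1 * ?f c0 t + (-1) * x t)" by (auto simp: fun_eq_iff)
      have "q (?f c - x) \<le> q (\<lambda>t. (fst c - fst c0) * y t + (snd c - snd c0) * z t) + q (?f c0 - x)"
        unfolding eq eq0
        by (rule class_seminorms_triangle[OF r U(2) smooth_loops_in_LC[OF r smooth_loops_lincomb[OF y z]] l])
      also have "\<dots> \<le> K * (dist c0 c + dist c0 c) + q (?f c0 - x)"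
        using n K(1) by (intro add_right_mono order_trans[OF K(2)[rule_format]] mult_left_mono add_mono)
      also have "\<dots> \<le> (2 * K) * d + q (?f c0 - x)" using c K(1) by (simp add: mult_left_mono)
      also have "\<dots> < (2 * K + 1) * d + q (?f c0 - x)" using d by (simp add: algebra_simps)
      also have "\<dots> = e" using K(1) by (simp add: d_def)
      finally show ?thesis .
    qed
    then show "\<exists>d>0. ball c0 d \<subseteq> {c. q (?f c - x) < e}" using d by (intro exI[of _ d]) auto
  qed
  moreover have "?f -` U \<inter> topspace euclidean = {c. q (?f c - x) < e}"
    unfolding U(1) topspace_euclidean Int_UNIV_right vimage_def mem_Collect_eq
    by (simp only: fLC simp_thms)
  ultimately show "openin euclidean (?f -` U \<inter> topspace euclidean)"
    by (simp only: open_openin)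
qed

section \<open>Holomorphic functions of two complex variables\<close>

text \<open>Continuity together with holomorphy on every complex line. On open sets this is ordinary
  holomorphy in two variables, but in this form all arguments reduce to functions of one
  variable.\<close>

definition hol2 :: "(complex \<times> complex) set \<Rightarrow> (complex \<times> complex \<Rightarrow> complex) \<Rightarrow> bool"
  where "hol2 \<Omega> g \<longleftrightarrow> continuous_on \<Omega> g \<and>
    (\<forall>a b a' b'. (\<lambda>z. g (a + z * a', b + z * b')) holomorphic_on {z. (a + z * a', b + z * b') \<in> \<Omega>})"

lemma hol2_continuous: "hol2 \<Omega> g \<Longrightarrow> continuous_on \<Omega> g"
  by (simp add: hol2_def)

lemma hol2_line: "hol2 \<Omega> g \<Longrightarrow>
    (\<lambda>z. g (a + z * a', b + z * b')) holomorphic_on {z. (a + z * a', b + z * b') \<in> \<Omega>}"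
  by (simp add: hol2_def)

lemma hol2_subset:
  assumes "hol2 \<Omega> g" "\<Omega>' \<subseteq> \<Omega>" shows "hol2 \<Omega>' g"
  unfolding hol2_def
proof (intro conjI allI)
  show "continuous_on \<Omega>' g" by (rule continuous_on_subset[OF hol2_continuous[OF assms(1)] assms(2)])
  show "(\<lambda>z. g (a + z * a', b + z * b')) holomorphic_on {z. (a + z * a', b + z * b') \<in> \<Omega>'}" for a b a' b'
    by (rule holomorphic_on_subset[OF hol2_line[OF assms(1)]], rule subsetI, drule CollectD, rule CollectI, rule subsetD[OF assms(2)])
qed

lemma hol2_const: "hol2 \<Omega> (\<lambda>c. w)"
  by (simp add: hol2_def)

lemma hol2I:
  assumes "continuous_on \<Omega> g"
    "\<And>a b a' b'. (\<lambda>z. g (a + z * a', b + z * b')) holomorphic_on {z. (a + z * a', b + z * b') \<in> \<Omega>}"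
  shows "hol2 \<Omega> g"
  unfolding hol2_def using assms by (intro conjI allI)

lemma hol2_mult:
  assumes "hol2 \<Omega> f" "hol2 \<Omega> g" shows "hol2 \<Omega> (\<lambda>c. f c * g c)"
  by (rule hol2I[OF continuous_on_mult[OF assms[THEN hol2_continuous]]
        holomorphic_on_mult[OF hol2_line[OF assms(1)] hol2_line[OF assms(2)]]])

lemma hol2_divide:
  assumes "hol2 \<Omega> f" "hol2 \<Omega> g" "\<And>c. c \<in> \<Omega> \<Longrightarrow> g c \<noteq> 0"
  shows "hol2 \<Omega> (\<lambda>c. f c / g c)"
proof (rule hol2I)
  show "continuous_on \<Omega> (\<lambda>c. f c / g c)"
    using assms by (intro continuous_on_divide hol2_continuous) auto
  show "(\<lambda>z. f (a + z * a', b + z * b') / g (a + z * a', b + z * b')) holomorphic_on {z. (a + z * a', b + z * b') \<in> \<Omega>}"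
    for a b a' b'
    by (rule holomorphic_on_divide[OF hol2_line[OF assms(1)] hol2_line[OF assms(2)]]) (simp add: assms(3))
qed

lemma hol2_cong: "hol2 \<Omega> f \<Longrightarrow> (\<And>c. c \<in> \<Omega> \<Longrightarrow> f c = g c) \<Longrightarrow> hol2 \<Omega> g"
proof -
  assume f: "hol2 \<Omega> f" and eq: "\<And>c. c \<in> \<Omega> \<Longrightarrow> f c = g c"
  have "continuous_on \<Omega> g" by (rule continuous_on_eq[OF hol2_continuous[OF f] eq])
  moreover have "(\<lambda>z. g (a + z * a', b + z * b')) holomorphic_on {z. (a + z * a', b + z * b') \<in> \<Omega>}" for a b a' b'
    by (rule holomorphic_transform[OF hol2_line[OF f]]) (simp add: eq)
  ultimately show "hol2 \<Omega> g" by (simp add: hol2_def)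
qed

lemma hol2_scale:
  assumes "hol2 \<Omega> g"
  shows "hol2 {c. (r * fst c, r * snd c) \<in> \<Omega>} (\<lambda>c. g (r * fst c, r * snd c))"
  unfolding hol2_def
proof (intro conjI allI)
  have "continuous_on {c. (r * fst c, r * snd c) \<in> \<Omega>} (\<lambda>c. (r * fst c, r * snd c))"
    by (intro continuous_intros)
  then show "continuous_on {c. (r * fst c, r * snd c) \<in> \<Omega>} (\<lambda>c. g (r * fst c, r * snd c))"
    by (rule continuous_on_compose2[OF hol2_continuous[OF assms]]) auto
  fix a b a' b'
  have "(r * fst (a + z * a', b + z * b'), r * snd (a + z * a', b + z * b')) = (r * a + z * (r * a'), r * b + z * (r * b'))" for z
    by (simp add: algebra_simps)
  then show "(\<lambda>z. g (r * fst (a + z * a', b + z * b'), r * snd (a + z * a', b + z * b'))) holomorphic_on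
      {z. (a + z * a', b + z * b') \<in> {c. (r * fst c, r * snd c) \<in> \<Omega>}}"
    using hol2_line[OF assms, of "r * a" "r * a'" "r * b" "r * b'"] by (simp only: mem_Collect_eq)
qed

lemma hol2_prod: "(\<And>n. n \<in> S \<Longrightarrow> hol2 \<Omega> (f n)) \<Longrightarrow> hol2 \<Omega> (\<lambda>c. \<Prod>n\<in>S. f n c)"
  by (induction S rule: infinite_finite_induct) (auto intro: hol2_const hol2_mult)

lemma hol2_uniform_limit:
  assumes \<Omega>: "open \<Omega>" and g: "\<And>n. hol2 \<Omega> (g n)" and u: "uniform_limit \<Omega> g p sequentially"
  shows "hol2 \<Omega> p"
  unfolding hol2_def
proof (intro conjI allI)
  show "continuous_on \<Omega> p"
    by (rule uniform_limit_theorem[OF _ u]) (simp_all add: hol2_continuous[OF g])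
  fix a b a' b'
  let ?S = "{z. (a + z * a', b + z * b') \<in> \<Omega>}"
  have "continuous_on UNIV (\<lambda>z. (a + z * a', b + z * b'))" by (intro continuous_intros)
  from open_vimage[OF \<Omega> this] have S: "open ?S" by (simp only: vimage_def)
  show "(\<lambda>z. p (a + z * a', b + z * b')) holomorphic_on ?S"
  proof (rule holomorphic_uniform_sequence[OF S hol2_line[OF g]])
    fix x assume "x \<in> ?S"
    then obtain d where d: "d > 0" "cball x d \<subseteq> ?S" using S open_contains_cball by blast
    have "uniform_limit (cball x d) (\<lambda>n z. g n (a + z * a', b + z * b')) (\<lambda>z. p (a + z * a', b + z * b')) sequentially"
      by (rule uniform_limit_compose'[OF u]) (use d in auto)
    then show "\<exists>d>0. cball x d \<subseteq> ?S \<and>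
        uniform_limit (cball x d) (\<lambda>n z. g n (a + z * a', b + z * b')) (\<lambda>z. p (a + z * a', b + z * b')) sequentially"
      using d by blast
  qed
qed

lemma norm_pair_scale: "norm (z * a, z * b) = cmod z * norm (a, b :: complex)" for a :: complex
proof -
  have "(cmod (z * a))\<^sup>2 + (cmod (z * b))\<^sup>2 = (cmod z)\<^sup>2 * ((cmod a)\<^sup>2 + (cmod b)\<^sup>2)"
    by (simp add: norm_mult power_mult_distrib distrib_left)
  then show ?thesis by (simp only: norm_Pair real_sqrt_mult real_sqrt_abs abs_norm_cancel)
qed

text \<open>As \<open>k\<close> equals 1 at the origin, the Schwarz lemma along the ray through
  \<open>c\<close> bounds the n-th factor minus 1 by a constant times \<open>(1/2) ^ n\<close>,
  uniformly in \<open>c\<close>; the product then converges uniformly.\<close>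

lemma hol2_infinite_product:
  assumes k: "hol2 \<Omega> k" and \<delta>: "\<delta> > 0" and sub: "cball 0 (2 * \<delta>) \<subseteq> \<Omega>" and k0: "k (0, 0) = 1"
  shows "hol2 (ball 0 \<delta>) (\<lambda>c. \<Prod>n. k ((1/2) ^ n * fst c, (1/2) ^ n * snd c))"
    "c \<in> cball 0 \<delta> \<Longrightarrow> convergent_prod (\<lambda>n. k ((1/2) ^ n * fst c, (1/2) ^ n * snd c))"
proof -
  let ?k = "\<lambda>n c. k ((1/2) ^ n * fst c, (1/2) ^ n * snd c)"
  have sc: "(z * fst c, z * snd c) \<in> cball 0 (2 * \<delta>)" if "cmod z \<le> 2" "c \<in> cball 0 \<delta>" for z c
  proof -
    have "norm (z * fst c, z * snd c) = cmod z * norm c" using norm_pair_scale[of z "fst c" "snd c"] by simp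
    also have "\<dots> \<le> 2 * \<delta>" using that \<delta> by (intro mult_mono) auto
    finally show ?thesis by simp
  qed
  have h1: "cmod ((1/2) ^ n) \<le> 1" for n by (simp add: norm_power power_le_one)
  have "compact (k ` cball 0 (2 * \<delta>))"
    by (rule compact_continuous_image[OF continuous_on_subset[OF hol2_continuous[OF k] sub] compact_cball])
  then obtain M0 where M0: "\<forall>x\<in>k ` cball 0 (2 * \<delta>). cmod x \<le> M0"
    using compact_imp_bounded bounded_iff by blast
  \<comment> \<open>Large enough for a strict bound on \<open>k c - 1\<close>, as the Schwarz lemma
    asks for values in the open disc.\<close>
  define M where "M = \<bar>M0\<bar> + 2"
  have M: "M > 0" "\<And>c. c \<in> cball 0 (2 * \<delta>) \<Longrightarrow> cmod (k c - 1) < M"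
  proof -
    show "M > 0" by (simp add: M_def)
    fix c :: "complex \<times> complex" assume "c \<in> cball 0 (2 * \<delta>)"
    then have "cmod (k c) \<le> M0" using M0 by blast
    then show "cmod (k c - 1) < M" using norm_triangle_ineq4[of "k c" 1] by (simp add: M_def)
  qed
  have bound: "cmod (?k n c - 1) \<le> M * (1/2) ^ n" if c: "c \<in> cball 0 \<delta>" for n c
  proof -
    \<comment> \<open>The ray runs through \<open>2 c\<close>, so that all points
      \<open>(1/2) ^ n * c\<close>, including the one with \<open>n = 0\<close>, correspond to
      parameters \<open>(1/2) ^ Suc n\<close> inside the open disc. This is why \<open>k\<close> has
      to be defined on the ball of radius \<open>2 * \<delta>\<close>.\<close>
    define g where "g z = (k (0 + z * (2 * fst c), 0 + z * (2 * snd c)) - 1) / M" for z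
    have m: "(0 + z * (2 * fst c), 0 + z * (2 * snd c)) \<in> cball 0 (2 * \<delta>)" if "cmod z < 1" for z
      using sc[of "z * 2" c] that c by (simp add: norm_mult mult.assoc)
    have "(\<lambda>z. k (0 + z * (2 * fst c), 0 + z * (2 * snd c))) holomorphic_on ball 0 1"
      by (rule holomorphic_on_subset[OF hol2_line[OF k]], rule subsetI, rule CollectI, rule subsetD[OF sub], rule m) simp
    then have "g holomorphic_on ball 0 1"
      unfolding g_def using M(1) by (intro holomorphic_on_divide holomorphic_on_diff holomorphic_on_const) auto
    moreover have "cmod (g z) < 1" if "cmod z < 1" for z
      using M(2)[OF m[OF that]] M(1) by (simp add: g_def norm_divide)
    moreover have "g 0 = 0" by (simp add: g_def k0)
    moreover have "cmod ((1/2) ^ Suc n) < 1" using h1[of n] by (simp add: norm_mult norm_power)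
    ultimately have "cmod (g ((1/2) ^ Suc n)) \<le> cmod ((1/2) ^ Suc n)"
      by (intro Schwarz_Lemma(1)) auto
    moreover have "cmod ((1/2) ^ Suc n) \<le> (1/2) ^ n" by (simp add: norm_mult norm_power)
    ultimately have "cmod (g ((1/2) ^ Suc n)) \<le> (1/2) ^ n" by linarith
    moreover have "?k n c - 1 = of_real M * g ((1/2) ^ Suc n)" using M(1) by (simp add: g_def)
    ultimately show ?thesis using M(1) by (simp add: norm_mult)
  qed
  have summ: "summable (\<lambda>n. M * (1/2) ^ n :: real)" by (intro summable_mult summable_geometric) simp
  show conv: "convergent_prod (\<lambda>n. ?k n c)" if "c \<in> cball 0 \<delta>" for c
  proof -
    have "summable (\<lambda>n. norm (?k n c - 1))"
      by (rule summable_comparison_test'[OF summ, of 0]) (use bound[OF that] in auto)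
    then show ?thesis
      by (intro abs_convergent_prod_imp_convergent_prod) (simp add: abs_convergent_prod_conv_summable)
  qed
  have kh: "hol2 (cball 0 \<delta>) (?k n)" for n
  proof (rule hol2_subset[OF hol2_scale[OF k]], rule subsetI, rule CollectI)
    fix c :: "complex \<times> complex" assume "c \<in> cball 0 \<delta>"
    then show "((1/2) ^ n * fst c, (1/2) ^ n * snd c) \<in> \<Omega>" using sc[of "(1/2) ^ n" c] h1[of n] sub by auto
  qed
  have "uniformly_convergent_on (cball 0 \<delta>) (\<lambda>N c. \<Sum>n<N. norm (?k n c - 1))"
    unfolding uniformly_convergent_on_def
    by (rule exI, rule Weierstrass_m_test[OF _ summ]) (use bound in auto)
  then have "uniformly_convergent_on (cball 0 \<delta>) (\<lambda>N c. \<Prod>n<N. ?k n c)"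
    by (rule uniformly_convergent_on_prod'[OF hol2_continuous[OF kh] compact_cball])
  then obtain p where p: "uniform_limit (cball 0 \<delta>) (\<lambda>N c. \<Prod>n<N. ?k n c) p sequentially"
    unfolding uniformly_convergent_on_def by blast
  have "hol2 (ball 0 \<delta>) p"
    by (rule hol2_uniform_limit[OF open_ball _ uniform_limit_on_subset[OF p ball_subset_cball]])
       (intro hol2_prod hol2_subset[OF kh ball_subset_cball])
  moreover have "p c = (\<Prod>n. ?k n c)" if "c \<in> ball 0 \<delta>" for c
  proof (rule LIMSEQ_unique)
    show "(\<lambda>N. \<Prod>n\<le>N. ?k n c) \<longlonglongrightarrow> p c"
      using LIMSEQ_Suc[OF tendsto_uniform_limitI[OF p, of c]] that by (simp add: lessThan_Suc_atMost)
    show "(\<lambda>N. \<Prod>n\<le>N. ?k n c) \<longlonglongrightarrow> (\<Prod>n. ?k n c)"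
      by (rule convergent_prod_LIMSEQ[OF conv]) (use that in auto)
  qed
  ultimately show "hol2 (ball 0 \<delta>) (\<lambda>c. \<Prod>n. ?k n c)" by (rule hol2_cong)
qed

section \<open>Normalising a germ by the action of the torus\<close>

definition loop_comb :: "(real \<Rightarrow> complex) \<Rightarrow> (real \<Rightarrow> complex) \<Rightarrow> complex \<times> complex \<Rightarrow> real \<Rightarrow> complex"
  where "loop_comb y z c = (\<lambda>t. fst c * y t + snd c * z t)"

lemma loop_comb_smooth: "y \<in> smooth_loops \<Longrightarrow> z \<in> smooth_loops \<Longrightarrow> loop_comb y z c \<in> smooth_loops"
  unfolding loop_comb_def by (rule smooth_loops_lincomb)

lemma loop_comb_scale: "LC_scale r (loop_comb y z c) = loop_comb y z (r * fst c, r * snd c)"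
  by (simp add: loop_comb_def LC_scale_def fun_eq_iff algebra_simps)

lemma loop_comb_1_0: "loop_comb y z (a, 0) = LC_scale a y"
  by (simp add: loop_comb_def LC_scale_def fun_eq_iff)

lemma smooth_loops_scale: "y \<in> smooth_loops \<Longrightarrow> LC_scale r y \<in> smooth_loops"
  using smooth_loops_lincomb[of y y r 0] by (simp add: LC_scale_def)

lemma LC_scale_scale: "LC_scale a (LC_scale b y) = LC_scale (a * b) y"
  by (simp add: LC_scale_def fun_eq_iff)

lemma LC_scale_1: "LC_scale 1 y = y"
  by (simp add: LC_scale_def)

text \<open>Here \<open>f\<close> is the lift with \<open>l \<circ> f = 1\<close> of the embedding \<open>e\<close> on a neighbourhood \<open>D\<close> of the loop
  \<open>0\<close>; \<open>A\<close> and \<open>B\<close> are linear lifts of the actions of \<open>z \<mapsto> z/2\<close> and \<open>z \<mapsto> 1/z\<close>, so that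
  \<open>B A\<^sup>-\<^sup>1\<close> and \<open>A B\<close> agree up to a scalar \<open>\<kappa>\<close>; \<open>L\<close> is the space of continuous functionals.\<close>

locale equivariant_germ = complex_subspace sc E
  for sc :: "complex \<Rightarrow> 'v \<Rightarrow> 'v::ab_group_add" and E +
  fixes L :: "('v \<Rightarrow> complex) set"
    and D :: "(real \<Rightarrow> complex) set"
    and f :: "(real \<Rightarrow> complex) \<Rightarrow> 'v"
    and e :: "(real \<Rightarrow> complex) \<Rightarrow> 'v set"
    and l :: "'v \<Rightarrow> complex"
    and A Ai B :: "'v \<Rightarrow> 'v"
    and \<alpha> \<kappa> :: complex
  assumes L_lin: "\<mu> \<in> L \<Longrightarrow> clinear_on sc (*) E \<mu>"
    and L_sep: "v \<in> E \<Longrightarrow> (\<And>\<mu>. \<mu> \<in> L \<Longrightarrow> \<mu> v = 0) \<Longrightarrow> v = 0"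
    and L_A: "\<mu> \<in> L \<Longrightarrow> (\<lambda>v. \<mu> (A v)) \<in> L"
    and L_Ai: "\<mu> \<in> L \<Longrightarrow> (\<lambda>v. \<mu> (Ai v)) \<in> L"
    and L_B: "\<mu> \<in> L \<Longrightarrow> (\<lambda>v. \<mu> (B v)) \<in> L"
    and l_L: "l \<in> L"
    and A_lin: "clinear_on sc sc E A" and Ai_lin: "clinear_on sc sc E Ai" and B_lin: "clinear_on sc sc E B"
    and A_E: "v \<in> E \<Longrightarrow> A v \<in> E" and Ai_E: "v \<in> E \<Longrightarrow> Ai v \<in> E" and B_E: "v \<in> E \<Longrightarrow> B v \<in> E"
    and A_Ai: "v \<in> E \<Longrightarrow> A (Ai v) = v" and Ai_A: "v \<in> E \<Longrightarrow> Ai (A v) = v"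
    and B_inj: "v \<in> E \<Longrightarrow> B v = 0 \<Longrightarrow> v = 0"
    and \<kappa>: "\<kappa> \<noteq> 0" and BA: "v \<in> E \<Longrightarrow> B (Ai v) = sc \<kappa> (A (B v))"
    and \<alpha>: "\<alpha> \<noteq> 0" and A_0: "A (f (\<lambda>t. 0)) = sc \<alpha> (f (\<lambda>t. 0))"
    and D_0: "(\<lambda>t. 0) \<in> D" and D_smooth: "D \<subseteq> smooth_loops"
    and f_E: "y \<in> D \<Longrightarrow> f y \<in> E" and f_l: "y \<in> D \<Longrightarrow> l (f y) = 1" and e_f: "y \<in> D \<Longrightarrow> e y = line sc (f y)"
    and e_A: "y \<in> smooth_loops \<Longrightarrow> e (LC_scale (1/2) y) = A ` e y"
    and e_B: "y \<in> smooth_loops \<Longrightarrow> z \<in> smooth_loops \<Longrightarrow> (\<And>t. y t * z t = 1) \<Longrightarrow> e z = B ` e y"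
    and e_line: "y \<in> smooth_loops \<Longrightarrow> \<exists>v\<in>E. v \<noteq> 0 \<and> e y = line sc v"
    and D_open: "y \<in> smooth_loops \<Longrightarrow> z \<in> smooth_loops \<Longrightarrow> open {c. loop_comb y z c \<in> D}"
    and f_hol: "y \<in> smooth_loops \<Longrightarrow> z \<in> smooth_loops \<Longrightarrow> \<mu> \<in> L \<Longrightarrow>
      hol2 {c. loop_comb y z c \<in> D} (\<lambda>c. \<mu> (f (loop_comb y z c)))"
begin

lemma L_add: "\<mu> \<in> L \<Longrightarrow> v \<in> E \<Longrightarrow> w \<in> E \<Longrightarrow> \<mu> (v + w) = \<mu> v + \<mu> w"
  using L_lin by (simp add: clinear_on_def)
lemma L_scale: "\<mu> \<in> L \<Longrightarrow> v \<in> E \<Longrightarrow> \<mu> (sc c v) = c * \<mu> v"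
  using L_lin by (simp add: clinear_on_def)
lemma A_scale: "v \<in> E \<Longrightarrow> A (sc c v) = sc c (A v)"
  using A_lin by (simp add: clinear_on_def)
lemma Ai_scale: "v \<in> E \<Longrightarrow> Ai (sc c v) = sc c (Ai v)"
  using Ai_lin by (simp add: clinear_on_def)
lemma B_scale: "v \<in> E \<Longrightarrow> B (sc c v) = sc c (B v)"
  using B_lin by (simp add: clinear_on_def)
lemma L_0: "\<mu> \<in> L \<Longrightarrow> \<mu> 0 = 0"
  using L_scale[of \<mu> 0 0] E_0 by simp
lemma Aik_E: "v \<in> E \<Longrightarrow> (Ai ^^ k) v \<in> E"
  by (induction k) (auto simp: Ai_E)
lemma L_Aik: "\<mu> \<in> L \<Longrightarrow> (\<lambda>v. \<mu> ((Ai ^^ k) v)) \<in> L"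
proof (induction k arbitrary: \<mu>)
  case (Suc k)
  show ?case using Suc.IH[OF L_Ai[OF Suc.prems]] by simp
qed simp
lemma Aik_scale: "v \<in> E \<Longrightarrow> (Ai ^^ k) (sc c v) = sc c ((Ai ^^ k) v)"
  by (induction k) (auto simp: Ai_scale Aik_E)

text \<open>The factor \<open>m\<close> measures the failure of \<open>A (f y) = \<alpha> f (y/2)\<close>.  Multiplying \<open>f\<close> by the infinite
  product \<open>P\<close> corrects it, and then \<open>F y = \<alpha>\<^sup>k A\<^sup>-\<^sup>k F (y/2\<^sup>k)\<close> extends the lift to all smooth loops.\<close>

definition m :: "(real \<Rightarrow> complex) \<Rightarrow> complex"
  where "m y = \<alpha> / l (A (f y))"

text \<open>By equivariance \<open>A (f y)\<close> lies on the line spanned by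
  \<open>f (y/2)\<close>, and \<open>l\<close> reads off the factor because it is 1 on all values of
  \<open>f\<close>.\<close>

lemma half_step:
  assumes y: "y \<in> D" and y2: "LC_scale (1/2) y \<in> D"
  shows "l (A (f y)) \<noteq> 0" "A (f y) = sc (l (A (f y))) (f (LC_scale (1/2) y))"
    "sc \<alpha> (Ai (f (LC_scale (1/2) y))) = sc (m y) (f y)"
proof -
  have s: "y \<in> smooth_loops" using y D_smooth by blast
  have "A (f y) \<in> A ` e y"
    unfolding e_f[OF y] line_def by (rule imageI, rule range_eqI[of _ _ 1]) simp
  also have "\<dots> = line sc (f (LC_scale (1/2) y))" using e_A[OF s] e_f[OF y2] by simp
  finally obtain c where c: "A (f y) = sc c (f (LC_scale (1/2) y))" by (auto simp: line_def)
  have lc: "l (A (f y)) = c" unfolding c using L_scale[OF l_L f_E[OF y2]] f_l[OF y2] by simp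
  show "A (f y) = sc (l (A (f y))) (f (LC_scale (1/2) y))" unfolding lc by (rule c)
  have fy: "f y = sc c (Ai (f (LC_scale (1/2) y)))"
    using arg_cong[OF c, of Ai] by (simp add: Ai_A f_E y y2 Ai_scale)
  have "c \<noteq> 0"
  proof
    assume "c = 0"
    then have "f y = 0" using fy by simp
    then show False using f_l[OF y] L_0[OF l_L] by simp
  qed
  then show "l (A (f y)) \<noteq> 0" using lc by simp
  show "sc \<alpha> (Ai (f (LC_scale (1/2) y))) = sc (m y) (f y)"
  proof -
    have "sc (m y) (f y) = sc (\<alpha> / c * c) (Ai (f (LC_scale (1/2) y)))"
      unfolding m_def lc scale_scale[symmetric] fy[symmetric] ..
    then show ?thesis using \<open>c \<noteq> 0\<close> by simp
  qed
qed

lemma m_nonzero: "y \<in> D \<Longrightarrow> LC_scale (1/2) y \<in> D \<Longrightarrow> m y \<noteq> 0"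
  using half_step(1) \<alpha> by (simp add: m_def)

lemma m_0: "m (\<lambda>t. 0) = 1"
  using L_scale[OF l_L f_E[OF D_0]] f_l[OF D_0] \<alpha> by (simp add: m_def A_0)

text \<open>The domain of the normalised lift. In contrast to \<open>D\<close> it is closed under
  halving by construction, and every smooth loop enters it after finitely many halvings.\<close>

definition N :: "(real \<Rightarrow> complex) set"
  where "N = {y. (\<forall>j. LC_scale ((1/2) ^ j) y \<in> D) \<and> convergent_prod (\<lambda>j. m (LC_scale ((1/2) ^ j) y))}"

definition P :: "(real \<Rightarrow> complex) \<Rightarrow> complex"
  where "P y = (\<Prod>j. m (LC_scale ((1/2) ^ j) y))"

lemma N_D: "y \<in> N \<Longrightarrow> y \<in> D"
  unfolding N_def by (auto dest: spec[of _ 0] simp: LC_scale_1)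

lemma N_half: "y \<in> N \<Longrightarrow> LC_scale (1/2) y \<in> N"
proof -
  assume y: "y \<in> N"
  have s: "LC_scale ((1/2) ^ j) (LC_scale (1/2) y) = LC_scale ((1/2) ^ Suc j) y" for j
    by (simp add: LC_scale_scale mult.commute)
  have "convergent_prod (\<lambda>j. m (LC_scale ((1/2) ^ (j + 1)) y))"
    using y by (intro convergent_prod_ignore_initial_segment) (simp add: N_def)
  then show ?thesis using y by (simp add: N_def s del: power_Suc)
qed

lemma P_nonzero: "y \<in> N \<Longrightarrow> P y \<noteq> 0"
proof -
  assume y: "y \<in> N"
  have "m (LC_scale ((1/2) ^ j) y) \<noteq> 0" for j
  proof (rule m_nonzero)
    show "LC_scale ((1/2) ^ j) y \<in> D" using y by (simp add: N_def)
    have "LC_scale ((1/2) ^ Suc j) y \<in> D" using y unfolding N_def by blast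
    then show "LC_scale (1/2) (LC_scale ((1/2) ^ j) y) \<in> D" by (simp add: LC_scale_scale)
  qed
  then show "P y \<noteq> 0" unfolding P_def using y by (intro prodinf_nonzero) (simp_all add: N_def)
qed

lemma P_half: "y \<in> N \<Longrightarrow> P y = m y * P (LC_scale (1/2) y)"
proof -
  assume y: "y \<in> N"
  have s: "LC_scale ((1/2) ^ j) (LC_scale (1/2) y) = LC_scale ((1/2) ^ Suc j) y" for j
    by (simp add: LC_scale_scale mult.commute)
  have m0: "m (LC_scale ((1/2) ^ 0) y) \<noteq> 0"
    using m_nonzero[OF N_D[OF y] N_D[OF N_half[OF y]]] by (simp add: LC_scale_1)
  have "(\<Prod>j. m (LC_scale ((1/2) ^ Suc j) y)) = P y / m (LC_scale ((1/2) ^ 0) y)"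
    unfolding P_def using y m0 by (intro prodinf_split_head) (simp_all add: N_def)
  then have "P (LC_scale (1/2) y) = P y / m (LC_scale ((1/2) ^ 0) y)"
    unfolding P_def s .
  then show ?thesis using m0 by (simp add: LC_scale_1)
qed

definition F_at :: "nat \<Rightarrow> (real \<Rightarrow> complex) \<Rightarrow> 'v"
  where "F_at k y = sc (\<alpha> ^ k * P (LC_scale ((1/2) ^ k) y)) ((Ai ^^ k) (f (LC_scale ((1/2) ^ k) y)))"

definition F :: "(real \<Rightarrow> complex) \<Rightarrow> 'v"
  where "F y = F_at (LEAST k. LC_scale ((1/2) ^ k) y \<in> N) y"

text \<open>Passing to the next level introduces the factor \<open>m\<close> through
  \<open>half_step\<close>, and the product \<open>P\<close> loses exactly this factor.\<close>

lemma F_at_Suc: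
  assumes "LC_scale ((1/2) ^ k) y \<in> N"
  shows "LC_scale ((1/2) ^ Suc k) y \<in> N" "F_at (Suc k) y = F_at k y"
proof -
  let ?z = "LC_scale ((1/2) ^ k) y"
  have z: "LC_scale (1/2) ?z = LC_scale ((1/2) ^ Suc k) y" by (simp add: LC_scale_scale)
  then show "LC_scale ((1/2) ^ Suc k) y \<in> N" using N_half[OF assms] by simp
  note D = N_D[OF assms] N_D[OF N_half[OF assms]]
  have "F_at (Suc k) y = sc (\<alpha> ^ Suc k * P (LC_scale (1/2) ?z)) ((Ai ^^ k) (Ai (f (LC_scale (1/2) ?z))))"
    unfolding F_at_def z by (simp add: funpow_swap1)
  also have "\<dots> = (Ai ^^ k) (sc (\<alpha> ^ k * P (LC_scale (1/2) ?z)) (sc \<alpha> (Ai (f (LC_scale (1/2) ?z)))))"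
    using D by (simp add: Aik_scale Ai_E f_E E_scale mult_ac)
  also have "\<dots> = (Ai ^^ k) (sc (\<alpha> ^ k * P ?z) (f ?z))"
    unfolding half_step(3)[OF D] P_half[OF assms] by (simp add: mult_ac)
  also have "\<dots> = F_at k y" unfolding F_at_def using D by (simp add: Aik_scale f_E)
  finally show "F_at (Suc k) y = F_at k y" .
qed

lemma F_eq:
  assumes "LC_scale ((1/2) ^ k) y \<in> N" shows "F y = F_at k y"
proof -
  let ?k0 = "LEAST k. LC_scale ((1/2) ^ k) y \<in> N"
  have k0: "LC_scale ((1/2) ^ ?k0) y \<in> N" by (rule LeastI[of "\<lambda>k. LC_scale ((1/2) ^ k) y \<in> N", OF assms])
  have "LC_scale ((1/2) ^ (?k0 + i)) y \<in> N \<and> F_at (?k0 + i) y = F_at ?k0 y" for i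
  proof (induction i)
    case (Suc i)
    then show ?case using F_at_Suc[of "?k0 + i" y] by simp
  qed (simp add: k0)
  from this[of "k - ?k0"] show ?thesis
    using Least_le[of "\<lambda>k. LC_scale ((1/2) ^ k) y \<in> N", OF assms] by (simp add: F_def)
qed

lemma local_product:
  assumes y: "y \<in> smooth_loops" and z: "z \<in> smooth_loops"
  obtains \<delta> where "\<delta> > 0" "\<And>c. c \<in> ball 0 \<delta> \<Longrightarrow> loop_comb y z c \<in> N"
    "hol2 (ball 0 \<delta>) (\<lambda>c. P (loop_comb y z c))"
proof -
  let ?S = "{c. loop_comb y z c \<in> D}"
  have "open ?S" by (rule D_open[OF y z])
  moreover have "0 \<in> ?S" using D_0 by (simp add: loop_comb_def zero_prod_def)
  ultimately obtain \<epsilon> where \<epsilon>: "\<epsilon> > 0" "ball 0 \<epsilon> \<subseteq> ?S" using open_contains_ball by blast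
  have half: "(1/2 * fst c, 1/2 * snd c) \<in> ball 0 \<epsilon>" if "c \<in> ball 0 \<epsilon>" for c :: "complex \<times> complex"
  proof -
    have "norm (1/2 * fst c, 1/2 * snd c) = 1/2 * norm c" using norm_pair_scale[of "1/2" "fst c" "snd c"] by simp
    then show ?thesis using that norm_ge_zero[of c] unfolding mem_ball_0 by linarith
  qed
  have nz: "l (A (f (loop_comb y z c))) \<noteq> 0" if "c \<in> ball 0 \<epsilon>" for c
  proof -
    have "loop_comb y z c \<in> D" "LC_scale (1/2) (loop_comb y z c) \<in> D"
      unfolding loop_comb_scale using \<epsilon>(2) that half[OF that] by blast+
    then show ?thesis by (rule half_step(1))
  qed
  have k: "hol2 (ball 0 \<epsilon>) (\<lambda>c. m (loop_comb y z c))"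
    unfolding m_def
    by (intro hol2_divide hol2_const hol2_subset[OF f_hol[OF y z L_A[OF l_L]] \<epsilon>(2)] nz)
  \<comment> \<open>A third of \<open>\<epsilon>\<close>, since the product needs a closed ball of
    radius \<open>2 * \<delta>\<close> inside the domain.\<close>
  define \<delta> where "\<delta> = \<epsilon> / 3"
  have \<delta>: "\<delta> > 0" "cball 0 (2 * \<delta>) \<subseteq> (ball 0 \<epsilon> :: (complex \<times> complex) set)" using \<epsilon>(1) by (auto simp: \<delta>_def)
  have k0: "m (loop_comb y z (0, 0)) = 1" using m_0 by (simp add: loop_comb_def)
  note prod = hol2_infinite_product[OF k \<delta> k0]
  show ?thesis
  proof (rule that[OF \<delta>(1)])
    show "hol2 (ball 0 \<delta>) (\<lambda>c. P (loop_comb y z c))"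
      unfolding P_def loop_comb_scale by (rule prod(1))
    fix c :: "complex \<times> complex" assume c: "c \<in> ball 0 \<delta>"
    show "loop_comb y z c \<in> N"
      unfolding N_def mem_Collect_eq loop_comb_scale
    proof (intro conjI allI)
      show "convergent_prod (\<lambda>j. m (loop_comb y z ((1/2) ^ j * fst c, (1/2) ^ j * snd c)))"
        by (rule prod(2)) (use c in auto)
      fix j
      have "norm ((1/2) ^ j * fst c, (1/2) ^ j * snd c) = cmod ((1/2) ^ j) * norm c"
        using norm_pair_scale[of "(1/2) ^ j" "fst c" "snd c"] by simp
      also have "\<dots> \<le> 1 * norm c" by (intro mult_right_mono) (auto simp: norm_power power_le_one)
      also have "\<dots> < \<epsilon>" using c \<epsilon>(1) by (simp add: \<delta>_def)
      finally show "loop_comb y z ((1/2) ^ j * fst c, (1/2) ^ j * snd c) \<in> D" using \<epsilon>(2) by (auto simp: subset_iff)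
    qed
  qed
qed

text \<open>The least level in the definition of \<open>F\<close> may jump from point to point. One
  level valid on a whole ball gives a single formula for \<open>F\<close> there, from which
  holomorphy can be read off.\<close>

lemma uniform_level:
  assumes y: "y \<in> smooth_loops" and z: "z \<in> smooth_loops"
  obtains k where "\<And>c. c \<in> ball 0 R \<Longrightarrow> LC_scale ((1/2) ^ k) (loop_comb y z c) \<in> N"
    "hol2 (ball 0 R) (\<lambda>c. P (LC_scale ((1/2) ^ k) (loop_comb y z c)))"
proof -
  obtain \<delta> where \<delta>: "\<delta> > 0" "\<And>c. c \<in> ball 0 \<delta> \<Longrightarrow> loop_comb y z c \<in> N"
    "hol2 (ball 0 \<delta>) (\<lambda>c. P (loop_comb y z c))"
    using local_product[OF y z] by blast
  obtain k where k: "(1/2) ^ k < \<delta> / (\<bar>R\<bar> + 1)"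
    using real_arch_pow_inv[of "\<delta> / (\<bar>R\<bar> + 1)" "1/2"] \<delta>(1) by auto
  have sub: "((1/2) ^ k * fst c, (1/2) ^ k * snd c) \<in> ball 0 \<delta>" if "c \<in> ball 0 R" for c :: "complex \<times> complex"
  proof -
    have "norm ((1/2) ^ k * fst c, (1/2) ^ k * snd c) = (1/2) ^ k * norm c"
      using norm_pair_scale[of "(1/2) ^ k" "fst c" "snd c"] by (simp add: norm_power)
    also have "\<dots> \<le> (1/2) ^ k * (\<bar>R\<bar> + 1)" using that by (intro mult_left_mono) auto
    also have "\<dots> < \<delta>" using k by (simp add: field_simps)
    finally show ?thesis by simp
  qed
  show ?thesis
  proof (rule that[of k])
    show "LC_scale ((1/2) ^ k) (loop_comb y z c) \<in> N" if "c \<in> ball 0 R" for c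
      unfolding loop_comb_scale by (rule \<delta>(2)[OF sub[OF that]])
    show "hol2 (ball 0 R) (\<lambda>c. P (LC_scale ((1/2) ^ k) (loop_comb y z c)))"
      unfolding loop_comb_scale
      by (rule hol2_subset[OF hol2_scale[OF \<delta>(3)]], rule subsetI, rule CollectI, rule sub)
  qed
qed

lemma level:
  assumes y: "y \<in> smooth_loops"
  obtains k where "LC_scale ((1/2) ^ k) y \<in> N"
proof -
  obtain k where k: "\<And>c. c \<in> ball 0 2 \<Longrightarrow> LC_scale ((1/2) ^ k) (loop_comb y y c) \<in> N"
    using uniform_level[OF y y, where R = 2] by blast
  have "((1, 0) :: complex \<times> complex) \<in> ball 0 2" by (simp add: norm_Pair)
  from k[OF this] show ?thesis by (intro that) (simp add: loop_comb_1_0 LC_scale_1)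
qed

lemma F_hol2:
  assumes y: "y \<in> smooth_loops" and z: "z \<in> smooth_loops" and L: "\<mu> \<in> L"
  shows "hol2 (ball 0 R) (\<lambda>c. \<mu> (F (loop_comb y z c)))"
proof -
  obtain k where k: "\<And>c. c \<in> ball 0 R \<Longrightarrow> LC_scale ((1/2) ^ k) (loop_comb y z c) \<in> N"
    "hol2 (ball 0 R) (\<lambda>c. P (LC_scale ((1/2) ^ k) (loop_comb y z c)))"
    using uniform_level[OF y z, where R = R] by blast
  have "hol2 (ball 0 R) (\<lambda>c. \<mu> ((Ai ^^ k) (f (LC_scale ((1/2) ^ k) (loop_comb y z c)))))"
    unfolding loop_comb_scale
  proof (rule hol2_subset[OF hol2_scale[OF f_hol[OF y z L_Aik[OF L]]]], rule subsetI, intro CollectI)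
    fix c :: "complex \<times> complex" assume "c \<in> ball 0 R"
    then show "loop_comb y z ((1/2) ^ k * fst c, (1/2) ^ k * snd c) \<in> D"
      using N_D[OF k(1)] unfolding loop_comb_scale by blast
  qed
  from hol2_mult[OF hol2_mult[OF hol2_const k(2)] this]
  have "hol2 (ball 0 R) (\<lambda>c. \<alpha> ^ k * P (LC_scale ((1/2) ^ k) (loop_comb y z c)) *
      \<mu> ((Ai ^^ k) (f (LC_scale ((1/2) ^ k) (loop_comb y z c)))))" .
  then show ?thesis
  proof (rule hol2_cong)
    fix c :: "complex \<times> complex" assume c: "c \<in> ball 0 R"
    show "\<alpha> ^ k * P (LC_scale ((1/2) ^ k) (loop_comb y z c)) * \<mu> ((Ai ^^ k) (f (LC_scale ((1/2) ^ k) (loop_comb y z c))))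
        = \<mu> (F (loop_comb y z c))"
      unfolding F_eq[OF k(1)[OF c]] F_at_def
      using L_scale[OF L Aik_E[OF f_E[OF N_D[OF k(1)[OF c]]]]] by simp
  qed
qed

lemma F_continuous:
  assumes "y \<in> smooth_loops" "z \<in> smooth_loops" "\<mu> \<in> L"
  shows "continuous_on UNIV (\<lambda>c. \<mu> (F (loop_comb y z c)))"
proof -
  have "isCont (\<lambda>c. \<mu> (F (loop_comb y z c))) c" for c
    using continuous_on_interior[OF hol2_continuous[OF F_hol2[OF assms, of "norm c + 1"]], of c]
    by (simp add: interior_open)
  then show ?thesis by (simp add: continuous_at_imp_continuous_on)
qed

lemma F_entire:
  assumes y: "y \<in> smooth_loops" and z: "z \<in> smooth_loops" and L: "\<mu> \<in> L"
  shows "(\<lambda>w. \<mu> (F (loop_comb y z (a + w * a', b + w * b')))) holomorphic_on UNIV"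
proof -
  have "(\<lambda>w. \<mu> (F (loop_comb y z (a + w * a', b + w * b')))) field_differentiable at w" for w
  proof -
    let ?R = "norm (a + w * a', b + w * b') + 1"
    let ?S = "{w. (a + w * a', b + w * b') \<in> ball 0 ?R}"
    have "continuous_on UNIV (\<lambda>z. (a + z * a', b + z * b'))" by (intro continuous_intros)
    from open_vimage[OF open_ball this] have S: "open ?S" by (simp only: vimage_def)
    show ?thesis
      by (rule holomorphic_on_imp_differentiable_at[OF hol2_line[OF F_hol2[OF y z L, of ?R]] S]) simp
  qed
  then show ?thesis by (simp add: holomorphic_on_def field_differentiable_at_within)
qed

lemma e_scale_power:
  assumes y: "y \<in> smooth_loops"
  shows "e (LC_scale ((1/2) ^ k) y) = (A ^^ k) ` e y"
proof (induction k)
  case (Suc k)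
  have "LC_scale ((1/2) ^ Suc k) y = LC_scale (1/2) (LC_scale ((1/2) ^ k) y)" by (simp add: LC_scale_scale)
  then show ?case using e_A[OF smooth_loops_scale[OF y]] Suc by (simp add: image_image)
qed (simp add: LC_scale_1)

lemma Ak_E: "v \<in> E \<Longrightarrow> (A ^^ k) v \<in> E"
  by (induction k) (simp_all add: A_E)

lemma Aik_Ak: "v \<in> E \<Longrightarrow> (Ai ^^ k) ((A ^^ k) v) = v"
proof (induction k)
  case (Suc k)
  have "(Ai ^^ Suc k) ((A ^^ Suc k) v) = (Ai ^^ k) (Ai (A ((A ^^ k) v)))"
    by (simp add: funpow_swap1)
  also have "\<dots> = v" using Suc by (simp add: Ai_A Ak_E)
  finally show ?case .
qed simp

lemma Ak_scale: "v \<in> E \<Longrightarrow> (A ^^ k) (sc c v) = sc c ((A ^^ k) v)"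
  by (induction k) (simp_all add: A_scale Ak_E)

text \<open>At a level \<open>k\<close> where the halved loop lies in \<open>N\<close>, the value of
  \<open>f\<close> spans the image of \<open>e y\<close> under the k-th power of \<open>A\<close>;
  the power of \<open>Ai\<close> in \<open>F\<close> carries it back to \<open>e y\<close>.\<close>

lemma F_line:
  assumes y: "y \<in> smooth_loops" shows "F y \<in> E" "F y \<noteq> 0" "e y = line sc (F y)"
proof -
  obtain k where k: "LC_scale ((1/2) ^ k) y \<in> N" by (rule level[OF y])
  let ?z = "LC_scale ((1/2) ^ k) y"
  have fz: "f ?z \<in> E" by (rule f_E[OF N_D[OF k]])
  show "F y \<in> E" unfolding F_eq[OF k] F_at_def by (intro E_scale Aik_E fz)
  obtain v where v: "v \<in> E" "v \<noteq> 0" "e y = line sc v" using e_line[OF y] by blast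
  have "f ?z \<in> e ?z" unfolding e_f[OF N_D[OF k]] line_def by (rule range_eqI[of _ _ 1]) simp
  then have "f ?z \<in> (A ^^ k) ` line sc v" unfolding e_scale_power[OF y] v(3) .
  then obtain c where c: "f ?z = (A ^^ k) (sc c v)" by (auto simp: line_def)
  have "c \<noteq> 0"
  proof
    assume "c = 0"
    then have "f ?z = 0" using c Ak_scale[OF v(1), of k 0] by simp
    then show False using f_l[OF N_D[OF k]] L_0[OF l_L] by simp
  qed
  have "(Ai ^^ k) (f ?z) = sc c v" unfolding c by (rule Aik_Ak[OF E_scale[OF v(1)]])
  then have Fv: "F y = sc (\<alpha> ^ k * P ?z * c) v" unfolding F_eq[OF k] F_at_def by simp
  have nz: "\<alpha> ^ k * P ?z * c \<noteq> 0" using \<alpha> P_nonzero[OF k] \<open>c \<noteq> 0\<close> by simp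
  show "F y \<noteq> 0" unfolding Fv using nz v(2) by simp
  show "e y = line sc (F y)"
  proof
    show "e y \<subseteq> line sc (F y)"
      unfolding v(3) Fv line_def
    proof (rule image_subsetI)
      fix d
      have "sc d v = sc (d / (\<alpha> ^ k * P ?z * c)) (sc (\<alpha> ^ k * P ?z * c) v)" using nz by simp
      then show "sc d v \<in> range (\<lambda>d. sc d (sc (\<alpha> ^ k * P ?z * c) v))" by (rule range_eqI)
    qed
    show "line sc (F y) \<subseteq> e y" unfolding v(3) Fv line_def by (auto simp: scale_scale)
  qed
qed

lemma F_half:
  assumes y: "y \<in> smooth_loops"
  shows "A (F y) = sc \<alpha> (F (LC_scale (1/2) y))" "sc \<alpha> (Ai (F (LC_scale (1/2) y))) = F y"
proof -
  obtain k where k: "LC_scale ((1/2) ^ k) y \<in> N" by (rule level[OF y])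
  let ?h = "LC_scale (1/2) y" and ?z = "LC_scale ((1/2) ^ Suc k) y"
  \<comment> \<open>Level \<open>k\<close> of the halved loop and level \<open>Suc k\<close> of
    \<open>y\<close> involve the same loop, so both values of \<open>F\<close> come from one value
    of \<open>f\<close>.\<close>
  have z: "LC_scale ((1/2) ^ k) ?h = ?z" by (simp add: LC_scale_scale mult.commute)
  have zN: "?z \<in> N" by (rule F_at_Suc(1)[OF k])
  then have hN: "LC_scale ((1/2) ^ k) ?h \<in> N" using z by simp
  have fz: "f ?z \<in> E" by (rule f_E[OF N_D[OF zN]])
  have Fh: "F ?h = sc (\<alpha> ^ k * P ?z) ((Ai ^^ k) (f ?z))" unfolding F_eq[OF hN] F_at_def z ..
  have Fy: "F y = sc (\<alpha> ^ Suc k * P ?z) (Ai ((Ai ^^ k) (f ?z)))" unfolding F_eq[OF zN] F_at_def by simp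
  show 1: "A (F y) = sc \<alpha> (F ?h)"
    unfolding Fh Fy using fz by (simp add: A_scale Ai_E Aik_E A_Ai mult_ac)
  show "sc \<alpha> (Ai (F ?h)) = F y"
    unfolding Fh Fy using fz by (simp add: Ai_scale Aik_E mult_ac)
qed

lemma F_0: "F (\<lambda>t. 0) = f (\<lambda>t. 0)"
proof -
  have s: "LC_scale c (\<lambda>t. 0) = (\<lambda>t. 0)" for c by (simp add: LC_scale_def)
  have N0: "LC_scale ((1/2) ^ 0) (\<lambda>t. 0) \<in> N"
    unfolding s N_def by (simp add: s D_0 m_0)
  have "P (\<lambda>t. 0) = 1" by (simp add: P_def s m_0)
  then show ?thesis unfolding F_eq[OF N0] F_at_def s by simp
qed

end

section \<open>Inversion and polynomial growth\<close>

context equivariant_germ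
begin

lemma F_E: "y \<in> smooth_loops \<Longrightarrow> F y \<in> E"
  by (rule F_line(1))

lemma F_ray:
  assumes y: "y \<in> smooth_loops" and L: "\<mu> \<in> L"
  shows "(\<lambda>w. \<mu> (F (LC_scale w y))) holomorphic_on UNIV"
  using F_entire[OF y y L, of 0 1 0 0] by (simp add: loop_comb_1_0)

lemma inversion_factor:
  assumes y: "y \<in> smooth_loops" and z: "z \<in> smooth_loops" and inv: "\<And>t. y t * z t = 1" and w: "w \<noteq> 0"
  shows "\<exists>\<theta>. \<theta> \<noteq> 0 \<and> F (LC_scale w y) = sc \<theta> (B (F (LC_scale (1 / w) z)))"
proof -
  let ?y = "LC_scale w y" and ?z = "LC_scale (1 / w) z"
  have s: "?y \<in> smooth_loops" "?z \<in> smooth_loops" using y z by (auto intro: smooth_loops_scale)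
  have i: "?z t * ?y t = 1" for t
  proof -
    have "?z t * ?y t = y t * z t" using w by (simp add: LC_scale_def)
    then show ?thesis using inv by simp
  qed
  have "F ?y \<in> e ?y" unfolding F_line(3)[OF s(1)] line_def by (rule range_eqI[of _ _ 1]) simp
  also have "e ?y = B ` e ?z" by (rule e_B[OF s(2,1) i])
  also have "\<dots> = B ` line sc (F ?z)" unfolding F_line(3)[OF s(2)] ..
  finally obtain c where c: "F ?y = B (sc c (F ?z))" unfolding line_def by blast
  then have eq: "F ?y = sc c (B (F ?z))" using B_scale[OF F_E[OF s(2)]] by simp
  have "c \<noteq> 0" using eq F_line(2)[OF s(1)] by auto
  then show ?thesis using eq by blast
qed

text \<open>One factor \<open>\<alpha>\<close> arises from doubling the loop, a second from halving
  its inverse, and \<open>\<kappa>\<close> from moving \<open>A\<close> past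
  \<open>B\<close>.\<close>

definition K :: complex where "K = \<alpha>\<^sup>2 * \<kappa>"

lemma K_nonzero: "K \<noteq> 0"
  using \<alpha> \<kappa> by (simp add: K_def)

text \<open>Applying \<open>A\<close> to the left side returns to the parameter \<open>w\<close>,
  where the comparison is known; the inverse loop is halved through \<open>Ai\<close>, the relation
  \<open>BA\<close> moves this operator to the left of \<open>B\<close> as \<open>A\<close>, and
  \<open>A\<close> is cancelled.\<close>

lemma inversion_factor_double:
  assumes y: "y \<in> smooth_loops" and z: "z \<in> smooth_loops" and w: "w \<noteq> 0"
    and eq: "F (LC_scale w y) = sc \<theta> (B (F (LC_scale (1 / w) z)))"
  shows "F (LC_scale (2 * w) y) = sc (K * \<theta>) (B (F (LC_scale (1 / (2 * w)) z)))"
proof -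
  let ?u = "F (LC_scale (2 * w) y)" and ?v = "F (LC_scale (1 / (2 * w)) z)"
  have u: "?u \<in> E" and v: "?v \<in> E" using y z by (auto intro: F_E smooth_loops_scale)
  have h1: "LC_scale (1/2) (LC_scale (2 * w) y) = LC_scale w y" by (simp add: LC_scale_scale)
  have h2: "LC_scale (1/2) (LC_scale (1 / w) z) = LC_scale (1 / (2 * w)) z" by (simp add: LC_scale_scale)
  have "A ?u = sc \<alpha> (F (LC_scale w y))"
    using F_half(1)[OF smooth_loops_scale[OF y, of "2 * w"]] unfolding h1 .
  also have "\<dots> = sc (\<alpha> * \<theta>) (B (F (LC_scale (1 / w) z)))" unfolding eq by simp
  also have "F (LC_scale (1 / w) z) = sc \<alpha> (Ai ?v)"
    using F_half(2)[OF smooth_loops_scale[OF z, of "1 / w"]] unfolding h2 by simp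
  also have "sc (\<alpha> * \<theta>) (B (sc \<alpha> (Ai ?v))) = sc (K * \<theta>) (A (B ?v))"
    using v by (simp add: B_scale Ai_E BA K_def power2_eq_square mult_ac)
  also have "\<dots> = A (sc (K * \<theta>) (B ?v))" using v by (simp add: A_scale B_E)
  finally have "Ai (A ?u) = Ai (A (sc (K * \<theta>) (B ?v)))" by simp
  then show ?thesis using u v by (simp add: Ai_A B_E E_scale)
qed

lemma exists_functional:
  assumes "v \<in> E" "v \<noteq> 0" obtains \<mu> where "\<mu> \<in> L" "\<mu> v \<noteq> 0"
  using L_sep assms by blast

text \<open>As the loop \<open>w y\<close> runs to infinity its inverse runs to \<open>0\<close>, and the comparison factor between
  the two germs satisfies \<open>\<theta>(2 w) = K \<theta>(w)\<close> with \<open>K\<close> independent of the loop.  This bounds the degree.\<close>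

lemma polynomial_growth:
  obtains n :: nat where "\<And>y z \<mu>. y \<in> smooth_loops \<Longrightarrow> z \<in> smooth_loops \<Longrightarrow> (\<And>t. y t * z t = 1) \<Longrightarrow> \<mu> \<in> L \<Longrightarrow>
    \<exists>C. \<forall>w. 1 \<le> cmod w \<longrightarrow> cmod (\<mu> (F (LC_scale w y))) \<le> C * cmod w ^ n"
proof -
  \<comment> \<open>\<open>n\<close> is determined by \<open>K\<close> alone, before any loop is
    chosen.\<close>
  obtain n where n: "cmod K < 2 ^ n" using real_arch_pow[of 2 "cmod K"] by auto
  have "\<exists>C. \<forall>w. 1 \<le> cmod w \<longrightarrow> cmod (\<mu> (F (LC_scale w y))) \<le> C * cmod w ^ n"
    if y: "y \<in> smooth_loops" and z: "z \<in> smooth_loops" and inv: "\<And>t. y t * z t = 1" and L: "\<mu> \<in> L" for y z \<mu>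
  proof -
    let ?G = "\<lambda>w. B (F (LC_scale (1 / w) z))"
    have GE: "?G w \<in> E" for w by (intro B_E F_E smooth_loops_scale z)
    have G0: "?G w \<noteq> 0" for w
      using B_inj[OF F_E[OF smooth_loops_scale[OF z]]] F_line(2)[OF smooth_loops_scale[OF z]] by blast
    have "\<forall>w. \<exists>\<theta>. w \<noteq> 0 \<longrightarrow> \<theta> \<noteq> 0 \<and> F (LC_scale w y) = sc \<theta> (?G w)"
      using inversion_factor[OF y z inv] by blast
    then obtain \<theta> where "\<forall>w. w \<noteq> 0 \<longrightarrow> \<theta> w \<noteq> 0 \<and> F (LC_scale w y) = sc (\<theta> w) (?G w)"
      by (rule choice[THEN exE])
    then have \<theta>: "F (LC_scale w y) = sc (\<theta> w) (?G w)" if "w \<noteq> 0" for w using that by blast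
    have dbl: "\<theta> (2 * w) = K * \<theta> w" if w: "w \<noteq> 0" for w
    proof -
      have "sc (\<theta> (2 * w)) (?G (2 * w)) = sc (K * \<theta> w) (?G (2 * w))"
        using inversion_factor_double[OF y z w \<theta>[OF w]] \<theta>[of "2 * w"] w by simp
      then show ?thesis using G0[of "2 * w"] by (simp only: scale_cancel_right) blast
    qed
    have contF: "isCont (\<lambda>w. \<nu> (F (LC_scale w y))) w" if "\<nu> \<in> L" for \<nu> w
      using holomorphic_on_imp_continuous_on[OF F_ray[OF y that]] by (simp add: continuous_on_eq_continuous_at)
    have contG: "isCont (\<lambda>w. \<nu> (?G w)) w" if "\<nu> \<in> L" "w \<noteq> 0" for \<nu> w
    proof -
      have "isCont (\<lambda>u. \<nu> (B (F (LC_scale u z)))) (1 / w)"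
        using holomorphic_on_imp_continuous_on[OF F_ray[OF z L_B[OF that(1)]]]
        by (simp add: continuous_on_eq_continuous_at)
      moreover have "isCont (\<lambda>w. 1 / w) w" using that(2) by (intro continuous_intros)
      ultimately show ?thesis by (rule isCont_o2[rotated])
    qed
    \<comment> \<open>\<open>\<theta>\<close> results from a choice, but near a given point it is a
      quotient of continuous scalar functions, for a functional \<open>\<nu>\<close> adapted to that
      point.\<close>
    have "isCont \<theta> w" if w: "w \<noteq> 0" for w
    proof -
      obtain \<nu> where \<nu>: "\<nu> \<in> L" "\<nu> (?G w) \<noteq> 0" using exists_functional[OF GE G0] by blast
      have q: "isCont (\<lambda>w. \<nu> (F (LC_scale w y)) / \<nu> (?G w)) w"
        by (rule isCont_divide[OF contF[OF \<nu>(1)] contG[OF \<nu>(1) w] \<nu>(2)])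
      have "((\<lambda>w. \<nu> (?G w)) \<longlongrightarrow> \<nu> (?G w)) (nhds w)"
        using contG[OF \<nu>(1) w] unfolding isCont_def
        by (rule tendsto_at_iff_tendsto_nhds[where g = "\<lambda>w. \<nu> (?G w)", THEN iffD1])
      then have "\<forall>\<^sub>F u in nhds w. \<nu> (?G u) \<noteq> 0"
        by (rule tendsto_imp_eventually_ne[OF _ \<nu>(2)])
      moreover have "\<forall>\<^sub>F u in nhds w. u \<noteq> 0" using w by (rule t1_space_nhds)
      ultimately have "\<forall>\<^sub>F u in nhds w. \<nu> (F (LC_scale u y)) / \<nu> (?G u) = \<theta> u"
      proof eventually_elim
        case (elim u)
        then show ?case unfolding \<theta>[OF elim(2)] by (simp add: L_scale[OF \<nu>(1) GE])
      qed
      from iffD1[OF isCont_cong[OF this] q] show ?thesis .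
    qed
    moreover have "w \<noteq> 0" if "w \<in> cball 0 2 - ball 0 1" for w :: complex using that by auto
    ultimately have "continuous_on (cball 0 2 - ball 0 1) \<theta>"
      by (intro continuous_at_imp_continuous_on ballI) blast
    moreover have "compact (cball 0 2 - ball 0 1 :: complex set)" by (intro compact_diff) auto
    ultimately have "compact (\<theta> ` (cball 0 2 - ball 0 1))" by (intro compact_continuous_image) simp_all
    then obtain M0 where M0: "\<forall>x\<in>\<theta> ` (cball 0 2 - ball 0 1). cmod x \<le> M0"
      using compact_imp_bounded bounded_iff by blast
    have M: "cmod (\<theta> w) \<le> \<bar>M0\<bar>" if "1 \<le> cmod w" "cmod w \<le> 2" for w
    proof -
      have "\<theta> w \<in> \<theta> ` (cball 0 2 - ball 0 1)" by (rule imageI) (use that in simp)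
      with M0 have "cmod (\<theta> w) \<le> M0" by (rule bspec)
      then show ?thesis by linarith
    qed
    \<comment> \<open>Compactness bounds \<open>\<theta>\<close> on the annulus between radii 1 and
      2; beyond it each doubling costs a factor of modulus below \<open>2 ^ n\<close>, which is the
      growth of \<open>cmod w ^ n\<close>.\<close>
    have growth: "1 \<le> cmod w \<Longrightarrow> cmod w \<le> 2 ^ Suc j \<Longrightarrow> cmod (\<theta> w) \<le> \<bar>M0\<bar> * cmod w ^ n" for w j
    proof (induction j arbitrary: w)
      case 0
      then have "cmod (\<theta> w) \<le> \<bar>M0\<bar> * 1" using M[of w] by simp
      also have "\<dots> \<le> \<bar>M0\<bar> * cmod w ^ n" using 0 by (intro mult_left_mono one_le_power) auto
      finally show ?case .
    next
      case (Suc j)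
      show ?case
      proof (cases "cmod w \<le> 2 ^ Suc j")
        case True
        then show ?thesis using Suc by blast
      next
        case False
        have p: "(1::real) \<le> 2 ^ j" by simp
        have "2 < cmod w" using False p unfolding not_le power_Suc by linarith
        then have w2: "1 \<le> cmod (w / 2)" "cmod (w / 2) \<le> 2 ^ Suc j" "w / 2 \<noteq> 0"
          using Suc.prems(2) by (auto simp: norm_divide)
        have "cmod (\<theta> w) = cmod K * cmod (\<theta> (w / 2))"
          using dbl[OF w2(3)] by (simp add: norm_mult)
        also have "\<dots> \<le> 2 ^ n * (\<bar>M0\<bar> * cmod (w / 2) ^ n)"
          using n by (intro mult_mono Suc.IH w2) auto
        also have "\<dots> = \<bar>M0\<bar> * cmod w ^ n" by (simp add: norm_divide power_divide)
        finally show ?thesis .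
      qed
    qed
    \<comment> \<open>For large \<open>w\<close> the inverse loop stays in the unit disc of its ray,
      so the other factor is bounded.\<close>
    have "continuous_on (cball 0 1) (\<lambda>u. \<mu> (B (F (LC_scale u z))))"
      by (rule continuous_on_subset[OF holomorphic_on_imp_continuous_on[OF F_ray[OF z L_B[OF L]]]]) simp
    then have "compact ((\<lambda>u. \<mu> (B (F (LC_scale u z)))) ` cball 0 1)"
      by (rule compact_continuous_image) simp
    then obtain M1 where M1: "\<forall>x\<in>(\<lambda>u. \<mu> (B (F (LC_scale u z)))) ` cball 0 1. cmod x \<le> M1"
      using compact_imp_bounded bounded_iff by blast
    show ?thesis
    proof (intro exI allI impI)
      fix w assume w: "1 \<le> cmod w"
      then have w0: "w \<noteq> 0" by auto
      obtain j where "cmod w < 2 ^ j" using real_arch_pow[of 2 "cmod w"] by auto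
      also have "\<dots> \<le> 2 ^ Suc j" by simp
      finally have j: "cmod w \<le> 2 ^ Suc j" by simp
      have m1: "cmod (\<mu> (?G w)) \<le> M1"
        using bspec[OF M1, OF imageI, of "1 / w"] w by (simp add: norm_divide divide_le_eq_1)
      have "cmod (\<mu> (F (LC_scale w y))) = cmod (\<theta> w) * cmod (\<mu> (?G w))"
        unfolding \<theta>[OF w0] L_scale[OF L GE] by (rule norm_mult)
      also have "\<dots> \<le> (\<bar>M0\<bar> * cmod w ^ n) * M1"
        by (intro mult_mono growth[OF w j] m1) auto
      finally show "cmod (\<mu> (F (LC_scale w y))) \<le> (\<bar>M0\<bar> * M1) * cmod w ^ n" by (simp add: mult_ac)
    qed
  qed
  then show ?thesis using that by blast
qed

end

section \<open>Affine circle loops and sums over roots of unity\<close>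

lemma smooth_loops_circle_inverse:
  assumes "cmod a \<noteq> cmod b"
  shows "(\<lambda>t. a + b * cis (2 * pi * t)) \<in> smooth_loops" "(\<lambda>t. inverse (a + b * cis (2 * pi * t))) \<in> smooth_loops"
    "a + b * cis (2 * pi * t) \<noteq> 0"
proof -
  show 1: "(\<lambda>t. a + b * cis (2 * pi * t)) \<in> smooth_loops" by (rule smooth_loops_affine)
  show nz: "a + b * cis (2 * pi * t) \<noteq> 0" for t
  proof
    assume "a + b * cis (2 * pi * t) = 0"
    then have "a = - (b * cis (2 * pi * t))" by (simp add: eq_neg_iff_add_eq_0)
    then have "cmod a = cmod b" by (simp add: norm_mult)
    then show False using assms by simp
  qed
  show "(\<lambda>t. inverse (a + b * cis (2 * pi * t))) \<in> smooth_loops"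
    by (rule smooth_loops_inverse[OF 1 nz])
qed

lemma sum_root_unity_powers:
  assumes "0 < q" "q < M"
  shows "(\<Sum>i<M. (cis (2 * pi * real q / real M)) ^ i) = 0"
proof -
  let ?\<theta> = "2 * pi * real q / real M"
  have M: "0 < real M" using assms by simp
  \<comment> \<open>Half of the angle: it lies strictly between 0 and pi, so its sine is positive
    and the cosine of the full angle is below 1.\<close>
  define x where "x = pi * (real q / real M)"
  have \<theta>: "?\<theta> = 2 * x" by (simp add: x_def)
  have "0 < x" using assms M by (simp add: x_def)
  moreover have "x < pi * 1"
    unfolding x_def using assms M by (intro mult_strict_left_mono) auto
  ultimately have "0 < sin x" by (intro sin_gt_zero) auto
  then have "cos ?\<theta> < 1" unfolding \<theta> cos_double_sin by simp
  then have ne: "cis ?\<theta> \<noteq> 1" by (auto simp: complex_eq_iff)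
  have "cis ?\<theta> ^ M = cis (real M * ?\<theta>)" by (rule Complex.DeMoivre)
  also have "real M * ?\<theta> = 2 * pi * real q" using M by simp
  also have "cis (2 * pi * real q) = 1" using cis_multiple_2pi[of "real q"] by simp
  finally show ?thesis using geometric_sum[OF ne, of M] by simp
qed

lemma root_unity_power: "cis (2 * pi / real M) ^ q = cis (2 * pi * real q / real M)"
  unfolding Complex.DeMoivre by (rule arg_cong[of _ _ cis]) simp

text \<open>The monomial of degree \<open>k\<close> contributes the sum of the powers of
  \<open>\<omega> ^ Suc k\<close>, which vanishes for exponents strictly between 0 and
  \<open>n + 2\<close>. The weight \<open>\<omega> ^ i\<close> shifts the exponent by one and so
  also removes the constant term; this is why n + 2 points are taken.\<close>

lemma polynomial_annihilator:
  fixes c :: "nat \<Rightarrow> complex" and n :: nat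
  defines "\<omega> \<equiv> cis (2 * pi / real (n + 2))"
  shows "(\<Sum>i<n + 2. \<omega> ^ i * (\<Sum>k\<le>n. c k * (\<omega> ^ i / 2) ^ k)) = 0"
proof -
  have "(\<Sum>i<n + 2. \<omega> ^ i * (\<Sum>k\<le>n. c k * (\<omega> ^ i / 2) ^ k))
      = (\<Sum>i<n + 2. \<Sum>k\<le>n. c k / 2 ^ k * (\<omega> ^ Suc k) ^ i)"
    unfolding sum_distrib_left
  proof (intro sum.cong refl)
    fix i k
    have "\<omega> ^ i * (\<omega> ^ i) ^ k = (\<omega> ^ Suc k) ^ i"
      by (simp add: power_mult_distrib flip: power_mult) (simp add: mult.commute)
    then show "\<omega> ^ i * (c k * (\<omega> ^ i / 2) ^ k) = c k / 2 ^ k * (\<omega> ^ Suc k) ^ i"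
      by (simp add: power_divide mult_ac)
  qed
  also have "\<dots> = (\<Sum>k\<le>n. \<Sum>i<n + 2. c k / 2 ^ k * (\<omega> ^ Suc k) ^ i)" by (rule sum.swap)
  also have "\<dots> = (\<Sum>k\<le>n. c k / 2 ^ k * (\<Sum>i<n + 2. (\<omega> ^ Suc k) ^ i))" by (simp only: sum_distrib_left)
  also have "\<dots> = 0"
  proof (rule sum.neutral, rule ballI)
    fix k assume k: "k \<in> {..n}"
    have "\<omega> ^ Suc k = cis (2 * pi * real (Suc k) / real (n + 2))"
      unfolding \<omega>_def by (rule root_unity_power)
    then have "(\<Sum>i<n + 2. (\<omega> ^ Suc k) ^ i) = 0"
      using sum_root_unity_powers[of "Suc k" "n + 2"] k by (simp only:) simp
    then show "c k / 2 ^ k * (\<Sum>i<n + 2. (\<omega> ^ Suc k) ^ i) = 0" by simp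
  qed
  finally show ?thesis .
qed

section \<open>A linear relation between values of the lift\<close>

context equivariant_germ
begin

abbreviation circle_loop :: "complex \<times> complex \<Rightarrow> real \<Rightarrow> complex"
  where "circle_loop \<equiv> loop_comb (\<lambda>t. 1) (\<lambda>t. cis (2 * pi * t))"

lemma circle_loop_eq: "circle_loop (a, b) = (\<lambda>t. a + b * cis (2 * pi * t))"
  by (simp add: loop_comb_def)

lemma one_smooth: "(\<lambda>t. 1) \<in> smooth_loops" and cis_smooth: "(\<lambda>t. cis (2 * pi * t)) \<in> smooth_loops"
  using smooth_loops_affine[of 1 0] smooth_loops_affine[of 0 1] by simp_all

lemma circle_loop_smooth: "circle_loop c \<in> smooth_loops"
  by (rule loop_comb_smooth[OF one_smooth cis_smooth])

text \<open>The growth estimate concerns rays, and its constant depends on the loop. Writing 1 + s h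
  as s times (1/s + h) puts the point on the ray through (1/s, 1), which moves with s but stays in a
  compact family; a bound uniform over this family is therefore required.\<close>

lemma F_circle_loop_polynomial:
  obtains n :: nat where "\<And>\<mu> u. \<mu> \<in> L \<Longrightarrow>
    \<exists>c. \<forall>s. \<mu> (F (circle_loop (u, u * s))) = (\<Sum>k\<le>n. c k * s ^ k)"
proof -
  obtain n where n: "\<And>y z \<mu>. y \<in> smooth_loops \<Longrightarrow> z \<in> smooth_loops \<Longrightarrow> (\<And>t. y t * z t = 1) \<Longrightarrow> \<mu> \<in> L \<Longrightarrow>
    \<exists>C. \<forall>w. 1 \<le> cmod w \<longrightarrow> cmod (\<mu> (F (LC_scale w y))) \<le> C * cmod w ^ n"
    using polynomial_growth by blast
  have "\<exists>c. \<forall>s. \<mu> (F (circle_loop (u, u * s))) = (\<Sum>k\<le>n. c k * s ^ k)" if L: "\<mu> \<in> L" for \<mu> u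
  proof (cases "u = 0")
    case True
    show ?thesis
    proof (intro exI allI)
      fix s
      show "\<mu> (F (circle_loop (u, u * s))) = (\<Sum>k\<le>n. (if k = 0 then \<mu> (F (circle_loop (0, 0))) else 0) * s ^ k)"
        using True by (simp add: if_distrib[of "\<lambda>x. x * _"] sum.delta cong: if_cong)
    qed
  next
    case False
    let ?G = "\<lambda>c. \<mu> (F (circle_loop c))"
    have cG: "continuous_on UNIV ?G" by (rule F_continuous[OF one_smooth cis_smooth L])
    have "compact (?G ` cball 0 2)" by (rule compact_continuous_image[OF continuous_on_subset[OF cG]]) simp_all
    then obtain M where M: "\<forall>x\<in>?G ` cball 0 2. cmod x \<le> M" using compact_imp_bounded bounded_iff by blast
    have ray: "cmod (?G (\<tau> * a, \<tau>)) \<le> (real n + 1) * \<bar>M\<bar> * cmod \<tau> ^ n" if a: "cmod a \<le> 1/2" and \<tau>: "1 \<le> cmod \<tau>" for a \<tau>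
    proof -
      let ?g = "\<lambda>\<tau>. \<mu> (F (LC_scale \<tau> (circle_loop (a, 1))))"
      have ab: "cmod a \<noteq> cmod 1" using a by simp
      have gG: "?g \<tau> = ?G (\<tau> * a, \<tau>)" for \<tau> by (simp add: loop_comb_scale)
      have hol: "?g holomorphic_on UNIV" by (rule F_ray[OF circle_loop_smooth L])
      have inv1: "circle_loop (a, 1) t * inverse (a + 1 * cis (2 * pi * t)) = 1" for t
        unfolding circle_loop_eq by (rule right_inverse[OF smooth_loops_circle_inverse(3)[OF ab]])
      obtain C where C: "\<forall>w. 1 \<le> cmod w \<longrightarrow> cmod (?g w) \<le> C * cmod w ^ n"
        using n[OF circle_loop_smooth smooth_loops_circle_inverse(2)[OF ab] inv1 L] by blast
      have poly: "?g \<tau> = (\<Sum>k\<le>n. (deriv ^^ k) ?g 0 / fact k * \<tau> ^ k)" for \<tau>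
        by (rule Liouville_polynomial[OF hol, of 1 C]) (use C in blast)
      \<comment> \<open>\<open>C\<close> above depends on \<open>a\<close>, so only the degree is
        kept. Cauchy estimates on the unit circle bound the coefficients by \<open>M\<close>,
        uniformly in \<open>a\<close>, since the points involved stay in the ball of radius
        2.\<close>
      have coef: "cmod ((deriv ^^ k) ?g 0 / fact k) \<le> \<bar>M\<bar>" for k
      proof -
        have "cmod ((deriv ^^ k) ?g 0) \<le> fact k * \<bar>M\<bar> / 1 ^ k"
        proof (rule Cauchy_inequality)
          show "?g holomorphic_on ball 0 1" by (rule holomorphic_on_subset[OF hol]) simp
          show "continuous_on (cball 0 1) ?g"
            by (rule holomorphic_on_imp_continuous_on[OF holomorphic_on_subset[OF hol]]) simp
          fix x :: complex assume "cmod (0 - x) = 1"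
          then have "norm (x * a, x) \<le> 2"
            using a norm_Pair_le[of "x * a" x] by (simp add: norm_mult)
          then have "(x * a, x) \<in> cball 0 2" by simp
          from bspec[OF M imageI[OF this]] show "cmod (?g x) \<le> \<bar>M\<bar>" unfolding gG by linarith
        qed simp
        then show ?thesis by (simp add: norm_divide divide_le_eq mult.commute)
      qed
      have "cmod (?g \<tau>) \<le> (\<Sum>k\<le>n. cmod ((deriv ^^ k) ?g 0 / fact k * \<tau> ^ k))"
        unfolding poly[of \<tau>] by (rule norm_sum)
      also have "\<dots> \<le> (\<Sum>k\<le>n. \<bar>M\<bar> * cmod \<tau> ^ n)"
      proof (rule sum_mono)
        fix k assume k: "k \<in> {..n}"
        show "cmod ((deriv ^^ k) ?g 0 / fact k * \<tau> ^ k) \<le> \<bar>M\<bar> * cmod \<tau> ^ n"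
          unfolding norm_mult norm_power using k \<tau> coef[of k]
          by (intro mult_mono power_increasing) auto
      qed
      also have "\<dots> = (real n + 1) * \<bar>M\<bar> * cmod \<tau> ^ n" by (simp add: algebra_simps)
      finally show ?thesis unfolding gG .
    qed
    let ?p = "\<lambda>s. ?G (u, u * s)"
    have hol: "?p holomorphic_on UNIV"
      using F_entire[OF one_smooth cis_smooth L, of u 0 0 u] by (simp add: mult.commute)
    have P: "?p s = (\<Sum>k\<le>n. (deriv ^^ k) ?p 0 / fact k * s ^ k)" for s
    proof (rule Liouville_polynomial[OF hol])
      \<comment> \<open>The threshold ensures that 1/s has modulus at most 1/2 and
        \<open>u * s\<close> modulus at least 1, as \<open>ray\<close> demands.\<close>
      fix s assume s: "max 2 (1 / cmod u) \<le> cmod s"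
      then have s0: "s \<noteq> 0" by auto
      have "cmod (1 / s) \<le> 1/2" using s frac_le[of 1 1 2 "cmod s"] by (simp add: norm_divide)
      moreover have "1 \<le> cmod (u * s)" using s False by (simp add: norm_mult field_simps)
      ultimately have "cmod (?G ((u * s) * (1 / s), u * s)) \<le> (real n + 1) * \<bar>M\<bar> * cmod (u * s) ^ n" by (rule ray)
      also have "(u * s) * (1 / s) = u" using s0 by simp
      also have "(real n + 1) * \<bar>M\<bar> * cmod (u * s) ^ n = ((real n + 1) * \<bar>M\<bar> * cmod u ^ n) * cmod s ^ n"
        by (simp add: norm_mult power_mult_distrib)
      finally show "cmod (?p s) \<le> ((real n + 1) * \<bar>M\<bar> * cmod u ^ n) * cmod s ^ n" .
    qed
    show ?thesis by (rule exI[of _ "\<lambda>k. (deriv ^^ k) ?p 0 / fact k"], rule allI, rule P)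
  qed
  then show ?thesis using that by blast
qed

lemma L_sum:
  assumes "\<mu> \<in> L" "finite I" "\<And>i. i \<in> I \<Longrightarrow> v i \<in> E"
  shows "\<mu> (\<Sum>i\<in>I. v i) = (\<Sum>i\<in>I. \<mu> (v i))" "(\<Sum>i\<in>I. v i) \<in> E"
proof -
  have "(\<Sum>i\<in>I. v i) \<in> E \<and> \<mu> (\<Sum>i\<in>I. v i) = (\<Sum>i\<in>I. \<mu> (v i))"
    using assms(2,3)
  proof (induction I rule: finite_induct)
    case empty
    show ?case using E_0 L_0[OF assms(1)] by simp
  next
    case (insert x I)
    then have "(\<Sum>i\<in>I. v i) \<in> E \<and> \<mu> (\<Sum>i\<in>I. v i) = (\<Sum>i\<in>I. \<mu> (v i))" "v x \<in> E" by simp_all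
    then show ?case using insert.hyps L_add[OF assms(1)] by (simp add: E_add)
  qed
  then show "\<mu> (\<Sum>i\<in>I. v i) = (\<Sum>i\<in>I. \<mu> (v i))" "(\<Sum>i\<in>I. v i) \<in> E" by blast+
qed

text \<open>The annihilating weights apply to the loops \<open>u (1 + s i h)\<close> for large
  \<open>u\<close>; inversion carries the relation to the inverse loops near 0. The comparison
  factors are \<open>K ^ j * \<theta> i\<close>, and the common \<open>K ^ j\<close> drops out, so
  the weights do not depend on \<open>j\<close>.\<close>

lemma relation_near_zero:
  "\<exists>(M::nat) W s. 0 < M \<and> inj_on s {..<M} \<and> (\<forall>i. W i \<noteq> 0) \<and> (\<forall>i. cmod (s i) = 1/2) \<and>
    (\<forall>\<mu>\<in>L. \<forall>j. (\<Sum>i<M. W i * \<mu> (F (LC_scale ((1/2) ^ j) (\<lambda>t. inverse (1 + s i * cis (2 * pi * t)))))) = 0)"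
proof -
  obtain n where n: "\<And>\<mu> u. \<mu> \<in> L \<Longrightarrow>
      \<exists>c. \<forall>s. \<mu> (F (circle_loop (u, u * s))) = (\<Sum>k\<le>n. c k * s ^ k)"
    using F_circle_loop_polynomial by blast
  define M where "M = n + 2"
  define \<omega> where "\<omega> = cis (2 * pi / real (M))"
  define s where "s i = \<omega> ^ i / 2" for i :: nat
  have \<omega>0: "\<omega> \<noteq> 0" by (simp add: \<omega>_def)
  have \<omega>1: "cmod \<omega> = 1" by (simp add: \<omega>_def)
  have s: "cmod (s i) = 1/2" for i by (simp add: s_def norm_divide norm_power \<omega>1)
  have inj: "inj_on s {..<M}"
  proof (rule inj_onI)
    fix i j assume ij: "i \<in> {..<M}" "j \<in> {..<M}" "s i = s j"
    have *: "a = b" if "a \<le> b" "b < M" "\<omega> ^ a = \<omega> ^ b" for a b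
    proof (rule ccontr)
      assume "a \<noteq> b"
      then have q: "0 < b - a" "b - a < M" using that by auto
      have "\<omega> ^ b = \<omega> ^ a * \<omega> ^ (b - a)" using that(1) by (simp flip: power_add)
      then have "\<omega> ^ (b - a) = 1" using that(3) \<omega>1 by auto
      moreover have "\<omega> ^ (b - a) = cis (2 * pi * real (b - a) / real (M))"
        unfolding \<omega>_def by (rule root_unity_power)
      ultimately have "(\<Sum>i<M. (1::complex) ^ i) = 0"
        using sum_root_unity_powers[OF q] by (simp only:)
      then have "of_nat (M) = (0::complex)" by (simp only: power_one sum_constant card_lessThan mult_1_right)
      then have "M = 0" by (simp only: of_nat_eq_0_iff)
      then show False by (simp add: M_def)
    qed
    have eq: "\<omega> ^ i = \<omega> ^ j" using ij(3) by (simp add: s_def)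
    have lt: "i < M" "j < M" using ij(1,2) by simp_all
    show "i = j"
    proof (cases "i \<le> j")
      case True
      then show ?thesis by (rule *[OF _ lt(2) eq])
    next
      case False
      then have "j \<le> i" by simp
      then show ?thesis by (rule *[OF _ lt(1) eq[symmetric], symmetric])
    qed
  qed
  let ?y = "\<lambda>i. circle_loop (1, s i)" and ?z = "\<lambda>i t. inverse (1 + s i * cis (2 * pi * t))"
  have y: "?y i \<in> smooth_loops" for i by (rule circle_loop_smooth)
  have ne: "cmod 1 \<noteq> cmod (s i)" for i by (simp add: s)
  have z: "?z i \<in> smooth_loops" for i by (rule smooth_loops_circle_inverse(2)[OF ne])
  have inv: "?y i t * ?z i t = 1" for i t
    unfolding circle_loop_eq by (rule right_inverse[OF smooth_loops_circle_inverse(3)[OF ne]])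
  have "\<exists>\<theta>. \<theta> \<noteq> 0 \<and> F (LC_scale 1 (?y i)) = sc \<theta> (B (F (LC_scale (1 / 1) (?z i))))" for i
    by (rule inversion_factor[OF y z inv]) simp
  then have "\<forall>i. \<exists>\<theta>. \<theta> \<noteq> 0 \<and> F (LC_scale 1 (?y i)) = sc \<theta> (B (F (LC_scale (1 / 1) (?z i))))" by blast
  then obtain \<theta> where "\<forall>i. \<theta> i \<noteq> 0 \<and> F (LC_scale 1 (?y i)) = sc (\<theta> i) (B (F (LC_scale (1 / 1) (?z i))))"
    by (rule choice[THEN exE])
  then have \<theta>: "\<theta> i \<noteq> 0" "F (LC_scale 1 (?y i)) = sc (\<theta> i) (B (F (LC_scale (1 / 1) (?z i))))" for i by blast+
  \<comment> \<open>Iterated doubling from \<open>u = 1\<close>: the accumulated factor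
    \<open>K ^ j\<close> is the same for all \<open>i\<close>.\<close>
  have pw: "F (LC_scale (2 ^ j) (?y i)) = sc (K ^ j * \<theta> i) (B (F (LC_scale (1 / 2 ^ j) (?z i))))" for i j
  proof (induction j)
    case 0
    show ?case using \<theta>(2) by (simp only: power_0 mult_1_left)
  next
    case (Suc j)
    have "F (LC_scale (2 * 2 ^ j) (?y i)) = sc (K * (K ^ j * \<theta> i)) (B (F (LC_scale (1 / (2 * 2 ^ j)) (?z i))))"
      by (rule inversion_factor_double[OF y z _ Suc]) simp
    then show ?case by (simp only: power_Suc mult.assoc)
  qed
  have rel: "(\<Sum>i<M. \<omega> ^ i * \<mu> (F (LC_scale u (?y i)))) = 0" if L: "\<mu> \<in> L" for \<mu> u
  proof -
    obtain c where c: "\<forall>s. \<mu> (F (circle_loop (u, u * s))) = (\<Sum>k\<le>n. c k * s ^ k)" using n[OF L] by blast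
    have "\<mu> (F (LC_scale u (?y i))) = (\<Sum>k\<le>n. c k * (\<omega> ^ i / 2) ^ k)" for i
      using c[rule_format, of "s i"] by (simp only: loop_comb_scale fst_conv snd_conv mult_1_right s_def)
    then show ?thesis using polynomial_annihilator[of n c, folded M_def] by (simp only: \<omega>_def)
  qed
  have final: "(\<Sum>i<M. (\<omega> ^ i * \<theta> i) * \<mu> (F (LC_scale ((1/2) ^ j) (?z i)))) = 0" if L: "\<mu> \<in> L" for \<mu> j
  proof -
    let ?v = "\<lambda>i. F (LC_scale (1 / 2 ^ j) (?z i))"
    have vE: "?v i \<in> E" for i by (rule F_E[OF smooth_loops_scale[OF z]])
    let ?S = "\<Sum>i<M. sc (\<omega> ^ i * \<theta> i) (?v i)"
    have SE: "?S \<in> E" by (rule L_sum(2)[OF L]) (simp_all add: E_scale vE)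
    \<comment> \<open>Injectivity of \<open>B\<close> applies to vectors, so the scalar relations
      are first assembled into one vector identity by separation.\<close>
    have "B ?S = 0"
    proof (rule L_sep[OF B_E[OF SE]])
      fix \<nu> assume \<nu>: "\<nu> \<in> L"
      have "\<nu> (B ?S) = (\<Sum>i<M. \<nu> (B (sc (\<omega> ^ i * \<theta> i) (?v i))))"
        by (rule L_sum(1)[OF L_B[OF \<nu>]]) (simp_all add: E_scale vE)
      also have "\<dots> = (\<Sum>i<M. (\<omega> ^ i * \<theta> i) * \<nu> (B (?v i)))"
        by (simp add: B_scale vE L_scale[OF \<nu>] B_E)
      finally have "K ^ j * \<nu> (B ?S) = (\<Sum>i<M. \<omega> ^ i * \<nu> (F (LC_scale (2 ^ j) (?y i))))"
        unfolding pw L_scale[OF \<nu> B_E[OF vE]] by (simp add: sum_distrib_left mult_ac)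
      also have "\<dots> = 0" by (rule rel[OF \<nu>])
      finally show "\<nu> (B ?S) = 0" using K_nonzero by simp
    qed
    then have "?S = 0" by (rule B_inj[OF SE])
    then have "\<mu> ?S = 0" using L_0[OF L] by simp
    moreover have "\<mu> ?S = (\<Sum>i<M. \<mu> (sc (\<omega> ^ i * \<theta> i) (?v i)))"
      by (rule L_sum(1)[OF L]) (simp_all add: E_scale vE)
    ultimately show ?thesis by (simp add: L_scale[OF L vE] power_one_over)
  qed
  show ?thesis
  proof (rule exI[of _ M], rule exI[of _ "\<lambda>i. \<omega> ^ i * \<theta> i"], rule exI[of _ s], intro conjI allI ballI)
    show "(\<Sum>i<M. (\<omega> ^ i * \<theta> i) * \<mu> (F (LC_scale ((1/2) ^ j) (?z i)))) = 0" if "\<mu> \<in> L" for \<mu> j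
      by (rule final[OF that])
    show "0 < M" by (simp add: M_def)
    show "inj_on s {..<M}" by (rule inj)
    show "\<omega> ^ i * \<theta> i \<noteq> 0" for i
      unfolding mult_eq_0_iff de_Morgan_disj by (intro conjI power_not_zero \<omega>0 \<theta>(1))
    show "cmod (s i) = 1/2" for i by (rule s)
  qed
qed

text \<open>On \<open>N\<close> the vector \<open>F y\<close> is \<open>l (F y)\<close> times
  \<open>f y\<close>. The relation for \<open>l\<close> thus cancels the constant term in the
  relation for \<open>\<mu>\<close>, and the coefficients \<open>l (F y)\<close> tend to 1 as
  \<open>y\<close> shrinks to 0. The limits \<open>d\<close> are hypotheses because the germ is
  known only through its scalar functions; the embedding supplies them later as values of its
  differential.\<close>

lemma first_order_relation:
  "\<exists>(M::nat) W s. 0 < M \<and> inj_on s {..<M} \<and> (\<forall>i. W i \<noteq> 0) \<and> (\<forall>i. cmod (s i) = 1/2) \<and>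
    (\<forall>\<mu>\<in>L. \<forall>d. (\<forall>i. (\<lambda>j. 2 ^ j * (\<mu> (f (LC_scale ((1/2) ^ j) (\<lambda>t. inverse (1 + s i * cis (2 * pi * t)))))
        - \<mu> (f (\<lambda>t. 0)))) \<longlonglongrightarrow> d i) \<longrightarrow> (\<Sum>i<M. W i * d i) = 0)"
proof -
  obtain M :: nat and W s where M: "0 < M" and inj: "inj_on s {..<M}"
    and W: "\<forall>i. W i \<noteq> 0" and s: "\<forall>i. cmod (s i) = 1/2"
    and R: "\<forall>\<mu>\<in>L. \<forall>j. (\<Sum>i<M. W i * \<mu> (F (LC_scale ((1/2) ^ j) (\<lambda>t. inverse (1 + s i * cis (2 * pi * t)))))) = 0"
    using relation_near_zero by (elim exE conjE)
  let ?z = "\<lambda>i t. inverse (1 + s i * cis (2 * pi * t))"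
  have z: "?z i \<in> smooth_loops" for i
    by (rule smooth_loops_circle_inverse(2)) (simp add: s)
  have ev: "\<forall>\<^sub>F j in sequentially. LC_scale ((1/2) ^ j) (?z i) \<in> N" for i
  proof -
    obtain k where k: "LC_scale ((1/2) ^ k) (?z i) \<in> N" using level[OF z] by blast
    have "LC_scale ((1/2) ^ j) (?z i) \<in> N" if "k \<le> j" for j
      using that by (induction j rule: dec_induct) (use k F_at_Suc(1) in blast)+
    then show ?thesis unfolding eventually_sequentially by blast
  qed
  have FN: "\<mu> (F y) = l (F y) * \<mu> (f y)" if L: "\<mu> \<in> L" and y: "y \<in> N" for \<mu> y
  proof -
    have y0: "LC_scale ((1/2) ^ 0) y = y" by (simp add: LC_scale_1)
    have Fy: "F y = sc (P y) (f y)" using F_eq[of 0 y] y unfolding y0 F_at_def by simp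
    have fE: "f y \<in> E" by (rule f_E[OF N_D[OF y]])
    show ?thesis unfolding Fy L_scale[OF L fE] L_scale[OF l_L fE] f_l[OF N_D[OF y]] by simp
  qed
  have lim1: "(\<lambda>j. l (F (LC_scale ((1/2) ^ j) (?z i)))) \<longlonglongrightarrow> 1" for i
  proof -
    have "isCont (\<lambda>w. l (F (LC_scale w (?z i)))) 0"
      using holomorphic_on_imp_continuous_on[OF F_ray[OF z l_L]] by (simp add: continuous_on_eq_continuous_at)
    moreover have "(\<lambda>j. (1/2 :: complex) ^ j) \<longlonglongrightarrow> 0" by (rule LIMSEQ_power_zero) simp
    ultimately have "(\<lambda>j. l (F (LC_scale ((1/2) ^ j) (?z i)))) \<longlonglongrightarrow> l (F (LC_scale 0 (?z i)))"
      by (rule isCont_tendsto_compose)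
    moreover have "LC_scale 0 (?z i) = (\<lambda>t. 0)" by (simp add: LC_scale_def)
    ultimately show ?thesis using F_0 f_l[OF D_0] by (simp only:)
  qed
  have rel: "(\<Sum>i<M. W i * d i) = 0"
    if L: "\<mu> \<in> L" and d: "\<And>i. (\<lambda>j. 2 ^ j * (\<mu> (f (LC_scale ((1/2) ^ j) (?z i))) - \<mu> (f (\<lambda>t. 0)))) \<longlonglongrightarrow> d i" for \<mu> d
  proof -
    let ?c = "\<lambda>i j. l (F (LC_scale ((1/2) ^ j) (?z i)))"
    let ?q = "\<lambda>i j. 2 ^ j * (\<mu> (f (LC_scale ((1/2) ^ j) (?z i))) - \<mu> (f (\<lambda>t. 0)))"
    have "(\<lambda>j. \<Sum>i<M. W i * (?c i j * ?q i j)) \<longlonglongrightarrow> (\<Sum>i<M. W i * (1 * d i))"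
      by (intro tendsto_sum tendsto_mult tendsto_const lim1 d)
    moreover have "\<forall>\<^sub>F j in sequentially. (\<Sum>i<M. W i * (?c i j * ?q i j)) = 0"
    proof -
      have "\<forall>\<^sub>F j in sequentially. \<forall>i\<in>{..<M}. LC_scale ((1/2) ^ j) (?z i) \<in> N"
        by (rule eventually_ball_finite) (simp_all add: ev)
      then show ?thesis
      proof (rule eventually_mono)
        fix j assume j: "\<forall>i\<in>{..<M}. LC_scale ((1/2) ^ j) (?z i) \<in> N"
        \<comment> \<open>Splits into the relation for \<open>\<mu>\<close> and the constant
          \<open>\<mu> (f (\<lambda>t. 0))\<close> times the relation for \<open>l\<close>; both
          vanish.\<close>
        have "(\<Sum>i<M. W i * (?c i j * ?q i j)) =
            2 ^ j * ((\<Sum>i<M. W i * (?c i j * \<mu> (f (LC_scale ((1/2) ^ j) (?z i))))) - \<mu> (f (\<lambda>t. 0)) * (\<Sum>i<M. W i * ?c i j))"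
          by (simp add: sum_distrib_left sum_subtractf algebra_simps)
        also have "(\<Sum>i<M. W i * (?c i j * \<mu> (f (LC_scale ((1/2) ^ j) (?z i))))) =
            (\<Sum>i<M. W i * \<mu> (F (LC_scale ((1/2) ^ j) (?z i))))"
        proof (rule sum.cong[OF refl])
          fix i assume "i \<in> {..<M}"
          with j have "LC_scale ((1/2) ^ j) (?z i) \<in> N" by (rule bspec)
          from FN[OF L this] show "W i * (?c i j * \<mu> (f (LC_scale ((1/2) ^ j) (?z i)))) =
              W i * \<mu> (F (LC_scale ((1/2) ^ j) (?z i)))" by simp
        qed
        also have "\<dots> = 0" by (rule R[rule_format, OF L])
        also have "(\<Sum>i<M. W i * ?c i j) = 0" by (rule R[rule_format, OF l_L])
        finally show "(\<Sum>i<M. W i * (?c i j * ?q i j)) = 0" by simp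
      qed
    qed
    ultimately have "(\<lambda>j. 0) \<longlonglongrightarrow> (\<Sum>i<M. W i * (1 * d i))" by (rule Lim_transform_eventually)
    then show ?thesis by (simp add: LIMSEQ_const_iff)
  qed
  show ?thesis
  proof (rule exI[of _ M], rule exI[of _ W], rule exI[of _ s], intro conjI ballI allI impI M inj W[rule_format] s[rule_format])
    fix \<mu> d
    assume "\<mu> \<in> L" and d: "\<forall>i. (\<lambda>j. 2 ^ j * (\<mu> (f (LC_scale ((1/2) ^ j) (?z i))) - \<mu> (f (\<lambda>t. 0)))) \<longlonglongrightarrow> d i"
    then show "(\<Sum>i<M. W i * d i) = 0" by (intro rel[where \<mu> = \<mu> and d = d] d[rule_format])
  qed
qed

end

section \<open>Gateaux derivatives and partial fractions\<close>

lemma has_vector_derivative_from_quotient: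
  fixes f :: "real \<Rightarrow> 'a::real_normed_vector"
  assumes "((\<lambda>h. (f (t + h) - f t) /\<^sub>R h) \<longlongrightarrow> v) (at 0)"
  shows "(f has_vector_derivative v) (at t)"
  unfolding has_vector_derivative_def has_derivative_at
proof
  show "bounded_linear (\<lambda>x. x *\<^sub>R v)" by (rule bounded_linear_scaleR_left)
  have "((\<lambda>h. norm ((f (t + h) - f t) /\<^sub>R h - v)) \<longlongrightarrow> 0) (at 0)"
    by (rule tendsto_norm_zero[OF LIM_zero[OF assms]])
  moreover have "norm ((f (t + h) - f t) /\<^sub>R h - v) = norm (f (t + h) - f t - h *\<^sub>R v) / norm h" if "h \<noteq> 0" for h
  proof -
    have "f (t + h) - f t - h *\<^sub>R v = h *\<^sub>R ((f (t + h) - f t) /\<^sub>R h - v)"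
      using that by (simp add: scaleR_diff_right)
    then show ?thesis using that by (simp only: norm_scaleR real_norm_def) simp
  qed
  then have "\<forall>\<^sub>F h in at 0. norm ((f (t + h) - f t) /\<^sub>R h - v) = norm (f (t + h) - f t - h *\<^sub>R v) / norm h"
    by (simp add: eventually_at_filter)
  ultimately show "((\<lambda>h. norm (f (t + h) - f t - h *\<^sub>R v) / norm h) \<longlongrightarrow> 0) (at 0)"
    by (rule Lim_transform_eventually)
qed

text \<open>Passes from real difference quotients to complex differentiability: the mean value
  inequality on the segment from \<open>z0\<close> to \<open>y\<close> turns continuity of
  \<open>g'\<close> into a linear approximation with small error.\<close>

lemma gateaux_holomorphic:
  fixes G g' :: "complex \<Rightarrow> complex"
  assumes S: "open S" and c: "continuous_on S g'"
    and d: "\<And>z \<zeta>. z \<in> S \<Longrightarrow> ((\<lambda>h::real. (G (z + of_real h * \<zeta>) - G z) / of_real h) \<longlongrightarrow> \<zeta> * g' z) (at 0)"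
  shows "G holomorphic_on S"
proof -
  have "(G has_field_derivative g' z0) (at z0)" if z0: "z0 \<in> S" for z0
    unfolding has_field_derivative_def has_derivative_at_alt
  proof (intro conjI allI impI)
    show "bounded_linear ((*) (g' z0))" by (rule bounded_linear_mult_right)
    fix e :: real assume e: "0 < e"
    obtain d1 where d1: "d1 > 0" "ball z0 d1 \<subseteq> S" using S z0 open_contains_ball by blast
    obtain d2 where d2: "d2 > 0" "\<And>x. x \<in> S \<Longrightarrow> dist x z0 < d2 \<Longrightarrow> dist (g' x) (g' z0) < e"
      using c z0 e unfolding continuous_on_iff by blast
    show "\<exists>d>0. \<forall>y. norm (y - z0) < d \<longrightarrow> norm (G y - G z0 - g' z0 * (y - z0)) \<le> e * norm (y - z0)"
    proof (intro exI[of _ "min d1 d2"] conjI allI impI)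
      show "0 < min d1 d2" using d1 d2 by simp
      fix y assume y: "norm (y - z0) < min d1 d2"
      let ?p = "\<lambda>t::real. z0 + of_real t * (y - z0)"
      have near: "dist (?p t) z0 < min d1 d2" if t: "t \<in> {0..1}" for t
      proof -
        have "dist (?p t) z0 = \<bar>t\<bar> * norm (y - z0)" by (simp add: dist_norm norm_mult)
        also have "\<dots> \<le> 1 * norm (y - z0)" using t by (intro mult_right_mono) auto
        finally show ?thesis using y by simp
      qed
      have pS: "?p t \<in> S" if "t \<in> {0..1}" for t
        using near[OF that] d1(2) by (auto simp: subset_iff dist_commute)
      have "norm (G (?p 1) - G (?p 0) - (1 - 0) *\<^sub>R ((y - z0) * g' (?p 0))) \<le> norm (1 - 0 :: real) * (norm (y - z0) * e)"
      proof (rule vector_differentiable_bound_linearization[where S = "{0..1}"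
            and f = "\<lambda>t. G (?p t)" and f' = "\<lambda>t. (y - z0) * g' (?p t)"])
        fix t :: real assume t: "t \<in> {0..1}"
        have "((\<lambda>h. (G (?p t + of_real h * (y - z0)) - G (?p t)) / of_real h) \<longlongrightarrow> (y - z0) * g' (?p t)) (at 0)"
          by (rule d[OF pS[OF t]])
        moreover have "?p t + of_real h * (y - z0) = ?p (t + h)" for h :: real by (simp add: algebra_simps)
        ultimately have "((\<lambda>h. (G (?p (t + h)) - G (?p t)) /\<^sub>R h) \<longlongrightarrow> (y - z0) * g' (?p t)) (at 0)"
          by (simp add: scaleR_conv_of_real divide_inverse mult.commute)
        then have "((\<lambda>t. G (?p t)) has_vector_derivative (y - z0) * g' (?p t)) (at t)"
          by (rule has_vector_derivative_from_quotient)
        then show "((\<lambda>t. G (?p t)) has_vector_derivative (y - z0) * g' (?p t)) (at t within {0..1})"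
          by (rule has_vector_derivative_at_within)
        have "norm ((y - z0) * g' (?p t) - (y - z0) * g' (?p 0)) = norm (y - z0) * dist (g' (?p t)) (g' z0)"
          by (simp add: dist_norm norm_mult flip: right_diff_distrib)
        also have "\<dots> \<le> norm (y - z0) * e"
          using d2(2)[OF pS[OF t]] near[OF t] by (intro mult_left_mono) auto
        finally show "norm ((y - z0) * g' (?p t) - (y - z0) * g' (?p 0)) \<le> norm (y - z0) * e" .
      qed (auto simp: closed_segment_eq_real_ivl)
      then show "norm (G y - G z0 - g' z0 * (y - z0)) \<le> e * norm (y - z0)" by (simp add: mult.commute)
    qed
  qed
  then show ?thesis
    unfolding holomorphic_on_def field_differentiable_def using has_field_derivative_at_within by blast
qed

text \<open>Clearing denominators gives a polynomial that vanishes on the circle, hence identically.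
  At the pole of the fraction with index 0 only the summand with weight \<open>W 0\<close> survives,
  and it is nonzero because the poles are distinct.\<close>

lemma partial_fractions_independent:
  fixes M :: nat and W s :: "nat \<Rightarrow> complex"
  assumes M: "0 < M" and inj: "inj_on s {..<M}" and W: "W 0 \<noteq> 0" and s: "\<forall>i. cmod (s i) = 1/2"
    and z: "\<forall>t. (\<Sum>i<M. W i * inverse (1 + s i * cis (2 * pi * t))) = 0"
  shows False
proof -
  define p where "p = (\<Sum>i<M. smult (W i) (\<Prod>j\<in>{..<M} - {i}. [:1, s j:]))"
  have pp: "poly p c = (\<Sum>i<M. W i * (\<Prod>j\<in>{..<M} - {i}. 1 + s j * c))" for c
    by (simp add: p_def poly_sum poly_prod mult.commute)
  have "sphere 0 1 \<subseteq> {c. poly p c = 0}"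
  proof (rule subsetI, rule CollectI)
    fix c :: complex assume c: "c \<in> sphere 0 1"
    have c_eq: "cis (2 * pi * (Arg c / (2 * pi))) = c"
      using c rcis_cmod_Arg[of c] by (simp add: rcis_def)
    have nz: "1 + s i * c \<noteq> 0" for i
    proof
      assume "1 + s i * c = 0"
      then have "cmod (s i * c) = cmod (- 1)" by (metis add.inverse_inverse eq_neg_iff_add_eq_0 add.commute)
      then show False using s c by (simp add: norm_mult)
    qed
    have "poly p c = (\<Sum>i<M. (\<Prod>j<M. 1 + s j * c) * (W i * inverse (1 + s i * c)))"
      unfolding pp
    proof (rule sum.cong[OF refl])
      fix i assume i: "i \<in> {..<M}"
      have "(\<Prod>j<M. 1 + s j * c) = (1 + s i * c) * (\<Prod>j\<in>{..<M} - {i}. 1 + s j * c)"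
        by (rule prod.remove) (use i in auto)
      then show "W i * (\<Prod>j\<in>{..<M} - {i}. 1 + s j * c) = (\<Prod>j<M. 1 + s j * c) * (W i * inverse (1 + s i * c))"
        using nz[of i] by (simp add: field_simps)
    qed
    also have "\<dots> = (\<Prod>j<M. 1 + s j * c) * (\<Sum>i<M. W i * inverse (1 + s i * c))"
      by (rule sum_distrib_left[symmetric])
    also have "(\<Sum>i<M. W i * inverse (1 + s i * c)) = 0"
      using z[rule_format, of "Arg c / (2 * pi)"] unfolding c_eq .
    finally show "poly p c = 0" by simp
  qed
  \<comment> \<open>A connected set with two points is infinite.\<close>
  moreover have "infinite (sphere (0::complex) 1)"
  proof
    assume "finite (sphere (0::complex) 1)"
    then have "sphere (0::complex) 1 = {} \<or> (\<exists>a. sphere (0::complex) 1 = {a})"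
      using connected_finite_iff_sing[OF connected_sphere[of "0::complex" 1]] by simp
    moreover have "1 \<in> sphere (0::complex) 1" "-1 \<in> sphere (0::complex) 1" by simp_all
    ultimately have "(1::complex) = -1" by (metis empty_iff singletonD)
    then show False by simp
  qed
  ultimately have "p = 0" using poly_roots_finite[of p] finite_subset by blast
  then have "0 = poly p (- inverse (s 0))" by simp
  also have "\<dots> = (\<Sum>i<M. W i * (\<Prod>j\<in>{..<M} - {i}. 1 - s j * inverse (s 0)))" by (simp add: pp)
  also have "\<dots> = W 0 * (\<Prod>j\<in>{..<M} - {0}. 1 - s j * inverse (s 0))"
  proof (rule sum.remove[of "{..<M}" 0, THEN trans])
    have "(\<Sum>i\<in>{..<M} - {0}. W i * (\<Prod>j\<in>{..<M} - {i}. 1 - s j * inverse (s 0))) = 0"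
    proof (rule sum.neutral, rule ballI)
      fix i assume i: "i \<in> {..<M} - {0}"
      have "s 0 \<noteq> 0" using s[rule_format, of 0] by auto
      then have "(\<Prod>j\<in>{..<M} - {i}. 1 - s j * inverse (s 0)) = 0"
        using i M by (intro prod_zero bexI[of _ 0]) auto
      then show "W i * (\<Prod>j\<in>{..<M} - {i}. 1 - s j * inverse (s 0)) = 0" by simp
    qed
    then show "W 0 * (\<Prod>j\<in>{..<M} - {0}. 1 - s j * inverse (s 0)) +
        (\<Sum>i\<in>{..<M} - {0}. W i * (\<Prod>j\<in>{..<M} - {i}. 1 - s j * inverse (s 0))) =
        W 0 * (\<Prod>j\<in>{..<M} - {0}. 1 - s j * inverse (s 0))" by simp
  qed (use M in auto)
  also have "\<dots> \<noteq> 0"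
  proof -
    have "1 - s j * inverse (s 0) \<noteq> 0" if j: "j \<in> {..<M} - {0}" for j
    proof
      assume "1 - s j * inverse (s 0) = 0"
      moreover have "s 0 \<noteq> 0" using s[rule_format, of 0] by auto
      ultimately have "s j = s 0" by (simp add: field_simps)
      then show False using inj_onD[OF inj, of j 0] j M by auto
    qed
    then have "(\<Prod>j\<in>{..<M} - {0}. 1 - s j * inverse (s 0)) \<noteq> 0"
      by (simp only: prod_zero_iff finite_Diff finite_lessThan) blast
    then show ?thesis using W by simp
  qed
  finally show False by simp
qed

context complex_subspace
begin

lemma in_line: "v \<in> line sc v"
  unfolding line_def by (rule range_eqI[of _ _ 1]) simp

text \<open>For \<open>v\<close> not proportional to \<open>v1\<close>, comparing the scalars at
  \<open>v1\<close>, \<open>v\<close> and \<open>v1 + v\<close> and using that \<open>S\<close> is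
  injective forces them to agree.\<close>

lemma projectively_equal:
  assumes T: "clinear_on sc sc E T" and S: "clinear_on sc sc E S"
    and SE: "\<And>v. v \<in> E \<Longrightarrow> S v = 0 \<Longrightarrow> v = 0"
    and eq: "\<And>v. v \<in> E \<Longrightarrow> \<exists>c. T v = sc c (S v)" and v1: "v1 \<in> E" "v1 \<noteq> 0"
  obtains \<kappa> where "\<And>v. v \<in> E \<Longrightarrow> T v = sc \<kappa> (S v)"
proof -
  have Tl: "T (v + w) = T v + T w" if "v \<in> E" "w \<in> E" for v w
    using T that by (auto simp: clinear_on_def)
  have Ts: "T (sc c v) = sc c (T v)" if "v \<in> E" for v c
    using T that by (auto simp: clinear_on_def)
  have Sl: "S (v + w) = S v + S w" if "v \<in> E" "w \<in> E" for v w
    using S that by (auto simp: clinear_on_def)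
  have Ss: "S (sc c v) = sc c (S v)" if "v \<in> E" for v c
    using S that by (auto simp: clinear_on_def)
  obtain \<kappa> where \<kappa>: "T v1 = sc \<kappa> (S v1)" using eq[OF v1(1)] by blast
  have "T v = sc \<kappa> (S v)" if v: "v \<in> E" for v
  proof (cases "\<exists>d. v = sc d v1")
    case True
    then obtain d where d: "v = sc d v1" by blast
    show ?thesis
      unfolding d Ts[OF v1(1)] Ss[OF v1(1)] \<kappa> scale_scale mult.commute[of d] ..
  next
    case False
    obtain c where c: "T v = sc c (S v)" using eq[OF v] by blast
    obtain c' where c': "T (v1 + v) = sc c' (S (v1 + v))" using eq[OF E_add[OF v1(1) v]] by blast
    have "sc \<kappa> (S v1) + sc c (S v) = sc c' (S v1) + sc c' (S v)"
      using c' unfolding Tl[OF v1(1) v] Sl[OF v1(1) v] \<kappa> c scale_right_distrib .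
    then have "sc (\<kappa> - c') (S v1) + sc (c - c') (S v) = 0"
      by (simp add: scale_left_diff_distrib algebra_simps)
    then have "S (sc (\<kappa> - c') v1 + sc (c - c') v) = 0"
      unfolding Sl[OF E_scale[OF v1(1)] E_scale[OF v]] Ss[OF v1(1)] Ss[OF v] .
    then have z: "sc (\<kappa> - c') v1 + sc (c - c') v = 0"
      by (rule SE[OF E_add[OF E_scale[OF v1(1)] E_scale[OF v]]])
    have "c = c'"
    proof (rule ccontr)
      assume ne: "c \<noteq> c'"
      have "sc (c - c') v = sc (c' - \<kappa>) v1" using z by (simp add: scale_left_diff_distrib algebra_simps)
      then have "sc (1 / (c - c')) (sc (c - c') v) = sc (1 / (c - c')) (sc (c' - \<kappa>) v1)" by simp
      then have "v = sc (1 / (c - c') * (c' - \<kappa>)) v1" using ne by simp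
      then show False using False by blast
    qed
    then have "\<kappa> = c'" using z v1(2) by simp
    then show ?thesis using c \<open>c = c'\<close> by simp
  qed
  then show ?thesis using that by blast
qed

end

lemma seminorm_bounded_functional_continuous:
  assumes V: "complex_subspace sc (topspace V)"
    and P: "complex_seminorm_on sc (topspace V) p" "p \<in> Q"
    and T: "V = seminorm_topology (topspace V) Q"
    and l: "clinear_on sc (*) (topspace V) l" "\<forall>x\<in>topspace V. cmod (l x) \<le> p x"
  shows "continuous_functional sc V l"
proof -
  interpret complex_subspace sc "topspace V" by (rule V)
  have p0: "p 0 = 0"
  proof -
    have "p (sc 0 0) = cmod 0 * p 0" using P(1) E_0 unfolding complex_seminorm_on_def by blast
    then show ?thesis by simp
  qed
  have ld: "l (y - x) = l y - l x" if "x \<in> topspace V" "y \<in> topspace V" for x y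
  proof -
    have "l ((y - x) + x) = l (y - x) + l x"
      using l(1) E_diff[OF that(2,1)] that(1) unfolding clinear_on_def by blast
    then show ?thesis by simp
  qed
  have "openin V {x \<in> topspace V. l x \<in> U}" if U: "open U" for U
  proof (subst openin_subopen, rule ballI)
    fix x assume x: "x \<in> {x \<in> topspace V. l x \<in> U}"
    then obtain e where e: "e > 0" "ball (l x) e \<subseteq> U" using U open_contains_ball by blast
    let ?B = "{y \<in> topspace V. p (y - x) < e}"
    have "?B \<in> {{y \<in> topspace V. p (y - x) < e} |p x e. p \<in> Q \<and> x \<in> topspace V \<and> 0 < e}"
      by (rule CollectI, rule exI[of _ p], rule exI[of _ x], rule exI[of _ e]) (use P(2) x e(1) in simp)
    then have "openin V ?B"
      by (subst T) (simp only: seminorm_topology_def topology_generated_by_Basis)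
    moreover have "x \<in> ?B" using x e(1) p0 by simp
    moreover have "?B \<subseteq> {x \<in> topspace V. l x \<in> U}"
    proof
      fix y assume y: "y \<in> ?B"
      have xy: "x \<in> topspace V" "y \<in> topspace V" using x y by simp_all
      have "cmod (l y - l x) \<le> p (y - x)"
        unfolding ld[OF xy, symmetric] by (rule bspec[OF l(2) E_diff[OF xy(2,1)]])
      also have "\<dots> < e" using y by simp
      finally have "l y \<in> ball (l x) e" by (simp add: dist_norm norm_minus_commute)
      then show "y \<in> {x \<in> topspace V. l x \<in> U}" using e(2) y by blast
    qed
    ultimately show "\<exists>T. openin V T \<and> x \<in> T \<and> T \<subseteq> {x \<in> topspace V. l x \<in> U}" by blast
  qed
  then have "continuous_map V euclidean l" by (simp add: continuous_map)
  then show ?thesis using l(1) by (simp add: continuous_functional_def)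
qed

section \<open>Functionals and automorphisms of Frechet spaces\<close>

lemma complex_frechet_subspace: "complex_frechet_space sc V \<Longrightarrow> complex_subspace sc (topspace V)"
  by (simp add: complex_frechet_space_def complex_subspace_def)

text \<open>Some defining seminorm is nonzero at \<open>v\<close>; a functional dominated by that
  seminorm is continuous.\<close>

lemma continuous_functionals_separate:
  assumes V: "complex_frechet_space sc V" and v: "v \<in> topspace V"
    and z: "\<And>l. continuous_functional sc V l \<Longrightarrow> l v = 0"
  shows "v = 0"
proof (rule ccontr)
  assume "v \<noteq> 0"
  interpret complex_subspace sc "topspace V" by (rule complex_frechet_subspace[OF V])
  obtain P :: "nat \<Rightarrow> 'a \<Rightarrow> real" where P: "\<forall>n. complex_seminorm_on sc (topspace V) (P n)"
    and P0: "\<forall>x\<in>topspace V. (\<forall>n. P n x = 0) \<longrightarrow> x = 0" and T: "V = seminorm_topology (topspace V) (range P)"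
    using V unfolding complex_frechet_space_def by (elim exE conjE)
  have "\<not> (\<forall>n. P n v = 0)" using bspec[OF P0 v] \<open>v \<noteq> 0\<close> by blast
  then obtain n where n: "P n v \<noteq> 0" by blast
  have Pn: "complex_seminorm_on sc (topspace V) (P n)" using P by (rule spec)
  show False
  proof (rule hahn_banach_seminorm[OF Pn v n])
    fix l assume l: "clinear_on sc (*) (topspace V) l" "\<forall>x\<in>topspace V. cmod (l x) \<le> P n x" "l v \<noteq> 0"
    have "continuous_functional sc V l"
      by (rule seminorm_bounded_functional_continuous[OF complex_subspace_axioms Pn rangeI T l(1,2)])
    from z[OF this] l(3) show False by contradiction
  qed
qed

lemma continuous_functional_compose:
  assumes l: "continuous_functional sc V l" and A: "clinear_on sc sc (topspace V) A" "continuous_map V V A"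
  shows "continuous_functional sc V (\<lambda>v. l (A v))"
proof -
  have AE: "A v \<in> topspace V" if "v \<in> topspace V" for v
    using continuous_map_image_subset_topspace[OF A(2)] that by blast
  have l1: "clinear_on sc (*) (topspace V) l" and l2: "continuous_map V euclidean l"
    using l by (simp_all add: continuous_functional_def)
  have "continuous_map V euclidean (\<lambda>v. l (A v))"
    using continuous_map_compose[OF A(2) l2] unfolding o_def .
  moreover have "clinear_on sc (*) (topspace V) (\<lambda>v. l (A v))"
    using l1 A(1) AE unfolding clinear_on_def by simp
  ultimately show ?thesis by (simp add: continuous_functional_def)
qed

lemma linear_automorphism_inverse:
  assumes V: "complex_subspace sc (topspace V)" and A: "linear_automorphism sc V A"
  obtains Ai where "clinear_on sc sc (topspace V) Ai" "continuous_map V V Ai"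
    "\<forall>v\<in>topspace V. A (Ai v) = v" "\<forall>v\<in>topspace V. Ai (A v) = v"
proof -
  interpret complex_subspace sc "topspace V" by (rule V)
  have Al: "clinear_on sc sc (topspace V) A" using A by (simp add: linear_automorphism_def)
  obtain Ai where Ai: "homeomorphic_maps V V A Ai"
    using A unfolding linear_automorphism_def homeomorphic_map_maps by blast
  then have c: "continuous_map V V Ai" "\<forall>v\<in>topspace V. A (Ai v) = v" "\<forall>v\<in>topspace V. Ai (A v) = v"
    by (auto simp: homeomorphic_maps_def)
  have AiE: "Ai v \<in> topspace V" if "v \<in> topspace V" for v
    using continuous_map_image_subset_topspace[OF c(1)] that by blast
  have "clinear_on sc sc (topspace V) Ai"
    unfolding clinear_on_def
  proof (intro conjI ballI allI)
    fix x y assume xy: "x \<in> topspace V" "y \<in> topspace V"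
    have "A (Ai x + Ai y) = x + y"
      using Al AiE xy c(2) by (simp add: clinear_on_def)
    then show "Ai (x + y) = Ai x + Ai y" using c(3) E_add[OF AiE[OF xy(1)] AiE[OF xy(2)]] by metis
  next
    fix d x assume x: "x \<in> topspace V"
    have "A (sc d (Ai x)) = sc d x" using Al AiE x c(2) by (simp add: clinear_on_def)
    then show "Ai (sc d x) = sc d (Ai x)" using c(3) E_scale[OF AiE[OF x], of d] by metis
  qed
  then show ?thesis using c that by blast
qed

section \<open>Moebius transformations and loops in the affine part\<close>

abbreviation mobius :: "complex^2^2 \<Rightarrow> (complex^2) set \<Rightarrow> (complex^2) set"
  where "mobius M \<equiv> projectivization (*s) UNIV (\<lambda>v. M *v v)"

lemma mobius_PGL2: "invertible M \<Longrightarrow> mobius M \<in> carrier PGL2"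
  by (auto simp: PGL2_def)

lemma line_P1: "v \<noteq> 0 \<Longrightarrow> line (*s) v \<in> P1"
  by (auto simp: P1_def proj_def)

lemma mobius_line: "v \<noteq> 0 \<Longrightarrow> mobius M (line (*s) v) = line (*s) (M *v v)"
  using line_P1[of v] by (simp add: projectivization_def P1_def image_line)

lemma line_vec_scale: "c \<noteq> 0 \<Longrightarrow> line (*s) (c *s v) = line (*s) (v :: complex^2)"
proof -
  assume c: "c \<noteq> 0"
  have "d *s v = (d / c) *s (c *s v)" for d using c by simp
  then have "line (*s) v \<subseteq> line (*s) (c *s v)" unfolding line_def by (metis image_subsetI rangeI)
  moreover have "line (*s) (c *s v) \<subseteq> line (*s) v" by (auto simp: line_def)
  ultimately show "line (*s) (c *s v) = line (*s) v" by blast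
qed

lemma vector_affine_nonzero: "(vector [z, 1] :: complex^2) \<noteq> 0"
  by (auto simp: vec_eq_iff forall_2)

lemma affine_point_P1: "affine_point z \<in> P1"
  unfolding affine_point_def by (rule line_P1[OF vector_affine_nonzero])

lemma affine_point_inj: "affine_point z = affine_point w \<Longrightarrow> z = w"
proof -
  assume "affine_point z = affine_point w"
  moreover have "(vector [z, 1] :: complex^2) \<in> affine_point z"
    unfolding affine_point_def line_def by (rule range_eqI[of _ _ 1]) simp
  ultimately obtain c where "(vector [z, 1] :: complex^2) = c *s vector [w, 1]"
    unfolding affine_point_def line_def by auto
  then show "z = w" by (simp add: vec_eq_iff forall_2)
qed

lemma mobius_one: "L \<in> P1 \<Longrightarrow> mobius (mat 1) L = L"
  by (subst projectivization_one) simp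

definition halving :: "complex^2^2" where "halving = vector [vector [1/2, 0], vector [0, 1]]"
definition swapping :: "complex^2^2" where "swapping = vector [vector [0, 1], vector [1, 0]]"

lemma halving_vec: "halving *v w = vector [w $ 1 / 2, w $ 2]"
  by (simp add: halving_def vec_eq_iff forall_2 matrix_vector_mult_def sum_2)
lemma swapping_vec: "swapping *v w = vector [w $ 2, w $ 1]"
  by (simp add: swapping_def vec_eq_iff forall_2 matrix_vector_mult_def sum_2)
lemma invertible_halving: "invertible halving"
  by (simp add: invertible_det_nz det_2 halving_def)
lemma invertible_swapping: "invertible swapping"
  by (simp add: invertible_det_nz det_2 swapping_def)

lemma halving_affine: "mobius halving (affine_point z) = affine_point (1/2 * z)"
proof -
  have "mobius halving (affine_point z) = line (*s) (halving *v vector [z, 1])"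
    unfolding affine_point_def by (rule mobius_line[OF vector_affine_nonzero])
  then show ?thesis unfolding affine_point_def halving_vec by simp
qed

lemma swapping_affine:
  assumes "z * w = 1" shows "mobius swapping (affine_point z) = affine_point w"
proof -
  have "z \<noteq> 0" using assms by auto
  have "swapping *v vector [z, 1] = z *s vector [w, 1]"
    unfolding swapping_vec using assms by (simp add: vec_eq_iff forall_2)
  then show ?thesis
    unfolding affine_point_def mobius_line[OF vector_affine_nonzero] using line_vec_scale[OF \<open>z \<noteq> 0\<close>] by simp
qed

lemma PGL2_mult:
  assumes "invertible M" "invertible M'"
  shows "mobius M \<otimes>\<^bsub>PGL2\<^esub> mobius M' = mobius (M ** M')"
  using projectivization_Bij[OF assms(1)] projectivization_Bij[OF assms(2)] projectivization_mult[OF assms(2), of M]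
  by (simp add: PGL2_def BijGroup_def)

text \<open>In coordinates, half of 1/(z/2) is 1/z. The matrix product is only a multiple of
  \<open>swapping\<close>, so the identity is projective. Its lift to \<open>V\<close> is the source
  of \<open>\<kappa>\<close>.\<close>

lemma halving_swapping_halving:
  "mobius halving \<otimes>\<^bsub>PGL2\<^esub> (mobius swapping \<otimes>\<^bsub>PGL2\<^esub> mobius halving) = mobius swapping"
proof -
  have "mobius (halving ** (swapping ** halving)) L = mobius swapping L" for L
  proof (cases "L \<in> P1")
    case True
    then obtain v :: "complex^2" where v: "L = line (*s) v" "v \<noteq> 0" by (auto simp: P1_def proj_def)
    have "(halving ** (swapping ** halving)) *v v = (1/2) *s (swapping *v v)"
      unfolding matrix_vector_mul_assoc[symmetric] halving_vec swapping_vec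
      by (simp add: vec_eq_iff forall_2)
    then show ?thesis unfolding v(1) mobius_line[OF v(2)] by (simp add: line_vec_scale)
  next
    case False
    then show ?thesis by (simp add: projectivization_def P1_def)
  qed
  then show ?thesis
    by (simp add: PGL2_mult invertible_halving invertible_swapping invertible_mult ext)
qed

lemma affine_loop_LP1: "y \<in> LC r \<Longrightarrow> g \<in> carrier PGL2 \<Longrightarrow> (\<lambda>t. g (affine_point (y t))) \<in> LP1 r"
proof -
  assume y: "y \<in> LC r" and g: "g \<in> carrier PGL2"
  then obtain M where M: "g = mobius M" "invertible M" by (auto simp: PGL2_def)
  have per: "periodic y" and cl: "of_class r UNIV y" using y unfolding LC_def by blast+
  have P: "g (affine_point z) \<in> P1" for z
    using projectivization_in_P1[OF M(2) affine_point_P1[of z]] affine_point_P1[of z]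
    unfolding M(1) projectivization_def P1_def[symmetric] by simp
  show ?thesis
    unfolding LP1_def mem_Collect_eq
  proof (intro conjI allI)
    show "periodic (\<lambda>t. g (affine_point (y t)))" using per by (simp add: periodic_def)
    show "g (affine_point (y t)) \<in> P1" for t by (rule P)
    show "\<exists>g'\<in>carrier PGL2. \<exists>J f. open J \<and> t0 \<in> J \<and> of_class r J f \<and>
        (\<forall>t\<in>J. g (affine_point (y t)) = g' (affine_point (f t)))" for t0
      by (rule bexI[OF _ g], rule exI[of _ UNIV], rule exI[of _ y]) (simp only: cl open_UNIV UNIV_I simp_thms ball_simps)
  qed
qed

lemma id_PGL2: "mobius (mat 1) \<in> carrier PGL2"
  by (rule mobius_PGL2) (simp add: invertible_def)

lemma affine_chart: "(LC_topology r, \<lambda>y t. affine_point (y t)) \<in> LP1_charts r"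
proof -
  have eq: "(\<lambda>y t. affine_point (y t)) = (\<lambda>(y :: real \<Rightarrow> complex) t. mobius (mat 1) (affine_point (y t)))"
    by (intro ext) (simp only: mobius_one[OF affine_point_P1])
  show ?thesis unfolding LP1_charts_def
    by (rule CollectI, rule exI[of _ "mobius (mat 1)"], rule conjI[OF arg_cong[OF eq] id_PGL2])
qed

lemma topspace_LP1:
  assumes r: "admissible r"
  shows "topspace (manifold_topology (LP1 r) (LP1_charts r)) = LP1 r"
proof (rule topspace_manifold_topology)
  fix T \<phi> y assume T: "(T, \<phi>) \<in> LP1_charts r" and y: "y \<in> topspace T"
  then obtain g where g: "g \<in> carrier PGL2" "T = LC_topology r" "\<phi> = (\<lambda>y t. g (affine_point (y t)))"
    by (auto simp: LP1_charts_def)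
  then show "\<phi> y \<in> LP1 r" using affine_loop_LP1[of y r g] y topspace_LC_topology[OF r] by simp
qed

lemma proj_chartsE:
  assumes "(T, \<phi>) \<in> proj_charts sc V"
  obtains l v0 where "continuous_functional sc V l" "v0 \<in> topspace V" "l v0 = 1"
    "T = subtopology V {w. l w = 0}" "\<phi> = (\<lambda>w. line sc (v0 + w))"
proof -
  have "\<exists>l v0. (T, \<phi>) = (subtopology V {w. l w = 0}, \<lambda>w. line sc (v0 + w)) \<and>
      continuous_functional sc V l \<and> v0 \<in> topspace V \<and> l v0 = 1"
    using assms unfolding proj_charts_def by (rule CollectD)
  then show ?thesis using that by (elim exE conjE) (simp only: prod.inject)
qed

section \<open>Equivariant embeddings in charts\<close>

locale equivariant_loop_embedding =
  fixes r :: smoothness and sc :: "complex \<Rightarrow> 'v::ab_group_add \<Rightarrow> 'v" and V :: "'v topology"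
    and \<epsilon> :: "(real \<Rightarrow> (complex^2) set) \<Rightarrow> 'v set"
  assumes r: "admissible r" and V: "complex_frechet_space sc V"
    and emb: "holomorphic_embedding LC_scale (LP1 r) (LP1_charts r) sc (proj sc (topspace V)) (proj_charts sc V) \<epsilon>"
    and eqv: "equivariant r sc V \<epsilon>"
begin

sublocale complex_subspace sc "topspace V"
  using V by (simp add: complex_frechet_space_def complex_subspace_def)

definition e :: "(real \<Rightarrow> complex) \<Rightarrow> 'v set"
  where "e y = \<epsilon> (\<lambda>t. affine_point (y t))"

lemma affine_LP1: "y \<in> LC r \<Longrightarrow> (\<lambda>t. affine_point (y t)) \<in> LP1 r"
  using affine_loop_LP1[OF _ id_PGL2, of y r] by (simp only: mobius_one[OF affine_point_P1])

lemma topspace_proj: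
  "topspace (manifold_topology (proj sc (topspace V)) (proj_charts sc V)) = proj sc (topspace V)"
proof (rule topspace_manifold_topology)
  fix T \<phi> w assume T: "(T, \<phi>) \<in> proj_charts sc V" and w: "w \<in> topspace T"
  obtain l v0 where l: "continuous_functional sc V l" "v0 \<in> topspace V" "l v0 = 1"
    "T = subtopology V {w. l w = 0}" "\<phi> = (\<lambda>w. line sc (v0 + w))"
    by (rule proj_chartsE[OF T])
  have wE: "w \<in> topspace V" "l w = 0" using w l(4) by auto
  have "l (v0 + w) = 1" using l wE by (simp add: continuous_functional_def clinear_on_def)
  moreover have "l 0 = 0"
  proof -
    have "l (sc 0 0) = 0 * l 0" using l(1) E_0 unfolding continuous_functional_def clinear_on_def by blast
    then show ?thesis by simp
  qed
  ultimately have "v0 + w \<noteq> 0" by auto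
  then show "\<phi> w \<in> proj sc (topspace V)" using l E_add wE by (auto simp: proj_def)
qed

lemma \<epsilon>_continuous: "continuous_map (manifold_topology (LP1 r) (LP1_charts r))
    (manifold_topology (proj sc (topspace V)) (proj_charts sc V)) \<epsilon>"
  using emb by (simp add: holomorphic_embedding_def holomorphic_map_def)

lemma \<epsilon>_proj: "x \<in> LP1 r \<Longrightarrow> \<epsilon> x \<in> proj sc (topspace V)"
  using continuous_map_image_subset_topspace[OF \<epsilon>_continuous] unfolding topspace_LP1[OF r] topspace_proj by blast

lemma \<epsilon>_inj: "inj_on \<epsilon> (LP1 r)"
proof -
  have "embedding_map (manifold_topology (LP1 r) (LP1_charts r))
      (manifold_topology (proj sc (topspace V)) (proj_charts sc V)) \<epsilon>"
    using emb unfolding holomorphic_embedding_def by blast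
  from homeomorphic_imp_injective_map[OF this[unfolded embedding_map_def]]
  show ?thesis unfolding topspace_LP1[OF r] .
qed

lemma e_line: "y \<in> LC r \<Longrightarrow> \<exists>v\<in>topspace V. v \<noteq> 0 \<and> e y = line sc v"
  using \<epsilon>_proj[OF affine_LP1] unfolding e_def proj_def by blast

lemma zero_smooth: "(\<lambda>t. 0) \<in> smooth_loops"
  using smooth_loops_affine[of 0 0] by simp

text \<open>Continuity and injectivity of \<open>\<epsilon>\<close> would make the loop 0 isolated;
  restricted to constant loops, this would make a single point open in the complex plane.\<close>

lemma not_isolated:
  assumes isolated: "openin (manifold_topology (proj sc (topspace V)) (proj_charts sc V)) {e (\<lambda>t. 0)}"
  shows False
proof -
  let ?M = "manifold_topology (LP1 r) (LP1_charts r)"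
  have z: "(\<lambda>t. 0) \<in> LC r" by (rule smooth_loops_in_LC[OF r zero_smooth])
  define S where "S = {x \<in> topspace ?M. \<epsilon> x \<in> {e (\<lambda>t. 0)}}"
  from isolated have "openin ?M S" unfolding S_def by (rule openin_continuous_map_preimage[OF \<epsilon>_continuous])
  then have "\<forall>(T, \<phi>)\<in>LP1_charts r. openin T {y \<in> topspace T. \<phi> y \<in> S}"
    unfolding openin_manifold_topology by (rule conjunct2)
  from bspec[OF this affine_chart] have o: "openin (LC_topology r) {y \<in> topspace (LC_topology r). (\<lambda>t. affine_point (y t)) \<in> S}"
    by (simp only: prod.case)
  have S: "x = (\<lambda>t. affine_point 0)" if x: "x \<in> S" for x
  proof (rule inj_onD[OF \<epsilon>_inj])
    show "x \<in> LP1 r" using x unfolding S_def topspace_LP1[OF r] by (rule CollectE) (erule conjunct1)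
    show "\<epsilon> x = \<epsilon> (\<lambda>t. affine_point 0)" using x unfolding S_def e_def by (rule CollectE) (erule conjE, erule singletonD)
    show "(\<lambda>t. affine_point 0) \<in> LP1 r" by (rule affine_LP1[OF z])
  qed
  have "{y \<in> topspace (LC_topology r). (\<lambda>t. affine_point (y t)) \<in> S} = {\<lambda>t. 0}"
  proof
    show "{y \<in> topspace (LC_topology r). (\<lambda>t. affine_point (y t)) \<in> S} \<subseteq> {\<lambda>t. 0}"
    proof (rule subsetI)
      fix y assume "y \<in> {y \<in> topspace (LC_topology r). (\<lambda>t. affine_point (y t)) \<in> S}"
      then have "(\<lambda>t. affine_point (y t)) = (\<lambda>t. affine_point 0)" by (intro S) (rule CollectE, assumption, erule conjunct2)
      then have "affine_point (y t) = affine_point 0" for t by (rule fun_cong)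
      then have "y t = 0" for t by (rule affine_point_inj)
      then show "y \<in> {\<lambda>t. 0}" unfolding singleton_iff by (rule ext)
    qed
    have "(\<lambda>t. 0) \<in> topspace (LC_topology r)" unfolding topspace_LC_topology[OF r] by (rule z)
    moreover have "(\<lambda>t. affine_point 0) \<in> S"
      unfolding S_def topspace_LP1[OF r] e_def by (rule CollectI, rule conjI[OF affine_LP1[OF z] singletonI])
    ultimately show "{\<lambda>t. 0} \<subseteq> {y \<in> topspace (LC_topology r). (\<lambda>t. affine_point (y t)) \<in> S}" by blast
  qed
  then have "openin (LC_topology r) {\<lambda>t. 0}" using o by (simp only:)
  moreover have one: "(\<lambda>t. 1) \<in> smooth_loops" using smooth_loops_affine[of 1 0] by simp
  \<comment> \<open>Both spanning loops are the constant 1, so the preimage of the zero loop is the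
    antidiagonal.\<close>
  ultimately have "openin euclidean {c \<in> topspace euclidean. (\<lambda>(a, b) t. a * 1 + b * 1) c \<in> {\<lambda>t::real. 0::complex}}"
    by (intro openin_continuous_map_preimage[OF continuous_LC_plane[OF r one one]])
  moreover have "{c \<in> topspace euclidean. (\<lambda>(a, b) t. a * 1 + b * 1) c \<in> {\<lambda>t::real. 0::complex}} = {c. fst c + snd c = 0}"
    by (auto simp: fun_eq_iff)
  ultimately have op: "open {c :: complex \<times> complex. fst c + snd c = 0}" by (simp only: open_openin)
  have "open {a :: complex. (a, 0) \<in> {c :: complex \<times> complex. fst c + snd c = 0}}"
  proof -
    have "continuous_on UNIV (\<lambda>a::complex. (a, 0::complex))" by (intro continuous_intros)
    from open_vimage[OF op this] show ?thesis by (simp only: vimage_def)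
  qed
  then have "open {0 :: complex}" by simp
  then show False by (simp add: not_open_singleton)
qed

text \<open>If no affine chart contained \<open>\<epsilon>(0)\<close>, this point would be isolated in the target, hence the
  constant loop \<open>0\<close> would be isolated among the loops.\<close>

lemma chart_exists:
  obtains l v0 w where "continuous_functional sc V l" "v0 \<in> topspace V" "l v0 = 1"
    "w \<in> topspace V" "l w = 0" "e (\<lambda>t. 0) = line sc (v0 + w)"
proof (rule ccontr)
  assume "\<not> thesis"
  then have none: "\<not> (continuous_functional sc V l \<and> v0 \<in> topspace V \<and> l v0 = 1 \<and>
      w \<in> topspace V \<and> l w = 0 \<and> e (\<lambda>t. 0) = line sc (v0 + w))" for l v0 w using that by blast
  let ?N = "manifold_topology (proj sc (topspace V)) (proj_charts sc V)"
  let ?M = "manifold_topology (LP1 r) (LP1_charts r)"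
  have z: "(\<lambda>t. 0) \<in> LC r" by (rule smooth_loops_in_LC[OF r zero_smooth])
  have "openin ?N {e (\<lambda>t. 0)}"
    unfolding openin_manifold_topology
  proof (intro conjI)
    show "{e (\<lambda>t. 0)} \<subseteq> proj sc (topspace V)" using \<epsilon>_proj[OF affine_LP1[OF z]] by (simp add: e_def)
    show "\<forall>(T, \<phi>)\<in>proj_charts sc V. openin T {w \<in> topspace T. \<phi> w \<in> {e (\<lambda>t. 0)}}"
    proof (intro ballI, clarify)
      fix T \<phi> assume T: "(T, \<phi>) \<in> proj_charts sc V"
      obtain l v0 where l: "continuous_functional sc V l" "v0 \<in> topspace V" "l v0 = 1"
        "T = subtopology V {w. l w = 0}" "\<phi> = (\<lambda>w. line sc (v0 + w))"
        by (rule proj_chartsE[OF T])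
      have "{w \<in> topspace T. \<phi> w \<in> {e (\<lambda>t. 0)}} = {}"
        unfolding l(4,5) using none[of l v0] l(1-3) by auto
      then show "openin T {w \<in> topspace T. \<phi> w \<in> {e (\<lambda>t. 0)}}" by (simp only: openin_empty)
    qed
  qed
  then show False by (rule not_isolated)
qed

end

locale chart_embedding = equivariant_loop_embedding r sc V \<epsilon>
  for r :: smoothness and sc :: "complex \<Rightarrow> 'v \<Rightarrow> 'v::ab_group_add" and V :: "'v topology"
    and \<epsilon> :: "(real \<Rightarrow> (complex^2) set) \<Rightarrow> 'v set" +
  fixes l :: "'v \<Rightarrow> complex" and v0 :: 'v
  assumes l: "continuous_functional sc V l" and v0: "v0 \<in> topspace V" "l v0 = 1"
begin

definition ker_top :: "'v topology" where "ker_top = subtopology V {w. l w = 0}"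

definition D0 :: "(real \<Rightarrow> complex) set"
  where "D0 = chart_domain (LC_topology r, \<lambda>y t. affine_point (y t)) (ker_top, \<lambda>w. line sc (v0 + w)) \<epsilon>"

text \<open>The embedding in coordinates, with values in the kernel of \<open>l\<close>. The lift
  handed to the germ is \<open>v0 + F0 y\<close>, on which \<open>l\<close> equals 1.\<close>

definition F0 :: "(real \<Rightarrow> complex) \<Rightarrow> 'v"
  where "F0 = in_charts (LC_topology r, \<lambda>y t. affine_point (y t)) (ker_top, \<lambda>w. line sc (v0 + w)) \<epsilon>"

lemma proj_chart: "(ker_top, \<lambda>w. line sc (v0 + w)) \<in> proj_charts sc V"
  unfolding proj_charts_def ker_top_def
  by (rule CollectI, rule exI[of _ l], rule exI[of _ v0]) (simp only: l v0 simp_thms)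

lemma topspace_ker_top: "topspace ker_top = {w \<in> topspace V. l w = 0}"
  by (auto simp: ker_top_def)

lemma D0_iff: "y \<in> D0 \<longleftrightarrow> y \<in> LC r \<and> (\<exists>w\<in>topspace V. l w = 0 \<and> e y = line sc (v0 + w))"
  unfolding D0_def chart_domain_def e_def fst_conv snd_conv topspace_LC_topology[OF r] topspace_ker_top by blast

lemma F0:
  assumes "y \<in> D0" shows "F0 y \<in> topspace V" "l (F0 y) = 0" "e y = line sc (v0 + F0 y)"
proof -
  have img: "e y \<in> (\<lambda>w. line sc (v0 + w)) ` topspace ker_top"
    using assms unfolding D0_iff topspace_ker_top by blast
  have F0y: "F0 y = inv_into (topspace ker_top) (\<lambda>w. line sc (v0 + w)) (e y)"
    unfolding F0_def in_charts_def fst_conv snd_conv e_def ..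
  have "F0 y \<in> topspace ker_top" unfolding F0y by (rule inv_into_into[OF img])
  then show "F0 y \<in> topspace V" "l (F0 y) = 0" by (simp_all add: topspace_ker_top)
  show "e y = line sc (v0 + F0 y)" unfolding F0y by (rule f_inv_into_f[OF img, symmetric])
qed

lemma F0_holomorphic: "holomorphic_between LC_scale (LC_topology r) sc ker_top D0 F0"
proof -
  have "\<forall>a\<in>LP1_charts r. \<forall>b\<in>proj_charts sc V.
      holomorphic_between LC_scale (fst a) sc (fst b) (chart_domain a b \<epsilon>) (in_charts a b \<epsilon>)"
    using emb unfolding holomorphic_embedding_def holomorphic_map_def by blast
  from bspec[OF bspec[OF this affine_chart] proj_chart] show ?thesis
    unfolding D0_def F0_def fst_conv .
qed

lemma D0_openin: "openin (LC_topology r) D0"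
  using F0_holomorphic unfolding holomorphic_between_def by blast

lemma F0_continuous: "continuous_map (subtopology (LC_topology r) D0) ker_top F0"
  using F0_holomorphic unfolding holomorphic_between_def by blast

lemma functional_ker_top: "continuous_functional sc V \<mu> \<Longrightarrow> continuous_map ker_top euclidean \<mu>"
  unfolding ker_top_def continuous_functional_def by (rule continuous_map_from_subtopology) (erule conjunct2)

lemma functional_linear:
  assumes "continuous_functional sc V \<mu>"
  shows "v \<in> topspace V \<Longrightarrow> w \<in> topspace V \<Longrightarrow> \<mu> (v + w) = \<mu> v + \<mu> w"
    "v \<in> topspace V \<Longrightarrow> \<mu> (sc c v) = c * \<mu> v"
  using assms by (simp_all add: continuous_functional_def clinear_on_def)

lemma functional_diff:
  assumes \<mu>: "continuous_functional sc V \<mu>" and v: "v \<in> topspace V" "w \<in> topspace V"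
  shows "\<mu> (v - w) = \<mu> v - \<mu> w"
  using functional_linear(1)[OF \<mu> E_diff[OF v] v(2)] by simp

lemma loop_comb_continuous:
  assumes "y \<in> smooth_loops" "z \<in> smooth_loops"
  shows "continuous_map euclidean (LC_topology r) (loop_comb y z)"
proof -
  have "(\<lambda>(a, b). (\<lambda>t. a * y t + b * z t)) = loop_comb y z"
    by (simp add: fun_eq_iff loop_comb_def)
  then show ?thesis using continuous_LC_plane[OF r assms] by (simp only:)
qed

lemma D0_plane_open:
  assumes "y \<in> smooth_loops" "z \<in> smooth_loops"
  shows "open {c. loop_comb y z c \<in> D0}"
  using openin_continuous_map_preimage[OF loop_comb_continuous[OF assms] D0_openin]
  by (simp only: topspace_euclidean UNIV_I simp_thms open_openin)

lemma D0_line_open: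
  assumes y: "y \<in> smooth_loops" and z: "z \<in> smooth_loops"
  shows "open {x. loop_comb y z (a + x * a', b + x * b') \<in> D0}"
proof -
  have "continuous_on UNIV (\<lambda>x. (a + x * a', b + x * b'))" by (intro continuous_intros)
  from open_vimage[OF D0_plane_open[OF y z] this] show ?thesis by (simp only: vimage_def mem_Collect_eq)
qed

end

locale chart_embedding_derivative = chart_embedding r sc V \<epsilon> l v0
  for r :: smoothness and sc :: "complex \<Rightarrow> 'v \<Rightarrow> 'v::ab_group_add" and V :: "'v topology"
    and \<epsilon> :: "(real \<Rightarrow> (complex^2) set) \<Rightarrow> 'v set" and l v0 +
  fixes df :: "(real \<Rightarrow> complex) \<Rightarrow> (real \<Rightarrow> complex) \<Rightarrow> 'v"
  assumes df: "\<forall>x\<in>D0. \<forall>\<xi>\<in>topspace (LC_topology r). has_directional_derivative LC_scale sc ker_top F0 x \<xi> (df x \<xi>)"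
    and df_linear: "\<forall>x\<in>D0. clinear_on LC_scale sc (topspace (LC_topology r)) (df x)"
    and df_continuous: "continuous_map (prod_topology (subtopology (LC_topology r) D0) (LC_topology r)) ker_top (\<lambda>(x, \<xi>). df x \<xi>)"
begin

lemma smooth_topspace: "y \<in> smooth_loops \<Longrightarrow> y \<in> topspace (LC_topology r)"
  unfolding topspace_LC_topology[OF r] by (rule smooth_loops_in_LC[OF r])

lemma df_ker_top:
  assumes "x \<in> D0" "\<xi> \<in> smooth_loops" shows "df x \<xi> \<in> topspace ker_top"
  using bspec[OF bspec[OF df assms(1)] smooth_topspace[OF assms(2)]]
  unfolding has_directional_derivative_def by (rule limitin_topspace)

lemma df_E: "x \<in> D0 \<Longrightarrow> \<xi> \<in> smooth_loops \<Longrightarrow> df x \<xi> \<in> topspace V"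
  using df_ker_top[of x \<xi>] unfolding topspace_ker_top by simp

lemma directional:
  assumes x: "x \<in> D0" "x \<in> smooth_loops" and \<xi>: "\<xi> \<in> smooth_loops" and \<mu>: "continuous_functional sc V \<mu>"
  shows "((\<lambda>h::real. (\<mu> (F0 (loop_comb x \<xi> (1, of_real h))) - \<mu> (F0 x)) / of_real h) \<longlongrightarrow> \<mu> (df x \<xi>)) (at 0)"
proof -
  have eq: "x + LC_scale (of_real h) \<xi> = loop_comb x \<xi> (1, of_real h)" for h :: real
    by (simp add: loop_comb_def LC_scale_def fun_eq_iff)
  have "limitin ker_top (\<lambda>h::real. sc (of_real (1 / h)) (F0 (loop_comb x \<xi> (1, of_real h)) - F0 x)) (df x \<xi>) (at 0)"
    using bspec[OF bspec[OF df x(1)] smooth_topspace[OF \<xi>]] unfolding has_directional_derivative_def eq .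
  from continuous_map_limit[OF functional_ker_top[OF \<mu>] this]
  have lim: "((\<lambda>h::real. \<mu> (sc (of_real (1 / h)) (F0 (loop_comb x \<xi> (1, of_real h)) - F0 x))) \<longlongrightarrow> \<mu> (df x \<xi>)) (at 0)"
    unfolding limitin_canonical_iff o_def .
  have "continuous_on UNIV (\<lambda>h::real. (1::complex, complex_of_real h))" by (intro continuous_intros)
  from open_vimage[OF D0_plane_open[OF x(2) \<xi>] this]
  have op: "open {h::real. loop_comb x \<xi> (1, of_real h) \<in> D0}" by (simp only: vimage_def mem_Collect_eq)
  have "loop_comb x \<xi> (1, of_real 0) = x" by (simp add: loop_comb_def)
  then have "0 \<in> {h::real. loop_comb x \<xi> (1, of_real h) \<in> D0}" using x(1) by simp
  from eventually_nhds_in_open[OF op this]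
  have ev: "\<forall>\<^sub>F h::real in at 0. loop_comb x \<xi> (1, of_real h) \<in> D0"
    unfolding eventually_at_filter by (rule eventually_mono) simp
  show ?thesis
  proof (rule Lim_transform_eventually[OF lim], rule eventually_mono[OF ev])
    fix h :: real assume h: "loop_comb x \<xi> (1, of_real h) \<in> D0"
    note E = F0(1)[OF h] F0(1)[OF x(1)]
    show "\<mu> (sc (of_real (1 / h)) (F0 (loop_comb x \<xi> (1, of_real h)) - F0 x)) =
        (\<mu> (F0 (loop_comb x \<xi> (1, of_real h))) - \<mu> (F0 x)) / of_real h"
      unfolding functional_linear(2)[OF \<mu> E_diff[OF E]] functional_diff[OF \<mu> E] by simp
  qed
qed

text \<open>Along a complex line, complex linearity of the differential supplies the factor
  \<open>\<zeta>\<close> and its joint continuity supplies a continuous derivative, as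
  \<open>gateaux_holomorphic\<close> requires.\<close>

lemma F0_hol2:
  assumes y: "y \<in> smooth_loops" and z: "z \<in> smooth_loops" and \<mu>: "continuous_functional sc V \<mu>"
  shows "hol2 {c. loop_comb y z c \<in> D0} (\<lambda>c. \<mu> (v0 + F0 (loop_comb y z c)))"
proof -
  let ?S = "{c. loop_comb y z c \<in> D0}"
  have lc: "continuous_map (top_of_set ?S) (subtopology (LC_topology r) D0) (loop_comb y z)"
    unfolding continuous_map_in_subtopology
    by (rule conjI[OF continuous_map_from_subtopology[OF loop_comb_continuous[OF y z]]]) auto
  from continuous_map_compose[OF continuous_map_compose[OF lc F0_continuous] functional_ker_top[OF \<mu>]]
  have c: "continuous_on ?S (\<lambda>c. \<mu> (F0 (loop_comb y z c)))"
    unfolding continuous_map_iff_continuous o_def .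
  have h: "hol2 ?S (\<lambda>c. \<mu> (F0 (loop_comb y z c)))"
  proof (rule hol2I[OF c])
    fix a b a' b' :: complex
    let ?p = "\<lambda>x. (a + x * a', b + x * b')"
    let ?S1 = "{x. ?p x \<in> ?S}" and ?\<xi> = "loop_comb y z (a', b')"
    have \<xi>: "?\<xi> \<in> smooth_loops" by (rule loop_comb_smooth[OF y z])
    have xs: "loop_comb y z c \<in> smooth_loops" for c by (rule loop_comb_smooth[OF y z])
    show "(\<lambda>x. \<mu> (F0 (loop_comb y z (?p x)))) holomorphic_on ?S1"
    proof (rule gateaux_holomorphic[where g' = "\<lambda>x. \<mu> (df (loop_comb y z (?p x)) ?\<xi>)"])
      show "open ?S1" unfolding mem_Collect_eq by (rule D0_line_open[OF y z])
      have "continuous_on ?S1 ?p" by (intro continuous_intros)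
      then have p: "continuous_map (top_of_set ?S1) (top_of_set ?S) ?p"
        unfolding continuous_map_in_subtopology continuous_map_iff_continuous by auto
      have "continuous_map (top_of_set ?S1) (prod_topology (subtopology (LC_topology r) D0) (LC_topology r))
          (\<lambda>x. ((loop_comb y z \<circ> ?p) x, ?\<xi>))"
        by (rule continuous_map_pairedI[OF continuous_map_compose[OF p lc]])
           (simp only: continuous_map_const smooth_topspace[OF \<xi>] simp_thms)
      from continuous_map_compose[OF continuous_map_compose[OF this df_continuous] functional_ker_top[OF \<mu>]]
      show "continuous_on ?S1 (\<lambda>x. \<mu> (df (loop_comb y z (?p x)) ?\<xi>))"
        unfolding continuous_map_iff_continuous o_def prod.case .
      fix x \<zeta> :: complex assume x: "x \<in> ?S1"
      let ?x = "loop_comb y z (?p x)"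
      have xD: "?x \<in> D0" using x by simp
      have \<zeta>\<xi>: "LC_scale \<zeta> ?\<xi> \<in> smooth_loops" by (rule smooth_loops_scale[OF \<xi>])
      have eq: "loop_comb ?x (LC_scale \<zeta> ?\<xi>) (1, of_real h) = loop_comb y z (?p (x + of_real h * \<zeta>))" for h :: real
        by (simp add: loop_comb_def LC_scale_def fun_eq_iff algebra_simps)
      have "df ?x (LC_scale \<zeta> ?\<xi>) = sc \<zeta> (df ?x ?\<xi>)"
        using bspec[OF df_linear xD] smooth_topspace[OF \<xi>] unfolding clinear_on_def by blast
      then have "\<mu> (df ?x (LC_scale \<zeta> ?\<xi>)) = \<zeta> * \<mu> (df ?x ?\<xi>)"
        using functional_linear(2)[OF \<mu> df_E[OF xD \<xi>]] by simp
      with directional[OF xD xs \<zeta>\<xi> \<mu>]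
      show "((\<lambda>h::real. (\<mu> (F0 (loop_comb y z (?p (x + of_real h * \<zeta>)))) - \<mu> (F0 ?x)) / of_real h)
          \<longlongrightarrow> \<zeta> * \<mu> (df ?x ?\<xi>)) (at 0)" unfolding eq by (simp only:)
    qed
  qed
  have k: "hol2 ?S (\<lambda>c. \<mu> v0)" by (rule hol2_const)
  have "hol2 ?S (\<lambda>c. \<mu> v0 + \<mu> (F0 (loop_comb y z c)))"
    by (rule hol2I[OF continuous_on_add[OF continuous_on_const c] holomorphic_on_add[OF holomorphic_on_const hol2_line[OF h]]])
  then show ?thesis
    by (rule hol2_cong) (simp only: mem_Collect_eq functional_linear(1)[OF \<mu> v0(1) F0(1)])
qed

end

section \<open>Linear lifts of halving and inversion\<close>

context equivariant_loop_embedding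
begin

lemma action_by_automorphisms:
  obtains \<rho> where "group_action PGL2 (proj sc (topspace V)) \<rho>"
    "\<forall>g\<in>carrier PGL2. \<exists>A. linear_automorphism sc V A \<and> \<rho> g = projectivization sc (topspace V) A"
    "\<forall>g\<in>carrier PGL2. \<forall>x\<in>LP1 r. \<epsilon> (\<lambda>t. g (x t)) = \<rho> g (\<epsilon> x)"
  using eqv unfolding equivariant_def projective_action_def by blast

lemma linear_automorphism_E: "linear_automorphism sc V A \<Longrightarrow> v \<in> topspace V \<Longrightarrow> A v \<in> topspace V"
proof -
  assume A: "linear_automorphism sc V A" and v: "v \<in> topspace V"
  have "A ` topspace V = topspace V"
    using A homeomorphic_imp_surjective_map unfolding linear_automorphism_def by blast
  then show "A v \<in> topspace V" using v by blast
qed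

lemma linear_automorphism_scale:
  "linear_automorphism sc V A \<Longrightarrow> v \<in> topspace V \<Longrightarrow> A (sc c v) = sc c (A v)"
  unfolding linear_automorphism_def clinear_on_def by blast

lemma image_of_line:
  assumes A: "linear_automorphism sc V A" and v: "v \<in> topspace V"
  shows "A ` line sc v = line sc (A v)"
  unfolding line_def image_image linear_automorphism_scale[OF A v] ..

lemma linear_automorphism_zero_iff:
  assumes A: "linear_automorphism sc V A" and v: "v \<in> topspace V"
  shows "A v = 0 \<longleftrightarrow> v = 0"
proof -
  have 0: "A 0 = 0" using linear_automorphism_scale[OF A E_0, of 0] by simp
  have "inj_on A (topspace V)"
    using A homeomorphic_imp_injective_map unfolding linear_automorphism_def by blast
  from inj_on_eq_iff[OF this v E_0] show ?thesis unfolding 0 .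
qed

text \<open>Projective transformations determine their linear lifts only up to scalars, so the group
  relation between halving and inversion survives as a relation up to the scalar
  \<open>\<kappa>\<close>.\<close>

lemma lifts:
  obtains A B \<kappa> where "linear_automorphism sc V A" "linear_automorphism sc V B"
    "\<forall>y\<in>LC r. e (LC_scale (1/2) y) = A ` e y"
    "\<forall>y\<in>LC r. \<forall>z. (\<forall>t. y t * z t = 1) \<longrightarrow> e z = B ` e y"
    "\<kappa> \<noteq> 0" "\<forall>v\<in>topspace V. B v = sc \<kappa> (A (B (A v)))"
proof -
  obtain \<rho> where act: "group_action PGL2 (proj sc (topspace V)) \<rho>"
    and lin: "\<forall>g\<in>carrier PGL2. \<exists>A. linear_automorphism sc V A \<and> \<rho> g = projectivization sc (topspace V) A"
    and eq: "\<forall>g\<in>carrier PGL2. \<forall>x\<in>LP1 r. \<epsilon> (\<lambda>t. g (x t)) = \<rho> g (\<epsilon> x)"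
    by (rule action_by_automorphisms)
  have hP: "mobius halving \<in> carrier PGL2" by (rule mobius_PGL2[OF invertible_halving])
  have sP: "mobius swapping \<in> carrier PGL2" by (rule mobius_PGL2[OF invertible_swapping])
  obtain A where A: "linear_automorphism sc V A" "\<rho> (mobius halving) = projectivization sc (topspace V) A"
    using bspec[OF lin hP] by blast
  obtain B where B: "linear_automorphism sc V B" "\<rho> (mobius swapping) = projectivization sc (topspace V) B"
    using bspec[OF lin sP] by blast
  have pr: "projectivization sc (topspace V) C X = C ` X" if "X \<in> proj sc (topspace V)" for C X
    using that by (simp add: projectivization_def)
  have eA: "e (LC_scale (1/2) y) = A ` e y" if y: "y \<in> LC r" for y
  proof -
    have "e (LC_scale (1/2) y) = \<epsilon> (\<lambda>t. mobius halving (affine_point (y t)))"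
      unfolding e_def LC_scale_def halving_affine ..
    also have "\<dots> = \<rho> (mobius halving) (e y)"
      using bspec[OF bspec[OF eq hP] affine_LP1[OF y]] unfolding e_def .
    also have "\<dots> = A ` e y"
      unfolding A(2) e_def by (rule pr[OF \<epsilon>_proj[OF affine_LP1[OF y]]])
    finally show ?thesis .
  qed
  have eB: "e z = B ` e y" if y: "y \<in> LC r" and yz: "\<And>t. y t * z t = 1" for y z
  proof -
    have "e z = \<epsilon> (\<lambda>t. mobius swapping (affine_point (y t)))"
      unfolding e_def swapping_affine[OF yz] ..
    also have "\<dots> = \<rho> (mobius swapping) (e y)"
      using bspec[OF bspec[OF eq sP] affine_LP1[OF y]] unfolding e_def .
    also have "\<dots> = B ` e y"
      unfolding B(2) e_def by (rule pr[OF \<epsilon>_proj[OF affine_LP1[OF y]]])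
    finally show ?thesis .
  qed
  have line_proj: "line sc v \<in> proj sc (topspace V)" if "v \<in> topspace V" "v \<noteq> 0" for v
    using that by (auto simp: proj_def)
  \<comment> \<open>At first only pointwise, with a scalar depending on \<open>v\<close>;
    \<open>projectively_equal\<close> then makes it constant.\<close>
  have ABA: "\<exists>c. B v = sc c (A (B (A v)))" if v: "v \<in> topspace V" for v
  proof (cases "v = 0")
    case True
    have "B v = 0" unfolding linear_automorphism_zero_iff[OF B(1) v] by (rule True)
    then show ?thesis by (intro exI[of _ 0]) simp
  next
    case False
    note Av = linear_automorphism_E[OF A(1) v]
    note BAv = linear_automorphism_E[OF B(1) Av]
    have nz: "A v \<noteq> 0" "B (A v) \<noteq> 0"
      using False linear_automorphism_zero_iff[OF A(1) v] linear_automorphism_zero_iff[OF B(1) Av] by simp_all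
    have sh: "mobius swapping \<otimes>\<^bsub>PGL2\<^esub> mobius halving \<in> carrier PGL2"
      unfolding PGL2_mult[OF invertible_swapping invertible_halving]
      by (rule mobius_PGL2[OF invertible_mult[OF invertible_swapping invertible_halving]])
    have "\<rho> (mobius swapping) (line sc v) =
        \<rho> (mobius halving) (\<rho> (mobius swapping) (\<rho> (mobius halving) (line sc v)))"
      using group_action.composition_rule[OF act line_proj[OF v False] hP sh]
        group_action.composition_rule[OF act line_proj[OF v False] sP hP]
      unfolding halving_swapping_halving by simp
    then have "line sc (B v) = line sc (A (B (A v)))"
      unfolding A(2) B(2) pr[OF line_proj[OF v False]] image_of_line[OF A(1) v] image_of_line[OF B(1) v]
        pr[OF line_proj[OF Av nz(1)]] image_of_line[OF B(1) Av] pr[OF line_proj[OF BAv nz(2)]] image_of_line[OF A(1) BAv] .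
    then have "B v \<in> line sc (A (B (A v)))" using in_line[of "B v"] by simp
    then show ?thesis unfolding line_def by blast
  qed
  obtain v1 where v1: "v1 \<in> topspace V" "v1 \<noteq> 0"
    using e_line[OF smooth_loops_in_LC[OF r zero_smooth]] by blast
  have Al: "clinear_on sc sc (topspace V) A" and Bl: "clinear_on sc sc (topspace V) B"
    using A(1) B(1) by (simp_all add: linear_automorphism_def)
  have ABAl: "clinear_on sc sc (topspace V) (\<lambda>v. A (B (A v)))"
    using Al Bl linear_automorphism_E[OF A(1)] linear_automorphism_E[OF B(1)] unfolding clinear_on_def by simp
  have ABA0: "v = 0" if v: "v \<in> topspace V" and z: "A (B (A v)) = 0" for v
  proof -
    note Av = linear_automorphism_E[OF A(1) v]
    show ?thesis
      using z linear_automorphism_zero_iff[OF A(1) linear_automorphism_E[OF B(1) Av]]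
        linear_automorphism_zero_iff[OF B(1) Av] linear_automorphism_zero_iff[OF A(1) v] by simp
  qed
  have "\<exists>\<kappa>. \<forall>v\<in>topspace V. B v = sc \<kappa> (A (B (A v)))"
    by (rule projectively_equal[OF Bl ABAl ABA0 ABA v1]) blast+
  then obtain \<kappa> where \<kappa>: "\<forall>v\<in>topspace V. B v = sc \<kappa> (A (B (A v)))" by blast
  have "\<kappa> \<noteq> 0"
  proof
    assume "\<kappa> = 0"
    then have "B v1 = 0" using bspec[OF \<kappa> v1(1)] by simp
    then show False using v1 linear_automorphism_zero_iff[OF B(1) v1(1)] by simp
  qed
  show ?thesis
  proof (rule that[OF A(1) B(1) _ _ \<open>\<kappa> \<noteq> 0\<close> \<kappa>])
    show "\<forall>y\<in>LC r. e (LC_scale (1/2) y) = A ` e y" by (rule ballI, rule eA)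
    show "\<forall>y\<in>LC r. \<forall>z. (\<forall>t. y t * z t = 1) \<longrightarrow> e z = B ` e y"
      by (rule ballI, rule allI, rule impI, rule eB) simp_all
  qed
qed

end

section \<open>The differential at the constant loop\<close>

context chart_embedding_derivative
begin

text \<open>Specialises the difference quotient at the loop 0 to the steps at which the linear
  relation is available; the summand \<open>v0\<close> cancels.\<close>

lemma differential_as_sequential_limit:
  assumes zD: "(\<lambda>t. 0) \<in> D0" and z: "z \<in> smooth_loops" and \<mu>: "continuous_functional sc V \<mu>"
  shows "(\<lambda>j. 2 ^ j * (\<mu> (v0 + F0 (LC_scale ((1/2) ^ j) z)) - \<mu> (v0 + F0 (\<lambda>t. 0)))) \<longlonglongrightarrow> \<mu> (df (\<lambda>t. 0) z)"
proof -
  have zs: "(\<lambda>t. 0) \<in> smooth_loops" by (rule zero_smooth)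
  have "filterlim (\<lambda>j. (1/2 :: real) ^ j) (at 0) sequentially"
  proof (rule filterlim_atI)
    show "(\<lambda>j. (1/2 :: real) ^ j) \<longlonglongrightarrow> 0" by (rule LIMSEQ_power_zero) simp
  qed simp
  from filterlim_compose[OF directional[OF zD zs z \<mu>] this]
  have l1: "(\<lambda>j. (\<mu> (F0 (loop_comb (\<lambda>t. 0) z (1, of_real ((1/2) ^ j)))) - \<mu> (F0 (\<lambda>t. 0))) / of_real ((1/2) ^ j))
      \<longlonglongrightarrow> \<mu> (df (\<lambda>t. 0) z)" .
  have lc: "loop_comb (\<lambda>t. 0) z (1, h) = LC_scale h z" for h
    by (simp add: loop_comb_def LC_scale_def fun_eq_iff)
  have "continuous_on UNIV (\<lambda>h::complex. (1::complex, h))" by (intro continuous_intros)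
  from open_vimage[OF D0_plane_open[OF zs z] this]
  have op: "open {h. LC_scale h z \<in> D0}" by (simp only: vimage_def mem_Collect_eq lc)
  have "LC_scale 0 z = (\<lambda>t. 0)" by (simp add: LC_scale_def)
  then have mem: "0 \<in> {h. LC_scale h z \<in> D0}" using zD by (simp only: mem_Collect_eq)
  have "(\<lambda>j. (1/2 :: complex) ^ j) \<longlonglongrightarrow> 0" by (rule LIMSEQ_power_zero) simp
  from topological_tendstoD[OF this op mem]
  have ev: "\<forall>\<^sub>F j in sequentially. LC_scale ((1/2) ^ j) z \<in> D0" by (simp only: mem_Collect_eq)
  have half: "(x - y) / (1/2) ^ j = 2 ^ j * (a + x - (a + y))" for x y a :: complex and j
    by (simp add: power_one_over)
  show ?thesis
  proof (rule Lim_transform_eventually[OF l1], rule eventually_mono[OF ev])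
    fix j assume j: "LC_scale ((1/2) ^ j) z \<in> D0"
    have h: "complex_of_real ((1/2) ^ j) = (1/2) ^ j" by simp
    show "(\<mu> (F0 (loop_comb (\<lambda>t. 0) z (1, of_real ((1/2) ^ j)))) - \<mu> (F0 (\<lambda>t. 0))) / of_real ((1/2) ^ j)
        = 2 ^ j * (\<mu> (v0 + F0 (LC_scale ((1/2) ^ j) z)) - \<mu> (v0 + F0 (\<lambda>t. 0)))"
      unfolding lc h functional_linear(1)[OF \<mu> v0(1) F0(1)[OF j]] functional_linear(1)[OF \<mu> v0(1) F0(1)[OF zD]]
      by (rule half)
  qed
qed

lemma differential_of_combination:
  fixes z :: "nat \<Rightarrow> real \<Rightarrow> complex"
  assumes zD: "(\<lambda>t. 0) \<in> D0" and z: "\<And>i. z i \<in> smooth_loops"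
  shows "(\<lambda>t. \<Sum>i<m. W i * z i t) \<in> smooth_loops \<and>
    (\<forall>\<mu>. continuous_functional sc V \<mu> \<longrightarrow>
      \<mu> (df (\<lambda>t. 0) (\<lambda>t. \<Sum>i<m. W i * z i t)) = (\<Sum>i<m. W i * \<mu> (df (\<lambda>t. 0) (z i))))"
proof -
  have zs: "(\<lambda>t. 0) \<in> smooth_loops" by (rule zero_smooth)
  have lin1: "df (\<lambda>t. 0) (x + y) = df (\<lambda>t. 0) x + df (\<lambda>t. 0) y"
    if "x \<in> topspace (LC_topology r)" "y \<in> topspace (LC_topology r)" for x y
    using bspec[OF df_linear zD] that unfolding clinear_on_def by blast
  have lin2: "df (\<lambda>t. 0) (LC_scale c x) = sc c (df (\<lambda>t. 0) x)" if "x \<in> topspace (LC_topology r)" for c x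
    using bspec[OF df_linear zD] that unfolding clinear_on_def by blast
  show ?thesis
  proof (induction m)
    case 0
    have "LC_scale 0 (\<lambda>t. 0) = (\<lambda>t. 0)" by (simp add: LC_scale_def)
    with lin2[OF smooth_topspace[OF zs], of 0] have "df (\<lambda>t. 0) (\<lambda>t. 0) = 0"
      using df_E[OF zD zs] by simp
    moreover have "\<mu> 0 = 0" if "continuous_functional sc V \<mu>" for \<mu>
      using functional_linear(2)[OF that E_0, of 0] by simp
    ultimately show ?case using zs by simp
  next
    case (Suc m)
    let ?Z = "\<lambda>t. \<Sum>i<m. W i * z i t"
    have Zm: "?Z \<in> smooth_loops" using Suc by (rule conjunct1)
    have eq: "(\<lambda>t. \<Sum>i<Suc m. W i * z i t) = ?Z + LC_scale (W m) (z m)"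
      by (simp add: fun_eq_iff LC_scale_def)
    have wz: "LC_scale (W m) (z m) \<in> smooth_loops" by (rule smooth_loops_scale[OF z])
    have 1: "?Z + LC_scale (W m) (z m) \<in> smooth_loops"
      using smooth_loops_lincomb[OF Zm wz, of 1 1] by (simp only: mult_1_left plus_fun_def)
    have 2: "df (\<lambda>t. 0) (?Z + LC_scale (W m) (z m)) = df (\<lambda>t. 0) ?Z + sc (W m) (df (\<lambda>t. 0) (z m))"
      by (simp only: lin1[OF smooth_topspace[OF Zm] smooth_topspace[OF wz]] lin2[OF smooth_topspace[OF z]])
    show ?case unfolding eq 2
    proof (intro conjI allI impI 1)
      fix \<mu> assume \<mu>: "continuous_functional sc V \<mu>"
      have "\<mu> (df (\<lambda>t. 0) ?Z + sc (W m) (df (\<lambda>t. 0) (z m))) = \<mu> (df (\<lambda>t. 0) ?Z) + W m * \<mu> (df (\<lambda>t. 0) (z m))"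
        by (simp only: functional_linear(1)[OF \<mu> df_E[OF zD Zm] E_scale[OF df_E[OF zD z]]]
            functional_linear(2)[OF \<mu> df_E[OF zD z]])
      also have "\<mu> (df (\<lambda>t. 0) ?Z) = (\<Sum>i<m. W i * \<mu> (df (\<lambda>t. 0) (z i)))"
        by (rule mp[OF spec[OF conjunct2[OF Suc]] \<mu>])
      finally show "\<mu> (df (\<lambda>t. 0) ?Z + sc (W m) (df (\<lambda>t. 0) (z m))) = (\<Sum>i<Suc m. W i * \<mu> (df (\<lambda>t. 0) (z i)))"
        by simp
    qed
  qed
qed

lemma germ_at_constant_loop_False:
  assumes zD: "(\<lambda>t. 0) \<in> D0"
  shows False
proof -
  obtain A B \<kappa> where A: "linear_automorphism sc V A" and B: "linear_automorphism sc V B"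
    and eA: "\<forall>y\<in>LC r. e (LC_scale (1/2) y) = A ` e y"
    and eB: "\<forall>y\<in>LC r. \<forall>z. (\<forall>t. y t * z t = 1) \<longrightarrow> e z = B ` e y"
    and \<kappa>: "\<kappa> \<noteq> 0" and BABA: "\<forall>v\<in>topspace V. B v = sc \<kappa> (A (B (A v)))"
    by (rule lifts)
  obtain Ai where Ai: "clinear_on sc sc (topspace V) Ai" "continuous_map V V Ai"
    "\<forall>v\<in>topspace V. A (Ai v) = v" "\<forall>v\<in>topspace V. Ai (A v) = v"
    by (rule linear_automorphism_inverse[OF complex_subspace_axioms A])
  have AB: "clinear_on sc sc (topspace V) A" "continuous_map V V A"
    "clinear_on sc sc (topspace V) B" "continuous_map V V B"
    using A B homeomorphic_imp_continuous_map unfolding linear_automorphism_def by blast+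
  have AiE: "Ai v \<in> topspace V" if "v \<in> topspace V" for v
    using continuous_map_image_subset_topspace[OF Ai(2)] that by blast
  let ?L = "Collect (continuous_functional sc V)"
  \<comment> \<open>The chart domain is cut down to smooth loops, the only ones on which the germ is
    studied.\<close>
  let ?D = "D0 \<inter> smooth_loops"
  let ?f = "\<lambda>y. v0 + F0 y"
  have zs: "(\<lambda>t. 0) \<in> smooth_loops" by (rule zero_smooth)
  have sLC: "y \<in> LC r" if "y \<in> smooth_loops" for y by (rule smooth_loops_in_LC[OF r that])
  have fE: "?f y \<in> topspace V" if "y \<in> D0" for y by (rule E_add[OF v0(1) F0(1)[OF that]])
  have fl: "l (?f y) = 1" if "y \<in> D0" for y
    using functional_linear(1)[OF l v0(1) F0(1)[OF that]] F0(2)[OF that] v0(2) by simp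
  have l0: "l 0 = 0" using functional_linear(2)[OF l E_0, of 0] by simp
  have f0: "?f (\<lambda>t. 0) \<noteq> 0" using fl[OF zD] l0 by auto
  \<comment> \<open>Halving fixes the loop 0, so \<open>A\<close> preserves the line over it;
    \<open>\<alpha>\<close> is the eigenvalue.\<close>
  obtain \<alpha> where \<alpha>: "A (?f (\<lambda>t. 0)) = sc \<alpha> (?f (\<lambda>t. 0))"
  proof -
    have "LC_scale (1/2) (\<lambda>t. 0) = (\<lambda>t. 0)" by (simp add: LC_scale_def)
    then have "e (\<lambda>t. 0) = A ` e (\<lambda>t. 0)" using bspec[OF eA sLC[OF zs]] by simp
    then have "line sc (?f (\<lambda>t. 0)) = line sc (A (?f (\<lambda>t. 0)))"
      unfolding F0(3)[OF zD] image_of_line[OF A fE[OF zD]] .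
    then have "A (?f (\<lambda>t. 0)) \<in> line sc (?f (\<lambda>t. 0))" using in_line by simp
    then show ?thesis using that unfolding line_def by blast
  qed
  have \<alpha>0: "\<alpha> \<noteq> 0"
  proof
    assume "\<alpha> = 0"
    then have "A (?f (\<lambda>t. 0)) = 0" using \<alpha> by simp
    then show False using linear_automorphism_zero_iff[OF A fE[OF zD]] f0 by simp
  qed
  interpret G: equivariant_germ sc "topspace V" ?L ?D ?f e l A Ai B \<alpha> \<kappa>
  proof (intro equivariant_germ.intro equivariant_germ_axioms.intro complex_subspace_axioms AB(1,3) Ai(1) \<kappa> \<alpha> \<alpha>0 AiE)
    show "clinear_on sc (*) (topspace V) \<mu>" if "\<mu> \<in> ?L" for \<mu>
      using that by (simp add: continuous_functional_def)
    show "v = 0" if "v \<in> topspace V" "\<And>\<mu>. \<mu> \<in> ?L \<Longrightarrow> \<mu> v = 0" for v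
      by (rule continuous_functionals_separate[OF V that(1)]) (rule that(2), rule CollectI)
    show "(\<lambda>v. \<mu> (A v)) \<in> ?L" "(\<lambda>v. \<mu> (Ai v)) \<in> ?L" "(\<lambda>v. \<mu> (B v)) \<in> ?L" if "\<mu> \<in> ?L" for \<mu>
      using that continuous_functional_compose[OF _ AB(1,2)] continuous_functional_compose[OF _ Ai(1,2)]
        continuous_functional_compose[OF _ AB(3,4)] by simp_all
    show "l \<in> ?L" using l by simp
    show "A v \<in> topspace V" "B v \<in> topspace V" if "v \<in> topspace V" for v
      using linear_automorphism_E A B that by blast+
    show "A (Ai v) = v" "Ai (A v) = v" if "v \<in> topspace V" for v using Ai(3,4) that by blast+
    show "v = 0" if "v \<in> topspace V" "B v = 0" for v using linear_automorphism_zero_iff[OF B that(1)] that(2) by simp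
    \<comment> \<open>The relation between \<open>B\<close> and \<open>A B A\<close>, evaluated at
      \<open>Ai v\<close>.\<close>
    show "B (Ai v) = sc \<kappa> (A (B v))" if "v \<in> topspace V" for v
      using bspec[OF BABA AiE[OF that]] bspec[OF Ai(3) that] by simp
    show "(\<lambda>t. 0) \<in> ?D" using zD zs by simp
    show "?D \<subseteq> smooth_loops" by simp
    show "?f y \<in> topspace V" "l (?f y) = 1" "e y = line sc (?f y)" if "y \<in> ?D" for y
      using fE fl F0(3) that by blast+
    show "e (LC_scale (1/2) y) = A ` e y" if "y \<in> smooth_loops" for y by (rule bspec[OF eA sLC[OF that]])
    show "e z = B ` e y" if "y \<in> smooth_loops" "z \<in> smooth_loops" "\<And>t. y t * z t = 1" for y z
      using bspec[OF eB sLC[OF that(1)]] that(3) by blast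
    show "\<exists>v\<in>topspace V. v \<noteq> 0 \<and> e y = line sc v" if "y \<in> smooth_loops" for y by (rule e_line[OF sLC[OF that]])
    have D: "{c. loop_comb y z c \<in> ?D} = {c. loop_comb y z c \<in> D0}" if "y \<in> smooth_loops" "z \<in> smooth_loops" for y z
      using loop_comb_smooth[OF that] by simp
    show "open {c. loop_comb y z c \<in> ?D}" if "y \<in> smooth_loops" "z \<in> smooth_loops" for y z
      unfolding D[OF that] by (rule D0_plane_open[OF that])
    show "hol2 {c. loop_comb y z c \<in> ?D} (\<lambda>c. \<mu> (?f (loop_comb y z c)))"
      if "y \<in> smooth_loops" "z \<in> smooth_loops" "\<mu> \<in> ?L" for y z \<mu>
      unfolding D[OF that(1,2)] by (rule F0_hol2[OF that(1,2) CollectD[OF that(3)]])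
  qed
  obtain M :: nat and W s where M: "0 < M" and inj: "inj_on s {..<M}"
    and W: "\<forall>i. W i \<noteq> 0" and s: "\<forall>i. cmod (s i) = 1/2"
    and R: "\<forall>\<mu>\<in>?L. \<forall>d. (\<forall>i. (\<lambda>j. 2 ^ j * (\<mu> (?f (LC_scale ((1/2) ^ j) (\<lambda>t. inverse (1 + s i * cis (2 * pi * t)))))
        - \<mu> (?f (\<lambda>t. 0)))) \<longlonglongrightarrow> d i) \<longrightarrow> (\<Sum>i<M. W i * d i) = 0"
    using G.first_order_relation by (elim exE conjE)
  let ?z = "\<lambda>i t. inverse (1 + s i * cis (2 * pi * t))"
  have z: "?z i \<in> smooth_loops" for i
    by (rule smooth_loops_circle_inverse(2)) (simp add: s)
  have lim: "(\<lambda>j. 2 ^ j * (\<mu> (?f (LC_scale ((1/2) ^ j) (?z i))) - \<mu> (?f (\<lambda>t. 0)))) \<longlonglongrightarrow> \<mu> (df (\<lambda>t. 0) (?z i))"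
    if \<mu>: "continuous_functional sc V \<mu>" for \<mu> i
    by (rule differential_as_sequential_limit[OF zD z \<mu>])
  let ?Z = "\<lambda>m t. \<Sum>i<m. W i * ?z i t"
  note Z = differential_of_combination[where z = ?z, OF zD z]
  have ZM: "?Z M \<in> smooth_loops" using Z by (rule conjunct1)
  \<comment> \<open>The relation holds under every continuous functional, hence in \<open>V\<close>:
    the differential kills a combination of the inverse loops.\<close>
  have "df (\<lambda>t. 0) (?Z M) = 0"
  proof (rule continuous_functionals_separate[OF V df_E[OF zD ZM]])
    fix \<mu> assume \<mu>: "continuous_functional sc V \<mu>"
    have "\<mu> (df (\<lambda>t. 0) (?Z M)) = (\<Sum>i<M. W i * \<mu> (df (\<lambda>t. 0) (?z i)))"
      by (rule mp[OF spec[OF conjunct2[OF Z]] \<mu>])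
    also have "\<dots> = 0"
    proof -
      have "\<mu> \<in> ?L" using \<mu> by (simp only: mem_Collect_eq)
      from mp[OF spec[OF bspec[OF R this], of "\<lambda>i. \<mu> (df (\<lambda>t. 0) (?z i))"]]
      show ?thesis using lim[OF \<mu>] by (simp only: simp_thms)
    qed
    finally show "\<mu> (df (\<lambda>t. 0) (?Z M)) = 0" .
  qed
  then have dz: "has_directional_derivative LC_scale sc ker_top F0 (\<lambda>t. 0) (?Z M) 0"
    using bspec[OF bspec[OF df zD] smooth_topspace[OF ZM]] by simp
  have "\<forall>a\<in>LP1_charts r. \<forall>b\<in>proj_charts sc V. \<forall>y\<in>chart_domain a b \<epsilon>. \<forall>\<xi>\<in>topspace (fst a).
      has_directional_derivative LC_scale sc (fst b) (in_charts a b \<epsilon>) y \<xi> 0 \<longrightarrow> \<xi> = 0"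
    using emb unfolding holomorphic_embedding_def injective_differential_def by blast
  from bspec[OF bspec[OF this affine_chart] proj_chart]
  have "\<forall>y\<in>D0. \<forall>\<xi>\<in>topspace (LC_topology r). has_directional_derivative LC_scale sc ker_top F0 y \<xi> 0 \<longrightarrow> \<xi> = 0"
    unfolding D0_def F0_def fst_conv .
  from mp[OF bspec[OF bspec[OF this zD] smooth_topspace[OF ZM]]] have "?Z M = 0" using dz .
  then have "\<forall>t. (\<Sum>i<M. W i * inverse (1 + s i * cis (2 * pi * t))) = 0"
    by (simp add: fun_eq_iff)
  then show False by (rule partial_fractions_independent[where M = M and W = W and s = s, OF M inj spec[OF W] s])
qed

end

theorem mainTheorem4:
  fixes r :: smoothness
    and scale :: "complex \<Rightarrow> 'v::ab_group_add \<Rightarrow> 'v"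
    and V :: "'v topology"
  assumes "admissible r"
    and "complex_frechet_space scale V"
  shows "\<not> (\<exists>\<epsilon>. holomorphic_embedding LC_scale (LP1 r) (LP1_charts r)
                    scale (proj scale (topspace V)) (proj_charts scale V) \<epsilon> \<and>
                 equivariant r scale V \<epsilon>)"
proof
  assume "\<exists>\<epsilon>. holomorphic_embedding LC_scale (LP1 r) (LP1_charts r)
                    scale (proj scale (topspace V)) (proj_charts scale V) \<epsilon> \<and>
                 equivariant r scale V \<epsilon>"
  then obtain \<epsilon> where \<epsilon>: "holomorphic_embedding LC_scale (LP1 r) (LP1_charts r)
      scale (proj scale (topspace V)) (proj_charts scale V) \<epsilon>" "equivariant r scale V \<epsilon>"
    by (elim exE conjE)
  interpret equivariant_loop_embedding r scale V \<epsilon>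
    by (rule equivariant_loop_embedding.intro[OF assms \<epsilon>])
  obtain l v0 w where l: "continuous_functional scale V l" "v0 \<in> topspace V" "l v0 = 1"
    and w: "w \<in> topspace V" "l w = 0" "e (\<lambda>t. 0) = line scale (v0 + w)"
    by (rule chart_exists)
  interpret chart_embedding r scale V \<epsilon> l v0
    by (rule chart_embedding.intro[OF equivariant_loop_embedding_axioms chart_embedding_axioms.intro[OF l]])
  obtain df where df: "\<forall>x\<in>D0. \<forall>\<xi>\<in>topspace (LC_topology r). has_directional_derivative LC_scale scale ker_top F0 x \<xi> (df x \<xi>)"
    "\<forall>x\<in>D0. clinear_on LC_scale scale (topspace (LC_topology r)) (df x)"
    "continuous_map (prod_topology (subtopology (LC_topology r) D0) (LC_topology r)) ker_top (\<lambda>(x, \<xi>). df x \<xi>)"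
    using F0_holomorphic unfolding holomorphic_between_def by (elim exE conjE)
  interpret chart_embedding_derivative r scale V \<epsilon> l v0 df
    by (rule chart_embedding_derivative.intro[OF chart_embedding_axioms chart_embedding_derivative_axioms.intro[OF df]])
  have "(\<lambda>t. 0) \<in> D0"
    unfolding D0_iff using w smooth_loops_in_LC[OF assms(1) zero_smooth] by blast
  then show False by (rule germ_at_constant_loop_False)
qed

end
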